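(* Let $\Gamma$ be a finite index subgroup of $\mathrm{SL}_2(\mathbf Z)$, and let $\varphi_\Gamma:\mathbf Z[\Gamma\backslash\mathrm{PSL}_2(\mathbf Z)]\to\mathbf Z[\mathcal C_\Gamma]_0$ be the group homomorphism $\varphi_\Gamma([\Gamma g])=(\Gamma g\infty)$. (1) The cokernel of $\tilde\xi_\Gamma$ is canonically isomorphic to the cokernel of the restriction of $\varphi_\Gamma$ to $\mathbf Z[\Gamma\backslash\mathrm{PSL}_2(\mathbf Z)]^U$. (2) Let $p\ge5$ be a prime and $n\ge1$ an integer. If $\Gamma=\Gamma_1(p^n)$ or $\Gamma=\Gamma_0(p^n)$, then the image of $\tilde\xi_\Gamma$ has index dividing $3$ in $\tilde{\mathcal M}_\Gamma$, the index being $1$ if and only if $p\equiv1\pmod3$ and $\Gamma=\Gamma_0(p^n)$. (3) The kernel of $\tilde\xi_\Gamma$ is spanned by the following two subgroups of $\mathbf Z[\Gamma\backslash\mathrm{PSL}_2(\mathbf Z)]$: the subgroup $\mathbf Z[\Gamma\backslash\mathrm{PSL}_2(\mathbf Z)]^S$, and the kernel of the restriction of $\varphi_\Gamma$ to $\mathbf Z[\Gamma\backslash\mathrm{PSL}_2(\mathbf Z)]^U$.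
   Context: $T=\begin{pmatrix}1&1\\0&1\end{pmatrix}$, $S=\begin{pmatrix}0&-1\\1&0\end{pmatrix}$, $U=\begin{pmatrix}1&-1\\1&0\end{pmatrix}$. For $g\in\mathrm{SL}_2(\mathbf Z)$, $\mathbf Z[\Gamma\backslash\mathrm{PSL}_2(\mathbf Z)]^g$ is the subgroup of elements fixed by right multiplication by $g$. Mixed modular symbols: $\tilde{\mathcal M}$ is the torsion-free abelian group generated by symbols $\{g,g'\}$, $(g,g')\in\mathrm{SL}_2(\mathbf Z)^2$, subject to: $\{g,g'\}+\{g',g''\}+\{g'',g\}=0$; $\{g,g'\}=\{\epsilon_1 g,\epsilon_2 g'\}$ for $\epsilon_1,\epsilon_2\in\{1,-1\}$; $\{g,gT^m\}=m\cdot\{g,gT\}$ for $m\in\mathbf Z$ (the quotient of the free abelian group by these relations, modulo torsion). $\mathrm{SL}_2(\mathbf Z)$ acts by $g\cdot\{g',g''\}=\{gg',gg''\}$, and $\tilde{\mathcal M}_\Gamma$ is the largest torsion-free quotient of $\tilde{\mathcal M}$ on which $\Gamma$ acts trivially. The Manin map $\tilde\xi_\Gamma:\mathbf Z[\Gamma\backslash\mathrm{PSL}_2(\mathbf Z)]\to\tilde{\mathcal M}_\Gamma$ is $\tilde\xi_\Gamma([\Gamma g])=\{g,gS\}$. $\mathcal C_\Gamma=\Gamma\backslash\mathbf P^1(\mathbf Q)$ is the set of cusps, $e_c$ the width of the cusp $c$, $d_\Gamma=\gcd(e_c)_{c\in\mathcal C_\Gamma}$. $\mathbf Z[\mathcal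 C_\Gamma]_0$ is the quotient of $\mathbf Z[\mathcal C_\Gamma]$ by the subgroup generated by $\frac1{d_\Gamma}\sum_{c}e_c\cdot[c]$, and $(c)$ is the image of $[c]$ in it. There is a canonical injection $\mathbf Z[\mathcal C_\Gamma]_0\hookrightarrow\tilde{\mathcal M}_\Gamma$, $(\Gamma g\infty)\mapsto\{g,gT\}$. *)

theory Defs
  imports
    "HOL-Analysis.Determinants"
    "HOL-Algebra.Free_Abelian_Groups"
    "HOL-Algebra.Group_Action"
    "HOL-Number_Theory.Cong"
begin

definition torsion :: "('a, 'b) monoid_scheme \<Rightarrow> 'a set" where
  "torsion G = {x \<in> carrier G. \<exists>n::nat. n > 0 \<and> x [^]\<^bsub>G\<^esub> n = \<one>\<^bsub>G\<^esub>}"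

text \<open>The largest torsion-free quotient of the abelian group \<open>G\<close> in which the elements of the
  subgroup \<open>H\<close> become trivial, and the projection of \<open>G\<close> to it.\<close>

definition tf_quotient :: "('a, 'b) monoid_scheme \<Rightarrow> 'a set \<Rightarrow> 'a set set monoid" where
  "tf_quotient G H = (G Mod H) Mod torsion (G Mod H)"

definition tf_proj :: "('a, 'b) monoid_scheme \<Rightarrow> 'a set \<Rightarrow> 'a \<Rightarrow> 'a set set" where
  "tf_proj G H x = torsion (G Mod H) #>\<^bsub>G Mod H\<^esub> (H #>\<^bsub>G\<^esub> x)"

definition cokernel ::
    "('a, 'm) monoid_scheme \<Rightarrow> ('b, 'n) monoid_scheme \<Rightarrow> ('a \<Rightarrow> 'b) \<Rightarrow> 'b set monoid" where
  "cokernel G H f = H Mod (f ` carrier G)"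

definition coker_proj ::
    "('a, 'm) monoid_scheme \<Rightarrow> ('b, 'n) monoid_scheme \<Rightarrow> ('a \<Rightarrow> 'b) \<Rightarrow> 'b \<Rightarrow> 'b set" where
  "coker_proj G H f y = (f ` carrier G) #>\<^bsub>H\<^esub> y"

text \<open>The homomorphism from a free abelian group to \<open>G\<close> with prescribed values \<open>f\<close> on the basis.\<close>

definition frag_lift :: "('a, 'b) monoid_scheme \<Rightarrow> ('c \<Rightarrow> 'a) \<Rightarrow> ('c \<Rightarrow>\<^sub>0 int) \<Rightarrow> 'a" where
  "frag_lift G f x =
     (\<Otimes>\<^bsub>G\<^esub>i\<in>Poly_Mapping.keys x. f i [^]\<^bsub>G\<^esub> Poly_Mapping.lookup x i)"

type_synonym imat2 = "int ^ 2 ^ 2"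

definition mat2 :: "int \<Rightarrow> int \<Rightarrow> int \<Rightarrow> int \<Rightarrow> imat2" where
  "mat2 a b c d = vector [vector [a, b], vector [c, d]]"

definition SL2Z :: "imat2 monoid" where
  "SL2Z = \<lparr>carrier = {A. det A = 1}, mult = (**), one = mat 1\<rparr>"

definition matT :: imat2 where "matT = mat2 1 1 0 1"
definition matS :: imat2 where "matS = mat2 0 (-1) 1 0"
definition matU :: imat2 where "matU = mat2 1 (-1) 1 0"

definition Gamma0 :: "nat \<Rightarrow> imat2 set" where
  "Gamma0 N = {A \<in> carrier SL2Z. [A $ 2 $ 1 = 0] (mod int N)}"

definition Gamma1 :: "nat \<Rightarrow> imat2 set" where
  "Gamma1 N = {A \<in> carrier SL2Z. [A $ 2 $ 1 = 0] (mod int N) \<and>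
     [A $ 1 $ 1 = 1] (mod int N) \<and> [A $ 2 $ 2 = 1] (mod int N)}"

definition PSL2Z :: "imat2 set monoid" where
  "PSL2Z = SL2Z Mod {mat 1, - mat 1}"

definition psl :: "imat2 \<Rightarrow> imat2 set" where
  "psl g = {mat 1, - mat 1} #>\<^bsub>SL2Z\<^esub> g"

text \<open>The class of \<open>g\<close> in the quotient of \<open>PSL\<^sub>2(Z)\<close> by left multiplication by \<open>\<Gamma>\<close>. This
  quotient is the set of right cosets of the image of \<open>\<Gamma>\<close>.\<close>

definition Gcoset :: "imat2 set \<Rightarrow> imat2 \<Rightarrow> imat2 set set" where
  "Gcoset \<Gamma> g = (psl ` \<Gamma>) #>\<^bsub>PSL2Z\<^esub> psl g"

definition ZPSL :: "imat2 set \<Rightarrow> (imat2 set set \<Rightarrow>\<^sub>0 int) monoid" where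
  "ZPSL \<Gamma> = free_Abelian_group (rcosets\<^bsub>PSL2Z\<^esub> (psl ` \<Gamma>))"

definition rmul :: "imat2 \<Rightarrow> (imat2 set set \<Rightarrow>\<^sub>0 int) \<Rightarrow> (imat2 set set \<Rightarrow>\<^sub>0 int)" where
  "rmul g = frag_extend (\<lambda>C. frag_of (C #>\<^bsub>PSL2Z\<^esub> psl g))"

definition ZPSL_inv :: "imat2 set \<Rightarrow> imat2 \<Rightarrow> (imat2 set set \<Rightarrow>\<^sub>0 int) monoid" where
  "ZPSL_inv \<Gamma> g = (ZPSL \<Gamma>)\<lparr>carrier := invariants (carrier (ZPSL \<Gamma>)) rmul g\<rparr>"

text \<open>\<open>P\<^sup>1(Q)\<close>, with \<open>None\<close> as the point at infinity.\<close>

type_synonym p1q = "rat option"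

definition moebius :: "imat2 \<Rightarrow> p1q \<Rightarrow> p1q" where
  "moebius A z =
    (let a = of_int (A $ 1 $ 1); b = of_int (A $ 1 $ 2);
         c = of_int (A $ 2 $ 1); d = of_int (A $ 2 $ 2)
     in case z of
          None \<Rightarrow> if c = 0 then None else Some (a / c)
        | Some q \<Rightarrow> if c * q + d = 0 then None else Some ((a * q + b) / (c * q + d)))"

definition cusps :: "imat2 set \<Rightarrow> p1q set set" where
  "cusps \<Gamma> = orbits (SL2Z\<lparr>carrier := \<Gamma>\<rparr>) UNIV moebius"

definition cusp_at :: "imat2 set \<Rightarrow> imat2 \<Rightarrow> p1q set" where
  "cusp_at \<Gamma> g = orbit (SL2Z\<lparr>carrier := \<Gamma>\<rparr>) moebius (moebius g None)"

text \<open>The width is taken in \<open>PSL\<^sub>2(Z)\<close>: it is the index, in the stabiliser of the cusp in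
  \<open>PSL\<^sub>2(Z)\<close>, of its stabiliser in the image of \<open>\<Gamma>\<close>. No distinction is made between regular
  and irregular cusps.\<close>

definition cusp_width :: "imat2 set \<Rightarrow> p1q set \<Rightarrow> nat" where
  "cusp_width \<Gamma> c = (LEAST h. h > 0 \<and> (\<exists>g \<in> carrier SL2Z. cusp_at \<Gamma> g = c \<and>
     psl (g \<otimes>\<^bsub>SL2Z\<^esub> matT [^]\<^bsub>SL2Z\<^esub> h \<otimes>\<^bsub>SL2Z\<^esub> inv\<^bsub>SL2Z\<^esub> g) \<in> psl ` \<Gamma>))"

definition width_gcd :: "imat2 set \<Rightarrow> nat" where
  "width_gcd \<Gamma> = Gcd (cusp_width \<Gamma> ` cusps \<Gamma>)"

definition Zcusps :: "imat2 set \<Rightarrow> (p1q set \<Rightarrow>\<^sub>0 int) monoid" where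
  "Zcusps \<Gamma> = free_Abelian_group (cusps \<Gamma>)"

definition Zcusps0_relations :: "imat2 set \<Rightarrow> (p1q set \<Rightarrow>\<^sub>0 int) set" where
  "Zcusps0_relations \<Gamma> = generate (Zcusps \<Gamma>)
     {\<Sum>c\<in>cusps \<Gamma>. frag_cmul (int (cusp_width \<Gamma> c div width_gcd \<Gamma>)) (frag_of c)}"

definition Zcusps0 :: "imat2 set \<Rightarrow> (p1q set \<Rightarrow>\<^sub>0 int) set monoid" where
  "Zcusps0 \<Gamma> = Zcusps \<Gamma> Mod Zcusps0_relations \<Gamma>"

definition cusp_class :: "imat2 set \<Rightarrow> p1q set \<Rightarrow> (p1q set \<Rightarrow>\<^sub>0 int) set" where
  "cusp_class \<Gamma> c = Zcusps0_relations \<Gamma> #>\<^bsub>Zcusps \<Gamma>\<^esub> frag_of c"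

type_synonym presymbol = "(imat2 \<times> imat2) \<Rightarrow>\<^sub>0 int"

definition presymbols :: "presymbol monoid" where
  "presymbols = free_Abelian_group (carrier SL2Z \<times> carrier SL2Z)"

definition symbol_relations :: "presymbol set" where
  "symbol_relations = generate presymbols
     ({frag_of (g, g') + frag_of (g', g'') + frag_of (g'', g) | g g' g''.
         g \<in> carrier SL2Z \<and> g' \<in> carrier SL2Z \<and> g'' \<in> carrier SL2Z}
    \<union> {frag_of (g, g') - frag_of (h, h') | g g' h h'.
         g \<in> carrier SL2Z \<and> g' \<in> carrier SL2Z \<and> h \<in> {g, - g} \<and> h' \<in> {g', - g'}}
    \<union> {frag_of (g, g \<otimes>\<^bsub>SL2Z\<^esub> matT [^]\<^bsub>SL2Z\<^esub> m) - frag_cmul m (frag_of (g, g \<otimes>\<^bsub>SL2Z\<^esub> matT)) | g m.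
         g \<in> carrier SL2Z \<and> m \<in> (UNIV :: int set)})"

definition MMS :: "presymbol set set monoid" where
  "MMS = tf_quotient presymbols symbol_relations"

definition mms :: "imat2 \<Rightarrow> imat2 \<Rightarrow> presymbol set set" where
  "mms g g' = tf_proj presymbols symbol_relations (frag_of (g, g'))"

text \<open>Elements of \<open>MMS\<close> are cosets of cosets of presymbols, and \<open>SL\<^sub>2(Z)\<close> acts by taking images.\<close>

definition act_presymbol :: "imat2 \<Rightarrow> presymbol \<Rightarrow> presymbol" where
  "act_presymbol g = frag_extend (\<lambda>(g', g''). frag_of (g \<otimes>\<^bsub>SL2Z\<^esub> g', g \<otimes>\<^bsub>SL2Z\<^esub> g''))"

definition act_MMS :: "imat2 \<Rightarrow> presymbol set set \<Rightarrow> presymbol set set" where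
  "act_MMS g x = (`) (act_presymbol g) ` x"

definition coinv_relations :: "imat2 set \<Rightarrow> presymbol set set set" where
  "coinv_relations \<Gamma> = generate MMS
     {act_MMS \<gamma> x \<otimes>\<^bsub>MMS\<^esub> inv\<^bsub>MMS\<^esub> x | \<gamma> x. \<gamma> \<in> \<Gamma> \<and> x \<in> carrier MMS}"

definition MMS_Gamma :: "imat2 set \<Rightarrow> presymbol set set set set monoid" where
  "MMS_Gamma \<Gamma> = tf_quotient MMS (coinv_relations \<Gamma>)"

definition mms_Gamma :: "imat2 set \<Rightarrow> imat2 \<Rightarrow> imat2 \<Rightarrow> presymbol set set set set" where
  "mms_Gamma \<Gamma> g g' = tf_proj MMS (coinv_relations \<Gamma>) (mms g g')"

text \<open>\<open>lift_cosets \<Gamma> G f\<close> is the homomorphism from \<open>ZPSL \<Gamma>\<close> to \<open>G\<close> that sends the basis element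
  \<open>[\<Gamma>g]\<close> to \<open>f g\<close>, provided that \<open>f g\<close> depends only on \<open>[\<Gamma>g]\<close>.\<close>

definition lift_cosets ::
    "imat2 set \<Rightarrow> ('a, 'b) monoid_scheme \<Rightarrow> (imat2 \<Rightarrow> 'a) \<Rightarrow> (imat2 set set \<Rightarrow>\<^sub>0 int) \<Rightarrow> 'a" where
  "lift_cosets \<Gamma> G f = frag_lift G (\<lambda>C. the_elem (f ` {g \<in> carrier SL2Z. Gcoset \<Gamma> g = C}))"

definition manin_map ::
    "imat2 set \<Rightarrow> (imat2 set set \<Rightarrow>\<^sub>0 int) \<Rightarrow> presymbol set set set set" where
  "manin_map \<Gamma> = lift_cosets \<Gamma> (MMS_Gamma \<Gamma>) (\<lambda>g. mms_Gamma \<Gamma> g (g \<otimes>\<^bsub>SL2Z\<^esub> matS))"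

definition cusp_map ::
    "imat2 set \<Rightarrow> (imat2 set set \<Rightarrow>\<^sub>0 int) \<Rightarrow> (p1q set \<Rightarrow>\<^sub>0 int) set" where
  "cusp_map \<Gamma> = lift_cosets \<Gamma> (Zcusps0 \<Gamma>) (\<lambda>g. cusp_class \<Gamma> (cusp_at \<Gamma> g))"

text \<open>The definitions above that depend on a choice or on a quotient are well defined:
  the torsion-free quotient has the expected kernel, the action is the one prescribed on symbols,
  and both maps take the prescribed values on basis elements.\<close>

lemma (in comm_group) subgroup_torsion: "subgroup (torsion G) G"
proof
  show "torsion G \<subseteq> carrier G" by (auto simp: torsion_def)
  show "\<one> \<in> torsion G" by (auto simp: torsion_def intro!: exI[of _ 1])
next
  fix x y assume "x \<in> torsion G" "y \<in> torsion G"
  then obtain m n :: nat where *: "x \<in> carrier G" "y \<in> carrier G" "m > 0" "n > 0"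
    "x [^] m = \<one>" "y [^] n = \<one>" by (auto simp: torsion_def)
  then have "x [^] (m * n) = \<one>" "y [^] (n * m) = \<one>" by (simp_all flip: nat_pow_pow)
  with * have "(x \<otimes> y) [^] (m * n) = \<one>" by (simp add: nat_pow_distrib mult.commute)
  then show "x \<otimes> y \<in> torsion G" using * unfolding torsion_def
    by (auto intro!: exI[of _ "m * n"])
next
  fix x assume "x \<in> torsion G"
  then show "inv x \<in> torsion G" by (auto simp: torsion_def nat_pow_inv)
qed

context
  fixes G :: "('a, 'b) monoid_scheme" and H
  assumes G: "comm_group G" and H: "subgroup H G"
begin

interpretation G: comm_group G by (rule G)
interpretation N: normal H G using H by (rule G.subgroup_imp_normal)
interpretation Q: comm_group "G Mod H" using H by (rule G.abelian_FactGroup)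
interpretation NQ: normal "torsion (G Mod H)" "G Mod H"
  using Q.subgroup_torsion by (rule Q.subgroup_imp_normal)

lemma comm_group_tf_quotient: "comm_group (tf_quotient G H)"
  unfolding tf_quotient_def by (rule Q.abelian_FactGroup [OF Q.subgroup_torsion])

lemma tf_proj_hom: "tf_proj G H \<in> hom G (tf_quotient G H)"
proof -
  have "tf_proj G H = (\<lambda>X. torsion (G Mod H) #>\<^bsub>G Mod H\<^esub> X) \<circ> (\<lambda>x. H #>\<^bsub>G\<^esub> x)"
    by (simp add: tf_proj_def fun_eq_iff)
  then show ?thesis
    unfolding tf_quotient_def using hom_compose[OF N.r_coset_hom_Mod NQ.r_coset_hom_Mod] by simp
qed

lemma carrier_tf_quotient: "carrier (tf_quotient G H) = tf_proj G H ` carrier G"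
  by (auto simp: tf_quotient_def carrier_FactGroup tf_proj_def)

lemma tf_proj_eq_one_iff:
  assumes "x \<in> carrier G"
  shows "tf_proj G H x = \<one>\<^bsub>tf_quotient G H\<^esub> \<longleftrightarrow> (\<exists>n::nat. n > 0 \<and> x [^]\<^bsub>G\<^esub> n \<in> H)"
proof -
  have c: "H #>\<^bsub>G\<^esub> x \<in> carrier (G Mod H)" using assms by (simp add: carrier_FactGroup)
  have pow: "H #>\<^bsub>G\<^esub> (x [^]\<^bsub>G\<^esub> n) = H \<longleftrightarrow> x [^]\<^bsub>G\<^esub> n \<in> H" for n :: nat
    using G.coset_join1[OF _ _ H] G.coset_join2[OF _ H] assms by blast
  have "tf_proj G H x = \<one>\<^bsub>tf_quotient G H\<^esub> \<longleftrightarrow> H #>\<^bsub>G\<^esub> x \<in> torsion (G Mod H)"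
    unfolding tf_proj_def tf_quotient_def
    using c Q.coset_join1 Q.coset_join2 Q.subgroup_torsion by (metis one_FactGroup subgroup.subset)
  also have "\<dots> \<longleftrightarrow> (\<exists>n::nat. n > 0 \<and> H #>\<^bsub>G\<^esub> (x [^]\<^bsub>G\<^esub> n) = H)"
    by (simp only: torsion_def mem_Collect_eq c simp_thms N.FactGroup_pow[OF assms] one_FactGroup)
  also have "\<dots> \<longleftrightarrow> (\<exists>n::nat. n > 0 \<and> x [^]\<^bsub>G\<^esub> n \<in> H)"
    by (simp only: pow)
  finally show ?thesis .
qed

lemma torsion_tf_quotient: "torsion (tf_quotient G H) = {\<one>\<^bsub>tf_quotient G H\<^esub>}"
proof -
  interpret T: comm_group "tf_quotient G H" by (rule comm_group_tf_quotient)
  interpret h: group_hom G "tf_quotient G H" "tf_proj G H"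
    by unfold_locales (rule tf_proj_hom)
  have "X = \<one>\<^bsub>tf_quotient G H\<^esub>" if X: "X \<in> torsion (tf_quotient G H)" for X
  proof -
    obtain x n where x: "x \<in> carrier G" "X = tf_proj G H x" "n > 0"
        "X [^]\<^bsub>tf_quotient G H\<^esub> (n::nat) = \<one>\<^bsub>tf_quotient G H\<^esub>"
      using X by (auto simp: torsion_def carrier_tf_quotient)
    then have "tf_proj G H (x [^]\<^bsub>G\<^esub> n) = \<one>\<^bsub>tf_quotient G H\<^esub>"
      by (simp add: h.hom_nat_pow)
    then obtain m :: nat where "m > 0" "(x [^]\<^bsub>G\<^esub> n) [^]\<^bsub>G\<^esub> m \<in> H"
      using x tf_proj_eq_one_iff[of "x [^]\<^bsub>G\<^esub> n"] by auto
    then have "n * m > 0 \<and> x [^]\<^bsub>G\<^esub> (n * m) \<in> H"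
      using x by (simp add: G.nat_pow_pow)
    then show ?thesis
      using x(1,2) tf_proj_eq_one_iff[of x] by blast
  qed
  moreover have "\<one>\<^bsub>tf_quotient G H\<^esub> \<in> torsion (tf_quotient G H)"
    using T.subgroup_torsion by (rule subgroup.one_closed)
  ultimately show ?thesis by blast
qed

lemma tf_proj_eqI:
  assumes "x \<in> carrier G" "y \<in> carrier G" "x \<otimes>\<^bsub>G\<^esub> inv\<^bsub>G\<^esub> y \<in> H"
  shows "tf_proj G H x = tf_proj G H y"
proof -
  interpret T: comm_group "tf_quotient G H" by (rule comm_group_tf_quotient)
  interpret h: group_hom G "tf_quotient G H" "tf_proj G H"
    by unfold_locales (rule tf_proj_hom)
  have "tf_proj G H (x \<otimes>\<^bsub>G\<^esub> inv\<^bsub>G\<^esub> y) = \<one>\<^bsub>tf_quotient G H\<^esub>"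
    using assms by (subst tf_proj_eq_one_iff) (auto intro!: exI[of _ 1])
  then have "tf_proj G H x \<otimes>\<^bsub>tf_quotient G H\<^esub> inv\<^bsub>tf_quotient G H\<^esub> tf_proj G H y = \<one>\<^bsub>tf_quotient G H\<^esub>"
    using assms by simp
  then show ?thesis using assms T.right_cancel[of "inv\<^bsub>tf_quotient G H\<^esub> tf_proj G H y"]
    by (metis T.inv_closed T.r_inv h.hom_closed)
qed

end

lemma (in comm_group) frag_lift_hom:
  assumes f: "f \<in> S \<rightarrow> carrier G"
  shows "frag_lift G f \<in> hom (free_Abelian_group S) G"
proof -
  have ext: "frag_lift G f x = (\<Otimes>i\<in>A. f i [^] Poly_Mapping.lookup x i)"
    if "finite A" "Poly_Mapping.keys x \<subseteq> A" "A \<subseteq> S" for x A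
    unfolding frag_lift_def
    by (rule finprod_mono_neutral_cong_left)
       (use that f in \<open>auto simp: in_keys_iff Pi_iff\<close>)
  show ?thesis
  proof (rule homI)
    fix x assume "x \<in> carrier (free_Abelian_group S)"
    then show "frag_lift G f x \<in> carrier G"
      using f by (auto simp: frag_lift_def Pi_iff intro!: finprod_closed)
  next
    fix x y assume xy: "x \<in> carrier (free_Abelian_group S)" "y \<in> carrier (free_Abelian_group S)"
    let ?A = "Poly_Mapping.keys x \<union> Poly_Mapping.keys y"
    have A: "finite ?A" "?A \<subseteq> S" "Poly_Mapping.keys (x + y) \<subseteq> ?A" using xy keys_add[of x y] by auto
    have fc: "f i [^] (k::int) \<in> carrier G" if "i \<in> ?A" for i k using that A f by (auto simp: Pi_iff)
    have fA: "f i \<in> carrier G" if "i \<in> ?A" for i using that A f by (auto simp: Pi_iff)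
    have "frag_lift G f (x + y)
        = (\<Otimes>i\<in>?A. f i [^] Poly_Mapping.lookup x i \<otimes> f i [^] Poly_Mapping.lookup y i)"
      unfolding ext[OF A(1,3,2)] using fA
      by (intro finprod_cong') (auto simp: lookup_add int_pow_mult)
    also have "\<dots> = frag_lift G f x \<otimes> frag_lift G f y"
      using fc A ext[of ?A x] ext[of ?A y]
      by (subst finprod_multf) (auto simp: Pi_iff)
    finally show "frag_lift G f (x \<otimes>\<^bsub>free_Abelian_group S\<^esub> y) = frag_lift G f x \<otimes> frag_lift G f y"
      by simp
  qed
qed

lemma (in comm_group) frag_lift_of:
  assumes "f i \<in> carrier G" shows "frag_lift G f (frag_of i) = f i"
  using assms by (simp add: frag_lift_def)

lemma mat2_eq_iff: "(A::imat2) = B \<longleftrightarrow> A$1$1 = B$1$1 \<and> A$1$2 = B$1$2 \<and> A$2$1 = B$2$1 \<and> A$2$2 = B$2$2"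
  by (auto simp: vec_eq_iff forall_2)

lemma mat2_mult_nth:
  "((A::imat2) ** B) $ i $ j = A$i$1 * B$1$j + A$i$2 * B$2$j"
  by (simp add: matrix_matrix_mult_def sum_2)

lemma group_SL2Z: "group SL2Z"
proof (rule groupI)
  fix x assume "x \<in> carrier SL2Z"
  then have d: "x$1$1 * x$2$2 - x$1$2 * x$2$1 = 1" by (simp add: SL2Z_def det_2)
  let ?y = "mat2 (x$2$2) (- x$1$2) (- x$2$1) (x$1$1)"
  have "?y \<in> carrier SL2Z" "?y \<otimes>\<^bsub>SL2Z\<^esub> x = \<one>\<^bsub>SL2Z\<^esub>"
    using d by (simp_all add: SL2Z_def det_2 mat2_def mat2_eq_iff mat2_mult_nth mat_def algebra_simps)
  then show "\<exists>y\<in>carrier SL2Z. y \<otimes>\<^bsub>SL2Z\<^esub> x = \<one>\<^bsub>SL2Z\<^esub>" by blast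
qed (auto simp: SL2Z_def det_mul matrix_mul_assoc)

lemma mat_in_SL2Z [simp]:
  "matT \<in> carrier SL2Z" "matS \<in> carrier SL2Z" "matU \<in> carrier SL2Z"
  "mat 1 \<in> carrier SL2Z"
  by (simp_all add: SL2Z_def det_2 mat2_def matT_def matS_def matU_def mat_def)

lemma uminus_SL2Z [simp]: "- g \<in> carrier SL2Z \<longleftrightarrow> g \<in> carrier SL2Z"
  by (simp add: SL2Z_def det_2)

lemma uminus_mult_SL2Z [simp]:
  "(- g) \<otimes>\<^bsub>SL2Z\<^esub> h = - (g \<otimes>\<^bsub>SL2Z\<^esub> h)" "g \<otimes>\<^bsub>SL2Z\<^esub> (- h) = - (g \<otimes>\<^bsub>SL2Z\<^esub> h)"
  by (simp_all add: SL2Z_def mat2_eq_iff mat2_mult_nth)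

lemma one_mult_SL2Z [simp]:
  "mat 1 \<otimes>\<^bsub>SL2Z\<^esub> h = h" "h \<otimes>\<^bsub>SL2Z\<^esub> mat 1 = h"
  by (simp_all add: SL2Z_def)

lemma one_SL2Z: "\<one>\<^bsub>SL2Z\<^esub> = mat 1"
  by (simp add: SL2Z_def)

lemma matTS: "matT \<otimes>\<^bsub>SL2Z\<^esub> matS = matU"
  by (simp add: SL2Z_def mat2_eq_iff mat2_mult_nth mat2_def matT_def matS_def matU_def)

lemma normal_pm1: "{mat 1, - mat 1} \<lhd> SL2Z"
proof -
  interpret group SL2Z by (rule group_SL2Z)
  have sub: "subgroup {mat 1, - mat 1} SL2Z"
  proof (rule subgroupI)
    fix a assume a: "a \<in> {mat 1, - mat 1 :: imat2}"
    then have "a \<otimes>\<^bsub>SL2Z\<^esub> a = \<one>\<^bsub>SL2Z\<^esub>" "a \<in> carrier SL2Z"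
      by (auto simp: SL2Z_def det_2 mat_def mat2_eq_iff mat2_mult_nth)
    then have "inv\<^bsub>SL2Z\<^esub> a = a" using inv_equality by blast
    then show "inv\<^bsub>SL2Z\<^esub> a \<in> {mat 1, - mat 1}" using a by metis
  qed auto
  show ?thesis
    by (rule normalI[OF sub]) (auto simp: r_coset_def l_coset_def)
qed

lemma psl_eq: "psl g = {g, - g}"
  by (auto simp: psl_def r_coset_def)

lemma psl_hom: "group_hom SL2Z PSL2Z psl"
proof -
  interpret normal "{mat 1, - mat 1}" SL2Z by (rule normal_pm1)
  show ?thesis unfolding PSL2Z_def
    using r_coset_hom_Mod factorgroup_is_group
    by (auto intro!: group_hom.intro group_hom_axioms.intro group_SL2Z simp: psl_def[abs_def])
qed

lemma carrier_PSL2Z: "carrier PSL2Z = psl ` carrier SL2Z"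
  by (simp add: PSL2Z_def carrier_FactGroup psl_def image_def)

context
  fixes \<Gamma> :: "imat2 set"
  assumes \<Gamma>: "subgroup \<Gamma> SL2Z"
begin

interpretation SL: group SL2Z by (rule group_SL2Z)
interpretation psl: group_hom SL2Z PSL2Z psl by (rule psl_hom)
interpretation \<Gamma>: subgroup \<Gamma> SL2Z by (rule \<Gamma>)

lemma subgroup_psl: "subgroup (psl ` \<Gamma>) PSL2Z"
  using psl.subgroup_img_is_subgroup[OF \<Gamma>] .

lemma rcosets_psl: "rcosets\<^bsub>PSL2Z\<^esub> (psl ` \<Gamma>) = Gcoset \<Gamma> ` carrier SL2Z"
  by (auto simp: RCOSETS_def Gcoset_def carrier_PSL2Z)

lemma Gcoset_eq_iff:
  assumes "g \<in> carrier SL2Z" "h \<in> carrier SL2Z"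
  shows "Gcoset \<Gamma> h = Gcoset \<Gamma> g \<longleftrightarrow>
    (\<exists>\<gamma>\<in>\<Gamma>. h = \<gamma> \<otimes>\<^bsub>SL2Z\<^esub> g \<or> h = - (\<gamma> \<otimes>\<^bsub>SL2Z\<^esub> g))"
proof -
  have c: "psl g \<in> carrier PSL2Z" "psl h \<in> carrier PSL2Z" using assms by auto
  have "Gcoset \<Gamma> h = Gcoset \<Gamma> g \<longleftrightarrow> psl h \<in> (psl ` \<Gamma>) #>\<^bsub>PSL2Z\<^esub> psl g"
    unfolding Gcoset_def using c subgroup_psl psl.H.repr_independence psl.H.rcos_self by metis
  also have "\<dots> \<longleftrightarrow> (\<exists>\<gamma>\<in>\<Gamma>. psl h = psl (\<gamma> \<otimes>\<^bsub>SL2Z\<^esub> g))"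
    using assms by (auto simp: r_coset_def)
  also have "\<dots> \<longleftrightarrow> (\<exists>\<gamma>\<in>\<Gamma>. h = \<gamma> \<otimes>\<^bsub>SL2Z\<^esub> g \<or> h = - (\<gamma> \<otimes>\<^bsub>SL2Z\<^esub> g))"
    by (auto simp: psl_eq doubleton_eq_iff)
  finally show ?thesis .
qed

lemma lift_cosets_hom_of:
  assumes G: "comm_group G" and f: "f \<in> carrier SL2Z \<rightarrow> carrier G"
    and inv: "\<And>\<gamma> g. \<gamma> \<in> \<Gamma> \<Longrightarrow> g \<in> carrier SL2Z \<Longrightarrow> f (\<gamma> \<otimes>\<^bsub>SL2Z\<^esub> g) = f g"
    and neg: "\<And>g. g \<in> carrier SL2Z \<Longrightarrow> f (- g) = f g"
  shows "lift_cosets \<Gamma> G f \<in> hom (ZPSL \<Gamma>) G"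
    and "g \<in> carrier SL2Z \<Longrightarrow> lift_cosets \<Gamma> G f (frag_of (Gcoset \<Gamma> g)) = f g"
proof -
  interpret G: comm_group G by (rule G)
  have "f ` {h \<in> carrier SL2Z. Gcoset \<Gamma> h = Gcoset \<Gamma> g} = {f g}" if "g \<in> carrier SL2Z" for g
    using that by (force simp: Gcoset_eq_iff inv neg)
  then have *: "the_elem (f ` {h \<in> carrier SL2Z. Gcoset \<Gamma> h = Gcoset \<Gamma> g}) = f g"
    if "g \<in> carrier SL2Z" for g using that by simp
  show "lift_cosets \<Gamma> G f \<in> hom (ZPSL \<Gamma>) G"
    unfolding lift_cosets_def ZPSL_def rcosets_psl
    by (rule G.frag_lift_hom) (use f * in auto)
  show "lift_cosets \<Gamma> G f (frag_of (Gcoset \<Gamma> g)) = f g" if "g \<in> carrier SL2Z"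
    unfolding lift_cosets_def using that f * by (subst G.frag_lift_of) auto
qed

end

lemma image_r_coset:
  assumes "f \<in> hom G K" "H \<subseteq> carrier G" "x \<in> carrier G"
  shows "f ` (H #>\<^bsub>G\<^esub> x) = (f ` H) #>\<^bsub>K\<^esub> f x"
  using assms by (force simp: r_coset_def hom_def image_iff subset_iff)

lemma hom_torsion:
  assumes "group G" "group K" "f \<in> hom G K"
  shows "f ` torsion G \<subseteq> torsion K"
proof -
  interpret group_hom G K f using assms by (simp add: group_hom_def group_hom_axioms_def)
  show ?thesis by (force simp: torsion_def simp flip: hom_nat_pow)
qed

lemma hom_FactGroup_image:
  assumes G: "comm_group G" and H: "subgroup H G" and f: "f \<in> hom G G" and fH: "f ` H = H"
  shows "(`) f \<in> hom (G Mod H) (G Mod H)"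
proof -
  interpret G: comm_group G by (rule G)
  interpret N: normal H G using H by (rule G.subgroup_imp_normal)
  have fc: "f x \<in> carrier G" if "x \<in> carrier G" for x using f that by (auto simp: hom_def)
  have *: "f ` (H #>\<^bsub>G\<^esub> x) = H #>\<^bsub>G\<^esub> f x" if "x \<in> carrier G" for x
    using image_r_coset[OF f N.subset that] fH by simp
  show ?thesis
  proof (rule homI)
    fix X Y assume "X \<in> carrier (G Mod H)" "Y \<in> carrier (G Mod H)"
    then obtain x y where "x \<in> carrier G" "X = H #>\<^bsub>G\<^esub> x" "y \<in> carrier G" "Y = H #>\<^bsub>G\<^esub> y"
      by (auto simp: carrier_FactGroup)
    then show "f ` (X \<otimes>\<^bsub>G Mod H\<^esub> Y) = f ` X \<otimes>\<^bsub>G Mod H\<^esub> f ` Y"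
      by (simp add: N.rcos_sum * fc hom_mult[OF f])
  qed (auto simp: carrier_FactGroup * fc)
qed

lemma tf_proj_image:
  assumes G: "comm_group G" and H: "subgroup H G"
    and f: "f \<in> hom G G" "f ` H \<subseteq> H" and g: "g \<in> hom G G" "g ` H \<subseteq> H"
    and fg: "\<And>x. x \<in> carrier G \<Longrightarrow> f (g x) = x" "\<And>x. x \<in> carrier G \<Longrightarrow> g (f x) = x"
    and x: "x \<in> carrier G"
  shows "(`) f ` tf_proj G H x = tf_proj G H (f x)"
proof -
  interpret G: comm_group G by (rule G)
  interpret N: normal H G using H by (rule G.subgroup_imp_normal)
  have fgi: "f ` g ` X = X" if "X \<subseteq> carrier G" for X
    using that fg(1) by (simp add: image_image subset_iff cong: image_cong_simp)
  have gfi: "g ` f ` X = X" if "X \<subseteq> carrier G" for X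
    using that fg(2) by (simp add: image_image subset_iff cong: image_cong_simp)
  have fH: "f ` H = H" and gH: "g ` H = H"
    using f(2) g(2) fgi[OF N.subset] gfi[OF N.subset] image_mono[OF f(2), of g] image_mono[OF g(2), of f]
    by (metis subset_antisym)+
  let ?Q = "G Mod H"
  note Q = G.abelian_FactGroup[OF H]
  interpret Q: comm_group ?Q by (rule Q)
  note F = hom_FactGroup_image[OF G H f(1) fH] and F' = hom_FactGroup_image[OF G H g(1) gH]
  have sub: "X \<subseteq> carrier G" if "X \<in> torsion ?Q" for X
    using that by (auto simp: torsion_def carrier_FactGroup r_coset_def)
  have 1: "(`) f ` torsion ?Q \<subseteq> torsion ?Q" "(`) g ` torsion ?Q \<subseteq> torsion ?Q"
    using hom_torsion[OF Q.is_group Q.is_group F] hom_torsion[OF Q.is_group Q.is_group F'] .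
  have "X \<in> (`) f ` torsion ?Q" if "X \<in> torsion ?Q" for X
    using 1(2) that fgi[OF sub[OF that]] by (metis image_eqI image_subset_iff)
  then have 2: "(`) f ` torsion ?Q = torsion ?Q" using 1 by blast
  have "(`) f ` tf_proj G H x = torsion ?Q #>\<^bsub>?Q\<^esub> (f ` (H #>\<^bsub>G\<^esub> x))"
    unfolding tf_proj_def using x 2
    by (subst image_r_coset[OF F]) (auto simp: torsion_def carrier_FactGroup)
  also have "f ` (H #>\<^bsub>G\<^esub> x) = H #>\<^bsub>G\<^esub> f x"
    using image_r_coset[OF f(1) N.subset x] fH by simp
  finally show ?thesis by (simp add: tf_proj_def)
qed

lemma comm_group_presymbols: "comm_group presymbols"
  unfolding presymbols_def by (rule abelian_free_Abelian_group)

lemma subgroup_symbol_relations: "subgroup symbol_relations presymbols"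
proof -
  interpret SL: group SL2Z by (rule group_SL2Z)
  interpret comm_group presymbols by (rule comm_group_presymbols)
  have *: "frag_of (g, g') \<in> carrier presymbols" if "g \<in> carrier SL2Z" "g' \<in> carrier SL2Z" for g g'
    using that by (simp add: presymbols_def)
  have p: "x + y \<in> carrier presymbols" "x - y \<in> carrier presymbols" "frag_cmul m x \<in> carrier presymbols"
    if "x \<in> carrier presymbols" "y \<in> carrier presymbols" for x y m
    using that keys_add[of x y] keys_diff[of x y] keys_cmul[of m x] by (auto simp: presymbols_def)
  show ?thesis unfolding symbol_relations_def
    by (rule generate_is_subgroup) (auto intro!: p *)
qed

lemma comm_group_MMS: "comm_group MMS"
  unfolding MMS_def by (rule comm_group_tf_quotient[OF comm_group_presymbols subgroup_symbol_relations])

lemma mms_closed: "g \<in> carrier SL2Z \<Longrightarrow> g' \<in> carrier SL2Z \<Longrightarrow> mms g g' \<in> carrier MMS"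
  unfolding MMS_def mms_def carrier_tf_quotient[OF comm_group_presymbols subgroup_symbol_relations]
  by (auto simp: presymbols_def)

lemma mms_sign:
  assumes "g \<in> carrier SL2Z" "g' \<in> carrier SL2Z" "h \<in> {g, - g}" "h' \<in> {g', - g'}"
  shows "mms g g' = mms h h'"
proof -
  interpret comm_group presymbols by (rule comm_group_presymbols)
  have h: "h \<in> carrier SL2Z" "h' \<in> carrier SL2Z" using assms by auto
  show ?thesis unfolding mms_def
  proof (rule tf_proj_eqI[OF comm_group_presymbols subgroup_symbol_relations])
    have "frag_of (g, g') - frag_of (h, h') \<in> symbol_relations"
      unfolding symbol_relations_def using assms by (intro generate.incl) blast
    then show "frag_of (g, g') \<otimes>\<^bsub>presymbols\<^esub> inv\<^bsub>presymbols\<^esub> frag_of (h, h') \<in> symbol_relations"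
      using h by (simp add: presymbols_def)
  qed (use assms h in \<open>auto simp: presymbols_def\<close>)
qed

lemma act_presymbol_hom:
  assumes "\<gamma> \<in> carrier SL2Z"
  shows "act_presymbol \<gamma> \<in> hom presymbols presymbols"
proof (rule homI)
  interpret SL: group SL2Z by (rule group_SL2Z)
  fix x assume "x \<in> carrier presymbols"
  then show "act_presymbol \<gamma> x \<in> carrier presymbols"
    using assms keys_frag_extend unfolding act_presymbol_def presymbols_def
    by (fastforce dest: subsetD[OF keys_frag_extend])
qed (simp add: act_presymbol_def presymbols_def frag_extend_add)

lemma act_presymbol_mult:
  assumes "\<gamma> \<in> carrier SL2Z" "\<gamma>' \<in> carrier SL2Z" "x \<in> carrier presymbols"
  shows "act_presymbol \<gamma> (act_presymbol \<gamma>' x) = act_presymbol (\<gamma> \<otimes>\<^bsub>SL2Z\<^esub> \<gamma>') x"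
proof -
  interpret SL: group SL2Z by (rule group_SL2Z)
  have "Poly_Mapping.keys x \<subseteq> carrier SL2Z \<times> carrier SL2Z" using assms by (simp add: presymbols_def)
  then show ?thesis
    by (induction rule: free_Abelian_group_induct[consumes 1])
       (use assms in \<open>auto simp: act_presymbol_def frag_extend_diff SL.m_assoc\<close>)
qed

lemma act_presymbol_one:
  assumes "x \<in> carrier presymbols"
  shows "act_presymbol (mat 1) x = x"
proof -
  have "Poly_Mapping.keys x \<subseteq> carrier SL2Z \<times> carrier SL2Z" using assms by (simp add: presymbols_def)
  then show ?thesis
    by (induction rule: free_Abelian_group_induct[consumes 1]) (auto simp: act_presymbol_def frag_extend_diff)
qed

lemma act_presymbol_relations:
  assumes "\<gamma> \<in> carrier SL2Z"
  shows "act_presymbol \<gamma> ` symbol_relations \<subseteq> symbol_relations"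
proof -
  interpret SL: group SL2Z by (rule group_SL2Z)
  interpret comm_group presymbols by (rule comm_group_presymbols)
  interpret h: group_hom presymbols presymbols "act_presymbol \<gamma>"
    by unfold_locales (rule act_presymbol_hom[OF assms])
  note S = subgroup_symbol_relations
  let ?A = "{frag_of (g, g') + frag_of (g', g'') + frag_of (g'', g) | g g' g''.
         g \<in> carrier SL2Z \<and> g' \<in> carrier SL2Z \<and> g'' \<in> carrier SL2Z}"
  let ?B = "{frag_of (g, g') - frag_of (h, h') | g g' h h'.
         g \<in> carrier SL2Z \<and> g' \<in> carrier SL2Z \<and> h \<in> {g, - g} \<and> h' \<in> {g', - g'}}"
  let ?C = "{frag_of (g, g \<otimes>\<^bsub>SL2Z\<^esub> matT [^]\<^bsub>SL2Z\<^esub> m) - frag_cmul m (frag_of (g, g \<otimes>\<^bsub>SL2Z\<^esub> matT)) | g m.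
         g \<in> carrier SL2Z \<and> m \<in> (UNIV :: int set)}"
  have "act_presymbol \<gamma> ` ?A \<subseteq> ?A"
    using assms by (auto simp: act_presymbol_def frag_extend_add) blast
  moreover have "act_presymbol \<gamma> ` ?B \<subseteq> ?B"
  proof (rule image_subsetI)
    fix x assume "x \<in> ?B"
    then obtain g g' h h' where x: "x = frag_of (g, g') - frag_of (h, h')"
         "g \<in> carrier SL2Z" "g' \<in> carrier SL2Z" "h \<in> {g, - g}" "h' \<in> {g', - g'}" by blast
    let ?m = "\<lambda>a. \<gamma> \<otimes>\<^bsub>SL2Z\<^esub> a"
    have "act_presymbol \<gamma> x = frag_of (?m g, ?m g') - frag_of (?m h, ?m h')"
      using x by (simp add: act_presymbol_def frag_extend_diff)
    moreover have "?m h \<in> {?m g, - ?m g}" "?m h' \<in> {?m g', - ?m g'}" using x by auto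
    ultimately show "act_presymbol \<gamma> x \<in> ?B" using x(2,3) assms SL.m_closed by blast
  qed
  moreover have "act_presymbol \<gamma> ` ?C \<subseteq> ?C"
  proof (rule image_subsetI)
    fix x assume "x \<in> ?C"
    then obtain g m where x: "g \<in> carrier SL2Z"
      "x = frag_of (g, g \<otimes>\<^bsub>SL2Z\<^esub> matT [^]\<^bsub>SL2Z\<^esub> (m::int)) - frag_cmul m (frag_of (g, g \<otimes>\<^bsub>SL2Z\<^esub> matT))" by blast
    let ?g = "\<gamma> \<otimes>\<^bsub>SL2Z\<^esub> g"
    have "act_presymbol \<gamma> x =
        frag_of (?g, ?g \<otimes>\<^bsub>SL2Z\<^esub> matT [^]\<^bsub>SL2Z\<^esub> (m::int)) - frag_cmul m (frag_of (?g, ?g \<otimes>\<^bsub>SL2Z\<^esub> matT))"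
      using x assms by (simp add: act_presymbol_def frag_extend_diff frag_extend_cmul SL.m_assoc)
    then show "act_presymbol \<gamma> x \<in> ?C" using x(1) assms SL.m_closed by blast
  qed
  ultimately have "act_presymbol \<gamma> ` (?A \<union> ?B \<union> ?C) \<subseteq> ?A \<union> ?B \<union> ?C"
    unfolding image_Un by (intro Un_mono)
  moreover have "?A \<union> ?B \<union> ?C \<subseteq> carrier presymbols"
    by (rule subset_trans[OF subsetI[OF generate.incl[of _ _ presymbols]]])
       (assumption, rule subgroup.subset[OF S, unfolded symbol_relations_def])
  ultimately have sub: "?A \<union> ?B \<union> ?C \<subseteq> carrier presymbols"
      "act_presymbol \<gamma> ` (?A \<union> ?B \<union> ?C) \<subseteq> ?A \<union> ?B \<union> ?C" by simp_all
  have "act_presymbol \<gamma> ` generate presymbols (?A \<union> ?B \<union> ?C)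
      = generate presymbols (act_presymbol \<gamma> ` (?A \<union> ?B \<union> ?C))"
    by (rule h.generate_img[OF sub(1), symmetric])
  also have "\<dots> \<subseteq> generate presymbols (?A \<union> ?B \<union> ?C)"
    by (rule mono_generate[OF sub(2)])
  finally show ?thesis by (simp only: symbol_relations_def)
qed

lemma act_MMS_tf_proj:
  assumes "\<gamma> \<in> carrier SL2Z" "x \<in> carrier presymbols"
  shows "act_MMS \<gamma> (tf_proj presymbols symbol_relations x)
    = tf_proj presymbols symbol_relations (act_presymbol \<gamma> x)"
proof -
  interpret SL: group SL2Z by (rule group_SL2Z)
  have i: "inv\<^bsub>SL2Z\<^esub> \<gamma> \<in> carrier SL2Z" "\<gamma> \<otimes>\<^bsub>SL2Z\<^esub> inv\<^bsub>SL2Z\<^esub> \<gamma> = mat 1" "inv\<^bsub>SL2Z\<^esub> \<gamma> \<otimes>\<^bsub>SL2Z\<^esub> \<gamma> = mat 1"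
    using assms SL.r_inv[of \<gamma>] SL.l_inv[of \<gamma>] SL.inv_closed[of \<gamma>] by (simp_all add: one_SL2Z)
  show ?thesis
    unfolding act_MMS_def
    by (rule tf_proj_image[OF comm_group_presymbols subgroup_symbol_relations,
          where g = "act_presymbol (inv\<^bsub>SL2Z\<^esub> \<gamma>)"])
       (use assms i in \<open>simp_all add: act_presymbol_hom act_presymbol_relations act_presymbol_mult
          act_presymbol_one\<close>)
qed

lemma act_MMS_mms:
  assumes "\<gamma> \<in> carrier SL2Z" "g \<in> carrier SL2Z" "g' \<in> carrier SL2Z"
  shows "act_MMS \<gamma> (mms g g') = mms (\<gamma> \<otimes>\<^bsub>SL2Z\<^esub> g) (\<gamma> \<otimes>\<^bsub>SL2Z\<^esub> g')"
proof -
  have "frag_of (g, g') \<in> carrier presymbols" using assms by (simp add: presymbols_def)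
  from act_MMS_tf_proj[OF assms(1) this] show ?thesis by (simp add: mms_def act_presymbol_def)
qed

lemma moebius_mult_None:
  assumes "h \<in> carrier SL2Z" "g \<in> carrier SL2Z"
  shows "moebius (h \<otimes>\<^bsub>SL2Z\<^esub> g) None = moebius h (moebius g None)"
proof (cases "g $ 2 $ 1 = 0")
  case True
  then have a: "g $ 1 $ 1 \<noteq> 0" using assms by (auto simp: SL2Z_def det_2)
  show ?thesis using True a by (simp add: moebius_def SL2Z_def mat2_mult_nth Let_def)
next
  case False
  let ?a = "rat_of_int (g $ 1 $ 1)" and ?c = "rat_of_int (g $ 2 $ 1)"
  have c: "?c \<noteq> 0" using False by simp
  have e: "x * ?a / ?c + y = (x * ?a + y * ?c) / ?c" for x y
    using c by (simp add: add_divide_distrib)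
  show ?thesis using c
    by (simp add: moebius_def SL2Z_def mat2_mult_nth Let_def e
        of_int_eq_0_iff[where 'a = rat, symmetric] del: of_int_eq_0_iff)
qed

context
  fixes \<Gamma> :: "imat2 set"
  assumes \<Gamma>: "subgroup \<Gamma> SL2Z"
begin

interpretation SL: group SL2Z by (rule group_SL2Z)
interpretation \<Gamma>: subgroup \<Gamma> SL2Z by (rule \<Gamma>)

lemma subgroup_coinv_relations: "subgroup (coinv_relations \<Gamma>) MMS"
proof -
  interpret M: comm_group MMS by (rule comm_group_MMS)
  have "act_MMS \<gamma> x \<in> carrier MMS" if \<gamma>x: "\<gamma> \<in> \<Gamma>" "x \<in> carrier MMS" for \<gamma> x
  proof -
    have \<gamma>: "\<gamma> \<in> carrier SL2Z" using \<gamma>x by auto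
    obtain y where y: "y \<in> carrier presymbols" "x = tf_proj presymbols symbol_relations y"
      using \<gamma>x carrier_tf_quotient[OF comm_group_presymbols subgroup_symbol_relations]
      by (auto simp: MMS_def)
    have "act_presymbol \<gamma> y \<in> carrier presymbols"
      using act_presymbol_hom[OF \<gamma>] y by (auto simp: hom_def)
    then show ?thesis
      using carrier_tf_quotient[OF comm_group_presymbols subgroup_symbol_relations] y
      by (auto simp: MMS_def act_MMS_tf_proj[OF \<gamma>])
  qed
  then show ?thesis unfolding coinv_relations_def
    by (intro M.generate_is_subgroup) auto
qed

lemma comm_group_MMS_Gamma: "comm_group (MMS_Gamma \<Gamma>)"
  unfolding MMS_Gamma_def by (rule comm_group_tf_quotient[OF comm_group_MMS subgroup_coinv_relations])

lemma mms_Gamma_closed: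
  "g \<in> carrier SL2Z \<Longrightarrow> g' \<in> carrier SL2Z \<Longrightarrow> mms_Gamma \<Gamma> g g' \<in> carrier (MMS_Gamma \<Gamma>)"
  unfolding MMS_Gamma_def mms_Gamma_def carrier_tf_quotient[OF comm_group_MMS subgroup_coinv_relations]
  by (auto intro: mms_closed)

lemma mms_Gamma_invariant:
  assumes "\<gamma> \<in> \<Gamma>" "g \<in> carrier SL2Z" "g' \<in> carrier SL2Z"
  shows "mms_Gamma \<Gamma> (\<gamma> \<otimes>\<^bsub>SL2Z\<^esub> g) (\<gamma> \<otimes>\<^bsub>SL2Z\<^esub> g') = mms_Gamma \<Gamma> g g'"
proof -
  have "mms (\<gamma> \<otimes>\<^bsub>SL2Z\<^esub> g) (\<gamma> \<otimes>\<^bsub>SL2Z\<^esub> g') \<otimes>\<^bsub>MMS\<^esub> inv\<^bsub>MMS\<^esub> mms g g' \<in> coinv_relations \<Gamma>"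
    unfolding coinv_relations_def act_MMS_mms[OF \<Gamma>.mem_carrier[OF assms(1)] assms(2,3), symmetric]
    using assms mms_closed by (intro generate.incl) blast
  then show ?thesis
    unfolding mms_Gamma_def using assms
    by (intro tf_proj_eqI[OF comm_group_MMS subgroup_coinv_relations]) (auto intro!: mms_closed)
qed

lemma manin_map:
  shows "manin_map \<Gamma> \<in> hom (ZPSL \<Gamma>) (MMS_Gamma \<Gamma>)"
    and "g \<in> carrier SL2Z \<Longrightarrow>
      manin_map \<Gamma> (frag_of (Gcoset \<Gamma> g)) = mms_Gamma \<Gamma> g (g \<otimes>\<^bsub>SL2Z\<^esub> matS)"
proof -
  have "mms_Gamma \<Gamma> (- g) (- g \<otimes>\<^bsub>SL2Z\<^esub> matS) = mms_Gamma \<Gamma> g (g \<otimes>\<^bsub>SL2Z\<^esub> matS)"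
    if "g \<in> carrier SL2Z" for g
    using that mms_sign[of g "g \<otimes>\<^bsub>SL2Z\<^esub> matS" "- g" "- (g \<otimes>\<^bsub>SL2Z\<^esub> matS)"]
    by (simp add: mms_Gamma_def)
  moreover have "mms_Gamma \<Gamma> (\<gamma> \<otimes>\<^bsub>SL2Z\<^esub> g) (\<gamma> \<otimes>\<^bsub>SL2Z\<^esub> g \<otimes>\<^bsub>SL2Z\<^esub> matS)
      = mms_Gamma \<Gamma> g (g \<otimes>\<^bsub>SL2Z\<^esub> matS)" if "\<gamma> \<in> \<Gamma>" "g \<in> carrier SL2Z" for \<gamma> g
    using that mms_Gamma_invariant[of \<gamma> g "g \<otimes>\<^bsub>SL2Z\<^esub> matS"] by (simp add: SL.m_assoc)
  moreover have "(\<lambda>g. mms_Gamma \<Gamma> g (g \<otimes>\<^bsub>SL2Z\<^esub> matS)) \<in> carrier SL2Z \<rightarrow> carrier (MMS_Gamma \<Gamma>)"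
    by (auto intro!: mms_Gamma_closed)
  ultimately show "manin_map \<Gamma> \<in> hom (ZPSL \<Gamma>) (MMS_Gamma \<Gamma>)"
    and "g \<in> carrier SL2Z \<Longrightarrow>
      manin_map \<Gamma> (frag_of (Gcoset \<Gamma> g)) = mms_Gamma \<Gamma> g (g \<otimes>\<^bsub>SL2Z\<^esub> matS)"
    unfolding manin_map_def
    using lift_cosets_hom_of[OF \<Gamma> comm_group_MMS_Gamma, of "\<lambda>g. mms_Gamma \<Gamma> g (g \<otimes>\<^bsub>SL2Z\<^esub> matS)"]
    by simp_all
qed

lemma cusp_at_in_cusps: "cusp_at \<Gamma> g \<in> cusps \<Gamma>"
  by (auto simp: cusp_at_def cusps_def orbits_def)

lemma cusp_at_invariant:
  assumes "\<gamma> \<in> \<Gamma>" "g \<in> carrier SL2Z"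
  shows "cusp_at \<Gamma> (\<gamma> \<otimes>\<^bsub>SL2Z\<^esub> g) = cusp_at \<Gamma> g"
proof -
  have *: "cusp_at \<Gamma> g = (\<lambda>\<delta>. moebius (\<delta> \<otimes>\<^bsub>SL2Z\<^esub> g) None) ` \<Gamma>" if "g \<in> carrier SL2Z" for g
    using that by (auto simp: cusp_at_def orbit_def moebius_mult_None image_def)
  have "\<Gamma> = (\<lambda>\<delta>. \<delta> \<otimes>\<^bsub>SL2Z\<^esub> \<gamma>) ` \<Gamma>"
    using SL.coset_join2[OF _ \<Gamma> assms(1)] assms by (auto simp: r_coset_def)
  then have "cusp_at \<Gamma> g = (\<lambda>\<delta>. moebius (\<delta> \<otimes>\<^bsub>SL2Z\<^esub> g) None) ` (\<lambda>\<delta>. \<delta> \<otimes>\<^bsub>SL2Z\<^esub> \<gamma>) ` \<Gamma>"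
    using *[OF assms(2)] by simp
  also have "\<dots> = cusp_at \<Gamma> (\<gamma> \<otimes>\<^bsub>SL2Z\<^esub> g)"
    using assms by (subst *) (auto simp: image_image SL.m_assoc intro!: image_cong)
  finally show ?thesis by simp
qed

lemma cusp_map:
  shows "cusp_map \<Gamma> \<in> hom (ZPSL \<Gamma>) (Zcusps0 \<Gamma>)"
    and "g \<in> carrier SL2Z \<Longrightarrow>
      cusp_map \<Gamma> (frag_of (Gcoset \<Gamma> g)) = cusp_class \<Gamma> (cusp_at \<Gamma> g)"
proof -
  interpret Z: comm_group "Zcusps \<Gamma>"
    unfolding Zcusps_def by (rule abelian_free_Abelian_group)
  have "(\<Sum>c\<in>cusps \<Gamma>. frag_cmul (int (cusp_width \<Gamma> c div width_gcd \<Gamma>)) (frag_of c)) \<in> carrier (Zcusps \<Gamma>)"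
    unfolding Zcusps_def by (rule sum_closed_free_Abelian_group) auto
  then have sub: "subgroup (Zcusps0_relations \<Gamma>) (Zcusps \<Gamma>)"
    unfolding Zcusps0_relations_def by (intro Z.generate_is_subgroup) simp
  have G: "comm_group (Zcusps0 \<Gamma>)"
    unfolding Zcusps0_def using sub by (rule Z.abelian_FactGroup)
  have "cusp_class \<Gamma> (cusp_at \<Gamma> g) \<in> carrier (Zcusps0 \<Gamma>)" for g
    using cusp_at_in_cusps by (auto simp: cusp_class_def Zcusps0_def carrier_FactGroup Zcusps_def)
  moreover have "cusp_at \<Gamma> (- g) = cusp_at \<Gamma> g" for g
    by (simp add: cusp_at_def moebius_def)
  ultimately show "cusp_map \<Gamma> \<in> hom (ZPSL \<Gamma>) (Zcusps0 \<Gamma>)"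
    and "g \<in> carrier SL2Z \<Longrightarrow>
      cusp_map \<Gamma> (frag_of (Gcoset \<Gamma> g)) = cusp_class \<Gamma> (cusp_at \<Gamma> g)"
    unfolding cusp_map_def
    using lift_cosets_hom_of[OF \<Gamma> G, of "\<lambda>g. cusp_class \<Gamma> (cusp_at \<Gamma> g)"] cusp_at_invariant
    by simp_all
qed

end

end

theory Submission
  imports Defs "HOL-Number_Theory.Residue_Primitive_Roots"
begin

text \<open>
  Write \<open>X\<close> for the finite set \<open>\<Gamma>\PSL\<^sub>2(Z)\<close>. Since \<open>PSL\<^sub>2(Z)\<close> is the free product of the groups
  generated by \<open>S\<close> and \<open>U = TS\<close>, of orders 2 and 3, a cocycle on \<open>PSL\<^sub>2(Z)\<close> is determined by its
  values on the symbols \<open>{g, gS}\<close> and \<open>{g, gT}\<close>, which are subject only to the relations coming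
  from \<open>S\<^sup>2\<close> and \<open>U\<^sup>3\<close>; a descent on Conway's topograph constructs the cocycle, so that the free
  product decomposition itself is not needed. Hence \<open>MMS_Gamma \<Gamma>\<close> is the quotient of
  \<open>Z[X] \<times> Zcusps0 \<Gamma>\<close> by \<open>Z[X]\<^sup>S\<close> and by the pairs \<open>(v, - \<phi> v)\<close> with \<open>v\<close> in \<open>Z[X]\<^sup>U\<close>: this
  quotient has no torsion, because a function on \<open>X\<close> that is invariant modulo \<open>n\<close> under \<open>S\<close> and \<open>U\<close>
  is constant modulo \<open>n\<close>. Parts (1) and (3) can be read off from this presentation.

  For part (2), the relations \<open>[g\<infinity>] + [gU\<infinity>] + [gU\<^sup>2\<infinity>] = 0\<close> in the cokernel show that the class of
  \<open>g\<infinity>\<close> does not change under \<open>g \<mapsto> g L\<^sup>2\<close>, where \<open>L\<close> is the lower unipotent generator. Since the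
  level \<open>N\<close> is odd and \<open>g L\<^sup>N g\<^sup>-\<^sup>1\<close> lies in \<open>\<Gamma>\<close>, all cusps have the same class, which is killed by 3.
  It vanishes if and only if \<open>U\<close> has a fixed point on \<open>X\<close>: otherwise the degree modulo 3 detects it.
\<close>

section \<open>A potential on the modular group\<close>


text \<open>The obstacle is to show that there are no further relations. \<open>MMS_Gamma\<close>
  arises by two successive quotients modulo torsion, so bounding it from below takes a homomorphism
  out of it. This map sends a symbol to a difference of values of one function on the modular group,
  modulo the group \<open>R\<close> of expected relations; it passes through both quotients because
  \<open>R\<close> is saturated. Torsion-freeness also shapes the relations themselves. Orbit sums
  of S and U give relations directly, and twice an S-invariant or three times a U-invariant element
  is such a sum, so all invariants follow, those at fixed points included. The sum over X is
  invariant under both S and U; its image in \<open>Zcusps \<Gamma>\<close> is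
  \<open>width_gcd \<Gamma>\<close> times the primitive vector \<open>eps\<close>, which must
  therefore vanish. This is the origin of the relation that defines \<open>Zcusps0\<close>. In part
  (2), the degree modulo 3 is defined on the cokernel only once 3 divides the degree of
  \<open>eps\<close>. The cusp at infinity has width 1, so \<open>eps\<close> is the image of the
  sum over X, and X is cut into free U-orbits.\<close>

lemma mult_SL2Z: "g \<otimes>\<^bsub>SL2Z\<^esub> h = g ** h"
  by (simp add: SL2Z_def)

lemma carrier_SL2Z_iff: "g \<in> carrier SL2Z \<longleftrightarrow> g$1$1 * g$2$2 - g$1$2 * g$2$1 = 1"
  by (simp add: SL2Z_def det_2)

lemma mult_in_SL2Z [simp]: "g \<in> carrier SL2Z \<Longrightarrow> h \<in> carrier SL2Z \<Longrightarrow> g ** h \<in> carrier SL2Z"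
  using group.is_monoid[OF group_SL2Z] by (metis monoid.m_closed mult_SL2Z)

lemma mat2_nth [simp]:
  "mat2 a b c d $ 1 $ 1 = a" "mat2 a b c d $ 1 $ 2 = b"
  "mat2 a b c d $ 2 $ 1 = c" "mat2 a b c d $ 2 $ 2 = d"
  by (simp_all add: mat2_def)

lemma mult_uminus_imat2 [simp]:
  "(- g) ** h = - (g ** h)" "g ** (- h) = - (g ** h)" for g h :: imat2
  by (simp_all add: mat2_eq_iff mat2_mult_nth)

lemma mult_matS [simp]:
  fixes g :: imat2
  shows
  "(g ** matS) $ i $ 1 = g $ i $ 2" "(g ** matS) $ i $ 2 = - g $ i $ 1"
  by (simp_all add: mat2_mult_nth matS_def)

lemma mult_matU [simp]:
  fixes g :: imat2
  shows
  "(g ** matU) $ i $ 1 = g $ i $ 1 + g $ i $ 2" "(g ** matU) $ i $ 2 = - g $ i $ 1"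
  by (simp_all add: mat2_mult_nth matU_def)

lemma mult_matT [simp]:
  fixes g :: imat2
  shows
  "(g ** matT) $ i $ 1 = g $ i $ 1" "(g ** matT) $ i $ 2 = g $ i $ 1 + g $ i $ 2"
  by (simp_all add: mat2_mult_nth matT_def)

lemma matSS: "g ** matS ** matS = - g" for g :: imat2
  by (simp add: mat2_eq_iff)

lemma matUUU: "g ** matU ** matU ** matU = - g" for g :: imat2
  by (simp add: mat2_eq_iff)

lemma matUS: "g ** matU ** matS = - (g ** matT)" for g :: imat2
  by (simp add: mat2_eq_iff)

lemma matTS_eq: "g ** matT ** matS = g ** matU" for g :: imat2
  by (simp add: mat2_eq_iff)

text \<open>The polar form of \<open>x\<^sup>2 - x y + y\<^sup>2\<close> at the columns of \<open>g\<close>. Among the forms of the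
  descent on Conway's topograph this one is chosen because its polar form is odd, hence
  nonzero, on every basis, and because \<open>{1, U, U\<^sup>2}\<close> is its unique minimal triangle.\<close>

definition polar :: "imat2 \<Rightarrow> int" where
  "polar g = 2 * g$1$1 * g$1$2 - g$1$1 * g$2$2 - g$1$2 * g$2$1 + 2 * g$2$1 * g$2$2"

definition hexform :: "int \<Rightarrow> int \<Rightarrow> int" where
  "hexform x y = x * x - x * y + y * y"

lemma hexform_nonneg: "hexform x y \<ge> 0"
proof -
  have "2 * hexform x y = x * x + y * y + (x - y) * (x - y)"
    by (simp add: hexform_def algebra_simps)
  then show ?thesis by (smt (verit) zero_le_square)
qed

text \<open>The columns of \<open>g\<close> and their sum are, up to sign, the three vectors at a
  vertex of the topograph. \<open>matU\<close> permutes them up to sign, and \<open>matS\<close>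
  crosses an edge by replacing the sum with the difference.\<close>

definition height :: "imat2 \<Rightarrow> nat" where
  "height g = nat (hexform (g$1$1) (g$2$1) + hexform (g$1$2) (g$2$2)
     + hexform (g$1$1 + g$1$2) (g$2$1 + g$2$2))"

lemma polar_uminus [simp]: "polar (- g) = polar g"
  by (simp add: polar_def)

lemma polar_matS: "polar (g ** matS) = - polar g"
  by (simp add: polar_def)

lemma height_matU: "height (g ** matU) = height g"
  by (simp add: height_def hexform_def algebra_simps)

text \<open>Passing from the sum to the difference of two vectors lowers the value of a quadratic
  form by twice its polar form.\<close>

lemma height_matS:
  assumes "polar g > 0"
  shows "height (g ** matS) < height g"
proof -
  have e: "hexform (g$1$1 + g$1$2) (g$2$1 + g$2$2)
      = hexform (g$1$2 - g$1$1) (g$2$2 - g$2$1) + 2 * polar g"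
    by (simp add: hexform_def polar_def algebra_simps)
  show ?thesis
    unfolding height_def using assms e
      hexform_nonneg[of "g$1$1" "g$2$1"] hexform_nonneg[of "g$1$2" "g$2$2"]
      hexform_nonneg[of "g$1$2 - g$1$1" "g$2$2 - g$2$1"]
      hexform_nonneg[of "- g$1$1" "- g$2$1"]
    by (auto simp: hexform_def algebra_simps)
qed

lemma polar_nonzero:
  assumes "g \<in> carrier SL2Z" shows "polar g \<noteq> 0"
proof -
  have "g$1$1 * g$2$2 = 1 + g$1$2 * g$2$1" using assms by (simp add: carrier_SL2Z_iff)
  then have "polar g = 2 * (g$1$1 * g$1$2 - g$1$2 * g$2$1 + g$2$1 * g$2$2) - 1"
    by (simp add: polar_def algebra_simps)
  then show ?thesis by presburger
qed

text \<open>The bases \<open>g\<close> and \<open>g ** matU\<close> share a vector up to sign, so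
  bilinearity applies. Hence at most one of the three edges at a vertex descends, which makes the
  order of the tests in \<open>potential\<close> immaterial.\<close>

lemma polar_sum:
  "polar g + polar (g ** matU) = - 2 * hexform (g$1$1) (g$2$1)"
  by (simp add: polar_def hexform_def algebra_simps)

lemma polar_at_most_one:
  "polar g > 0 \<Longrightarrow> polar (g ** matU) \<le> 0"
  using polar_sum[of g] hexform_nonneg[of "g$1$1" "g$2$1"] by linarith

lemma polar_UU_eq: "polar (g ** matU ** matU) + polar g = - 2 * hexform (g$1$2) (g$2$2)"
  by (simp add: polar_def hexform_def algebra_simps)

lemma polar_at_most_one':
  "polar g > 0 \<Longrightarrow> polar (g ** matU ** matU) \<le> 0"
  using polar_UU_eq[of g] hexform_nonneg[of "g$1$2" "g$2$2"] by linarith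

lemma hexform_eq_1_cases:
  assumes "hexform x y = 1"
  shows "(x, y) \<in> {(1,0), (-1,0), (0,1), (0,-1), (1,1), (-1,-1)}"
proof -
  have e: "4 * hexform x y = (2 * x - y)^2 + 3 * y^2" "4 * hexform x y = (2 * y - x)^2 + 3 * x^2"
    by (simp_all add: hexform_def power2_eq_square algebra_simps)
  have "\<bar>z\<bar> \<le> 1" if "3 * z^2 \<le> 4" for z :: int
  proof (rule ccontr)
    assume "\<not> \<bar>z\<bar> \<le> 1"
    then have "2 * 2 \<le> \<bar>z\<bar> * \<bar>z\<bar>" by (intro mult_mono) auto
    then show False using that by (simp add: power2_eq_square)
  qed
  moreover have "3 * y^2 \<le> 4" "3 * x^2 \<le> 4" using e assms by (smt (verit) zero_le_power2)+
  ultimately have "\<bar>x\<bar> \<le> 1" "\<bar>y\<bar> \<le> 1" by blast+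
  then have "x \<in> {-1,0,1}" "y \<in> {-1,0,1}" by auto
  then show ?thesis using assms by (auto simp: hexform_def)
qed

text \<open>The negated polar values p, q, r at a vertex satisfy p q + p r + q r = 3, which is the
  discriminant up to sign. Being at least 1, all three equal 1; then \<open>hexform\<close> is 1 on
  both columns and a finite check remains.\<close>

lemma minimal_triangle:
  assumes g: "g \<in> carrier SL2Z"
    and neg: "polar g \<le> 0" "polar (g ** matU) \<le> 0" "polar (g ** matU ** matU) \<le> 0"
  shows "g \<in> {mat 1, - mat 1, matU, - matU, matU ** matU, - (matU ** matU)}"
proof -
  define p q r where "p = - polar g" and "q = - polar (g ** matU)" and "r = - polar (g ** matU ** matU)"
  have pos: "p \<ge> 1" "q \<ge> 1" "r \<ge> 1"
    using neg polar_nonzero[of g] polar_nonzero[of "g ** matU"] polar_nonzero[of "g ** matU ** matU"] g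
    by (auto simp: p_def q_def r_def)
  have d: "g$1$1 * g$2$2 - g$1$2 * g$2$1 = 1" using g by (simp add: carrier_SL2Z_iff)
  have "p * q + p * r + q * r = 3 * (g$1$1 * g$2$2 - g$1$2 * g$2$1)^2"
    unfolding p_def q_def r_def by (simp add: polar_def power2_eq_square algebra_simps)
  then have 3: "p * q + p * r + q * r = 3" using d by simp
  have "p * q \<ge> 1" "p * r \<ge> 1" "q * r \<ge> 1"
    using pos by (smt (verit) mult_less_cancel_left1 mult_le_cancel_left1)+
  then have "p * q = 1" "p * r = 1" using 3 by linarith+
  then have pqr: "p = 1" "q = 1" "r = 1"
    using pos by (auto simp: zmult_eq_1_iff)
  then have "hexform (g$1$1) (g$2$1) = 1" "hexform (g$1$2) (g$2$2) = 1"
    using polar_sum[of g] polar_UU_eq[of g] by (auto simp: p_def q_def r_def)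
  note cols = this[THEN hexform_eq_1_cases]
  have cases: "(a, b, c, d) \<in> {(1,0,0,1), (-1,0,0,-1), (1,-1,1,0), (-1,1,-1,0), (0,-1,1,-1), (0,1,-1,1)}"
    if "(a, c) \<in> {(1,0), (-1,0), (0,1), (0,-1), (1,1), (-1,-1)}"
      "(b, d) \<in> {(1,0), (-1,0), (0,1), (0,-1), (1,1), (-1,-1)}"
      "a * d - b * c = 1" "2 * a * b - a * d - b * c + 2 * c * d = -1" for a b c d :: int
    using that by (elim insertE emptyE; simp)
  have "(g$1$1, g$1$2, g$2$1, g$2$2)
      \<in> {(1,0,0,1), (-1,0,0,-1), (1,-1,1,0), (-1,1,-1,0), (0,-1,1,-1), (0,1,-1,1)}"
    using cases[OF cols d] pqr(1) by (simp add: p_def polar_def)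
  then show ?thesis
    by (elim insertE emptyE) (simp_all add: mat2_eq_iff mat_def matU_def mat2_mult_nth)
qed

text \<open>The descent by \<open>height\<close> ends in the minimal triangle, and signs are
  recovered from S squared being -1. So S and U generate the group.\<close>

lemma SL2Z_induct [consumes 1, case_names one S U]:
  assumes "g \<in> carrier SL2Z" and one: "P (mat 1)"
    and S: "\<And>g. g \<in> carrier SL2Z \<Longrightarrow> P g \<Longrightarrow> P (g ** matS)"
    and U: "\<And>g. g \<in> carrier SL2Z \<Longrightarrow> P g \<Longrightarrow> P (g ** matU)"
  shows "P g"
  using assms(1)
proof (induction "height g" arbitrary: g rule: less_induct)
  case (less g)
  have neg: "P h" if "P (- h)" "h \<in> carrier SL2Z" for h
    using S[OF _ S[OF _ that(1)]] that(2) by (simp add: matSS)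
  have descend: "P h" if h: "h \<in> carrier SL2Z" "polar h > 0" "height h = height g" for h
  proof -
    have "P (h ** matS)" using less.hyps[of "h ** matS"] height_matS[OF h(2)] h by simp
    from S[OF _ this] h show ?thesis by (intro neg[of h]) (auto simp: matSS)
  qed
  consider "polar g > 0" | "polar (g ** matU) > 0" | "polar (g ** matU ** matU) > 0"
    | "polar g \<le> 0" "polar (g ** matU) \<le> 0" "polar (g ** matU ** matU) \<le> 0" by linarith
  then show ?case
  proof cases
    case 1 then show ?thesis using descend less.prems by blast
  next
    case 2
    then have "P (g ** matU)" using descend less.prems by (simp add: height_matU)
    from U[OF _ U[OF _ this]] less.prems show ?thesis by (intro neg[of g]) (auto simp: matUUU)
  next
    case 3
    then have "P (g ** matU ** matU)" using descend less.prems by (simp add: height_matU)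
    from U[OF _ this] less.prems show ?thesis by (intro neg[of g]) (auto simp: matUUU)
  next
    case 4
    have "P matU" "P (matU ** matU)" using U[OF _ one] U[OF _ U[OF _ one]] by simp_all
    moreover have "P (mat 1)" by (rule one)
    moreover have "P (- h)" if "P h" "h \<in> carrier SL2Z" for h using that by (intro neg[of "- h"]) simp_all
    ultimately show ?thesis using minimal_triangle[OF less.prems 4] by auto
  qed
qed

text \<open>This sums increments along the descent path, where \<open>a\<close> is the increment of
  a step by \<open>matS\<close> and \<open>c\<close> that of a step by \<open>matU\<close>, starting
  from 0 at the identity. In the third branch \<open>g\<close> lies, up to sign, one step by
  \<open>matU\<close> after \<open>g ** matU ** matU\<close>, hence the plus sign.\<close>

function potential :: "(imat2 \<Rightarrow> 'a) \<Rightarrow> (imat2 \<Rightarrow> 'a) \<Rightarrow> imat2 \<Rightarrow> 'a::ab_group_add" where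
  "potential a c g =
    (if polar g > 0 then potential a c (g ** matS) - a g
     else if polar (g ** matU) > 0
       then potential a c (g ** matU ** matS) - a (g ** matU) - c g
     else if polar (g ** matU ** matU) > 0
       then potential a c (g ** matU ** matU ** matS) - a (g ** matU ** matU) + c (g ** matU ** matU)
     else if g \<in> {matU, - matU} then c (mat 1)
     else if g \<in> {matU ** matU, - (matU ** matU)} then c (mat 1) + c matU
     else 0)"
  by pat_completeness auto
termination
proof (relation "measure (\<lambda>(a, c, g). height g)", goal_cases)
  case 1 show ?case by simp
next
  case (2 a c g) then show ?case by (simp add: height_matS)
next
  case (3 a c g)
  then show ?case using height_matS[of "g ** matU"] by (simp add: height_matU)
next
  case (4 a c g)
  then show ?case using height_matS[of "g ** matU ** matU"] by (simp add: height_matU)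
qed

declare potential.simps [simp del]

context
  fixes a c :: "imat2 \<Rightarrow> 'a::ab_group_add"
  assumes even: "\<And>g. a (- g) = a g" "\<And>g. c (- g) = c g"
begin

lemma potential_uminus: "potential a c (- g) = potential a c g"
proof (induction "height g" arbitrary: g rule: less_induct)
  case (less g)
  have m: "- g \<in> {h, - h} \<longleftrightarrow> g \<in> {h, - h}" for h :: imat2
    by (metis insertCI insertE minus_minus singletonD)
  have 1: "potential a c (- h ** matS) = potential a c (h ** matS)"
    if "polar h > 0" "height h = height g" for h
    using less[of "h ** matS"] height_matS[OF that(1)] that(2) by simp
  have 2: "potential a c (- (h ** matS)) = potential a c (h ** matS)"
    if "polar h > 0" "height h = height g" for h
    using 1[OF that] by simp
  show ?case
    by (subst (1 2) potential.simps) (simp only: m mult_uminus_imat2 polar_uminus even 2 height_matU cong: if_cong)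
qed

context
  fixes R :: "'a set"
  assumes R: "0 \<in> R" "\<And>x y. x \<in> R \<Longrightarrow> y \<in> R \<Longrightarrow> x + y \<in> R" "\<And>x. x \<in> R \<Longrightarrow> - x \<in> R"
    and relS: "\<And>g. g \<in> carrier SL2Z \<Longrightarrow> a g + a (g ** matS) \<in> R"
    and relU: "\<And>g. g \<in> carrier SL2Z \<Longrightarrow> c g + c (g ** matU) + c (g ** matU ** matU) \<in> R"
begin

text \<open>Exactly one of \<open>g\<close> and \<open>g ** matS\<close> descends across their
  common edge. For that one the increment is exact; for the other it is correct modulo
  \<open>R\<close>, by \<open>relS\<close>.\<close>

lemma potential_matS:
  assumes "g \<in> carrier SL2Z"
  shows "potential a c (g ** matS) - potential a c g - a g \<in> R"
proof (cases "polar g > 0")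
  case True
  then have "potential a c g = potential a c (g ** matS) - a g"
    by (subst potential.simps) simp
  then show ?thesis using R(1) by simp
next
  case False
  then have "polar (g ** matS) > 0" using polar_nonzero[OF assms] by (simp add: polar_matS)
  then have "potential a c (g ** matS) = potential a c (g ** matS ** matS) - a (g ** matS)"
    by (subst potential.simps) simp
  then have "potential a c (g ** matS) - potential a c g - a g = - (a g + a (g ** matS))"
    by (simp add: matSS potential_uminus)
  then show ?thesis using R(3)[OF relS[OF assms]] by (simp only:)
qed

lemma potential_matU:
  assumes g: "g \<in> carrier SL2Z"
  shows "potential a c (g ** matU) - potential a c g - c g \<in> R"
proof -
  have fwd: "potential a c h = potential a c (h ** matU) - c h" if "polar (h ** matU) > 0" for h
  proof -
    have "\<not> polar h > 0" using polar_at_most_one[of h] that by linarith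
    then have "potential a c h = potential a c (h ** matU ** matS) - a (h ** matU) - c h"
      using that by (subst potential.simps) simp
    moreover have "potential a c (h ** matU) = potential a c (h ** matU ** matS) - a (h ** matU)"
      using that by (subst potential.simps) simp
    ultimately show ?thesis by simp
  qed
  have bwd: "potential a c h = potential a c (h ** matU ** matU) + c (h ** matU ** matU)"
    if "polar (h ** matU ** matU) > 0" for h
  proof -
    have "\<not> polar h > 0" "\<not> polar (h ** matU) > 0"
      using polar_at_most_one'[of h] polar_at_most_one[of "h ** matU"] that by linarith+
    then have "potential a c h
        = potential a c (h ** matU ** matU ** matS) - a (h ** matU ** matU) + c (h ** matU ** matU)"
      using that by (subst potential.simps) simp
    moreover have "potential a c (h ** matU ** matU)
        = potential a c (h ** matU ** matU ** matS) - a (h ** matU ** matU)"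
      using that by (subst potential.simps) simp
    ultimately show ?thesis by simp
  qed
  consider "polar g > 0" | "polar (g ** matU) > 0" | "polar (g ** matU ** matU) > 0"
    | "polar g \<le> 0" "polar (g ** matU) \<le> 0" "polar (g ** matU ** matU) \<le> 0" by linarith
  then show ?thesis
  proof cases
    case 1
    then have "potential a c (g ** matU) = potential a c g + c g"
      using bwd[of "g ** matU"] by (simp add: matUUU even potential_uminus)
    then show ?thesis using R(1) by simp
  next
    case 2
    then show ?thesis using fwd[OF 2] R(1) by simp
  next
    case 3
    \<comment> \<open>Both values are measured from \<open>g ** matU ** matU\<close>:
      \<open>g\<close> is one step after it and \<open>g ** matU\<close> one step before it. The
      defect is therefore the whole sum around the triangle.\<close>
    then have "potential a c (g ** matU) - potential a c g - c g
        = - (c g + c (g ** matU) + c (g ** matU ** matU))"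
      using bwd[OF 3] fwd[of "g ** matU"] by (simp add: algebra_simps)
    then show ?thesis using R(3)[OF relU[OF g]] by (simp only:)
  next
    case 4
    have v: "potential a c h = (if h \<in> {matU, - matU} then c (mat 1)
      else if h \<in> {matU ** matU, - (matU ** matU)} then c (mat 1) + c matU else 0)"
      if "h \<in> {mat 1, matU, matU ** matU}" for h
      using that by (subst potential.simps) (auto simp: polar_def mat_def matU_def mat2_mult_nth)
    have ne: "mat 1 \<noteq> matU" "mat 1 \<noteq> - matU" "mat 1 \<noteq> matU ** matU" "mat 1 \<noteq> - (matU ** matU)"
      "matU ** matU \<noteq> matU" "matU ** matU \<noteq> - matU"
      by (auto simp: mat2_eq_iff mat_def matU_def mat2_mult_nth)
    have v1: "potential a c (mat 1) = 0" "potential a c matU = c (mat 1)"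
      "potential a c (matU ** matU) = c (mat 1) + c matU"
      using v[of "mat 1"] v[of matU] v[of "matU ** matU"] ne by simp_all
    have U3: "matU ** matU ** matU = - mat 1" using matUUU[of "mat 1"] by simp
    have r: "c (mat 1) + c matU + c (matU ** matU) \<in> R" using relU[of "mat 1"] by simp
    \<comment> \<open>Two of the three increments hold by definition; the step from
      \<open>matU ** matU\<close> back to minus the identity closes the triangle and uses
      \<open>r\<close>.\<close>
    have base: "potential a c (h ** matU) - potential a c h - c h \<in> R"
      if "h \<in> {mat 1, matU, matU ** matU}" for h
      using that R(1) R(3)[OF r] by (auto simp: v1 U3 potential_uminus algebra_simps)
    have "potential a c (- h ** matU) - potential a c (- h) - c (- h) \<in> R"
      if "h \<in> {mat 1, matU, matU ** matU}" for h
      using base[OF that] by (simp add: potential_uminus even)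
    with base show ?thesis using minimal_triangle[OF g 4] by blast
  qed
qed

end

end

section \<open>Cosets and cusps\<close>


lemma lookup_frag_sum:
  assumes "finite A"
  shows "Poly_Mapping.lookup (\<Sum>x\<in>A. frag_cmul (h x) (frag_of x)) y = (if y \<in> A then h y else 0)"
  using assms by (simp add: Poly_Mapping.lookup_sum if_distrib[of "(*) _"] cong: if_cong)

lemma keys_frag_sum:
  "Poly_Mapping.keys (\<Sum>x\<in>A. frag_cmul (h x) (frag_of x)) \<subseteq> A"
proof -
  have "(\<Sum>x\<in>A. frag_cmul (h x) (frag_of x)) \<in> carrier (free_Abelian_group A)"
    by (rule sum_closed_free_Abelian_group) auto
  then show ?thesis by simp
qed

definition Tpow :: "int \<Rightarrow> imat2" where
  "Tpow m = mat2 1 m 0 1"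

lemma Tpow_in_SL2Z [simp]: "Tpow m \<in> carrier SL2Z"
  by (simp add: carrier_SL2Z_iff Tpow_def)

lemma Tpow_add: "Tpow m ** Tpow n = Tpow (m + n)"
  by (simp add: mat2_eq_iff mat2_mult_nth Tpow_def)

lemma Tpow_add_assoc: "g ** Tpow m ** Tpow n = g ** Tpow (m + n)"
  by (simp add: Tpow_add flip: matrix_mul_assoc)

lemma Tpow_0: "Tpow 0 = mat 1" and Tpow_1: "Tpow 1 = matT"
  by (simp_all add: mat2_eq_iff Tpow_def mat_def matT_def)

lemma matT_nat_pow: "matT [^]\<^bsub>SL2Z\<^esub> (n::nat) = Tpow (int n)"
proof (induction n)
  case 0 then show ?case by (simp add: Tpow_0 one_SL2Z)
next
  case (Suc n)
  have "matT [^]\<^bsub>SL2Z\<^esub> Suc n = Tpow (int n) ** Tpow 1"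
    using Suc by (simp add: nat_pow_def mult_SL2Z Tpow_1)
  then show ?case by (simp add: Tpow_add add.commute)
qed

lemma matT_int_pow: "matT [^]\<^bsub>SL2Z\<^esub> (m::int) = Tpow m"
proof (cases "m \<ge> 0")
  case True
  then obtain n where "m = int n" using nonneg_int_cases by blast
  then show ?thesis by (simp add: int_pow_int matT_nat_pow)
next
  case False
  then obtain n where n: "m = - int n" by (metis int_cases2 of_nat_0_le_iff)
  have "inv\<^bsub>SL2Z\<^esub> Tpow (- m) = Tpow m"
    by (rule group.inv_equality[OF group_SL2Z]) (simp_all add: mult_SL2Z Tpow_add one_SL2Z Tpow_0)
  then show ?thesis
    by (simp add: n group.int_pow_neg[OF group_SL2Z] int_pow_int matT_nat_pow)
qed

lemma upper_triangular_SL2Z: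
  assumes "t \<in> carrier SL2Z" "t$2$1 = 0"
  shows "\<exists>m. t = Tpow m \<or> t = - Tpow m"
proof -
  have "t$1$1 * t$2$2 = 1" using assms by (simp add: carrier_SL2Z_iff)
  then consider "t$1$1 = 1" "t$2$2 = 1" | "t$1$1 = -1" "t$2$2 = -1"
    by (auto simp: zmult_eq_1_iff)
  then show ?thesis
  proof cases
    case 1 then show ?thesis using assms(2)
      by (intro exI[of _ "t$1$2"]) (simp add: mat2_eq_iff Tpow_def)
  next
    case 2 then show ?thesis using assms(2)
      by (intro exI[of _ "- t$1$2"]) (simp add: mat2_eq_iff Tpow_def)
  qed
qed

lemma inv_SL2Z:
  assumes "g \<in> carrier SL2Z"
  shows "inv\<^bsub>SL2Z\<^esub> g = mat2 (g$2$2) (- g$1$2) (- g$2$1) (g$1$1)"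
  using assms
  by (intro group.inv_equality[OF group_SL2Z])
     (auto simp: mult_SL2Z one_SL2Z mat2_eq_iff mat2_mult_nth mat_def carrier_SL2Z_iff algebra_simps)

text \<open>The matrix g^-1 h fixes infinity, so it is upper triangular, that is, a power of T up to
  sign.\<close>

lemma moebius_None_eq:
  assumes g: "g \<in> carrier SL2Z" and h: "h \<in> carrier SL2Z"
    and eq: "moebius g None = moebius h None"
  shows "\<exists>m. h = g ** Tpow m \<or> h = - (g ** Tpow m)"
proof -
  interpret group SL2Z by (rule group_SL2Z)
  let ?t = "inv\<^bsub>SL2Z\<^esub> g \<otimes>\<^bsub>SL2Z\<^esub> h"
  have "g$1$1 * h$2$1 = g$2$1 * h$1$1"
  proof (cases "g$2$1 = 0 \<or> h$2$1 = 0")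
    case True then show ?thesis using eq by (auto simp: moebius_def Let_def split: if_splits)
  next
    case False
    then have "rat_of_int (g$1$1) / rat_of_int (g$2$1) = rat_of_int (h$1$1) / rat_of_int (h$2$1)"
      using eq by (simp add: moebius_def Let_def)
    then have "rat_of_int (g$1$1 * h$2$1) = rat_of_int (g$2$1 * h$1$1)"
      using False by (simp add: field_simps)
    then show ?thesis by (simp only: of_int_eq_iff)
  qed
  then have "?t$2$1 = 0" by (simp add: inv_SL2Z[OF g] mult_SL2Z mat2_mult_nth algebra_simps)
  then obtain m where "?t = Tpow m \<or> ?t = - Tpow m"
    using upper_triangular_SL2Z[of ?t] g h by auto
  moreover have "h = g ** ?t"
    using g h by (simp add: m_assoc[symmetric] flip: mult_SL2Z)
  ultimately show ?thesis by (metis mult_uminus_imat2(2))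
qed

lemma moebius_None_surj: "\<exists>g\<in>carrier SL2Z. moebius g None = z"
proof (cases z)
  case None
  then have "moebius (mat 1) None = z" by (simp add: moebius_def mat_def)
  then show ?thesis using mat_in_SL2Z(4) by blast
next
  case (Some q)
  obtain a c where ac: "quotient_of q = (a, c)" by (cases "quotient_of q")
  then have c: "c > 0" "coprime a c" "q = of_int a / of_int c"
    using quotient_of_denom_pos quotient_of_coprime quotient_of_div by blast+
  obtain u v where "u * a + v * c = 1"
    using bezout_int[of a c] c(2) by (auto simp: coprime_iff_gcd_eq_1)
  then have "mat2 a (- v) c u \<in> carrier SL2Z" by (simp add: carrier_SL2Z_iff algebra_simps)
  moreover have "moebius (mat2 a (- v) c u) None = z"
    using c Some by (simp add: moebius_def)
  ultimately show ?thesis by blast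
qed

section \<open>The coset space X of a subgroup of finite index\<close>

locale finite_index =
  fixes \<Gamma> :: "imat2 set"
  assumes \<Gamma>: "subgroup \<Gamma> SL2Z"
    and finite_rcosets: "finite (rcosets\<^bsub>SL2Z\<^esub> \<Gamma>)"
begin

sublocale SL: group SL2Z by (rule group_SL2Z)
sublocale psl: group_hom SL2Z PSL2Z psl by (rule psl_hom)
sublocale \<Gamma>: subgroup \<Gamma> SL2Z by (rule \<Gamma>)

abbreviation "X \<equiv> Gcoset \<Gamma> ` carrier SL2Z"

lemma ZPSL_eq: "ZPSL \<Gamma> = free_Abelian_group X"
  by (simp add: ZPSL_def rcosets_psl[OF \<Gamma>])

lemma finite_X: "finite X"
proof -
  have "Gcoset \<Gamma> g = psl ` (\<Gamma> #>\<^bsub>SL2Z\<^esub> g)" if "g \<in> carrier SL2Z" for g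
    unfolding Gcoset_def using that by (subst image_r_coset[OF psl.homh]) auto
  then have "X \<subseteq> (`) psl ` (rcosets\<^bsub>SL2Z\<^esub> \<Gamma>)" by (auto simp: RCOSETS_def)
  then show ?thesis using finite_rcosets finite_surj by blast
qed

lemma Gcoset_eq:
  assumes "g \<in> carrier SL2Z" "h \<in> carrier SL2Z"
  shows "Gcoset \<Gamma> h = Gcoset \<Gamma> g \<longleftrightarrow> (\<exists>\<gamma>\<in>\<Gamma>. h = \<gamma> ** g \<or> h = - (\<gamma> ** g))"
  using Gcoset_eq_iff[OF \<Gamma> assms] by (simp add: mult_SL2Z)

lemma Gcoset_uminus [simp]: "Gcoset \<Gamma> (- g) = Gcoset \<Gamma> g"
  by (simp add: Gcoset_def psl_eq insert_commute)

lemma Gcoset_mult_left: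
  assumes "\<gamma> \<in> \<Gamma>" "g \<in> carrier SL2Z" shows "Gcoset \<Gamma> (\<gamma> ** g) = Gcoset \<Gamma> g"
  using assms by (subst Gcoset_eq) auto

lemma r_coset_psl:
  assumes "g \<in> carrier SL2Z" "k \<in> carrier SL2Z"
  shows "Gcoset \<Gamma> g #>\<^bsub>PSL2Z\<^esub> psl k = Gcoset \<Gamma> (g ** k)"
  unfolding Gcoset_def using assms subgroup.subset[OF subgroup_psl[OF \<Gamma>]]
  by (subst psl.H.coset_mult_assoc) (auto simp flip: mult_SL2Z)

lemma Gcoset_mult_right:
  assumes "Gcoset \<Gamma> g = Gcoset \<Gamma> h" "g \<in> carrier SL2Z" "h \<in> carrier SL2Z" "k \<in> carrier SL2Z"
  shows "Gcoset \<Gamma> (g ** k) = Gcoset \<Gamma> (h ** k)"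
  using assms by (simp flip: r_coset_psl)

lemma Gcoset_right_cancel:
  assumes "g \<in> carrier SL2Z" "h \<in> carrier SL2Z" "k \<in> carrier SL2Z"
  shows "Gcoset \<Gamma> (g ** k) = Gcoset \<Gamma> (h ** k) \<longleftrightarrow> Gcoset \<Gamma> g = Gcoset \<Gamma> h"
proof
  assume "Gcoset \<Gamma> (g ** k) = Gcoset \<Gamma> (h ** k)"
  from Gcoset_mult_right[OF this, of "inv\<^bsub>SL2Z\<^esub> k"] show "Gcoset \<Gamma> g = Gcoset \<Gamma> h"
    using assms by (simp add: SL.m_assoc flip: mult_SL2Z)
qed (use assms Gcoset_mult_right in blast)

lemma rmul_of:
  assumes "g \<in> carrier SL2Z" "k \<in> carrier SL2Z"
  shows "rmul k (frag_of (Gcoset \<Gamma> g)) = frag_of (Gcoset \<Gamma> (g ** k))"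
  using assms by (simp add: rmul_def r_coset_psl)

lemma keys_rmul:
  assumes "Poly_Mapping.keys x \<subseteq> X" "k \<in> carrier SL2Z"
  shows "Poly_Mapping.keys (rmul k x) \<subseteq> X"
proof -
  have "Poly_Mapping.keys (rmul k x) \<subseteq> (\<lambda>C. C #>\<^bsub>PSL2Z\<^esub> psl k) ` X"
    using assms(1) unfolding rmul_def by (intro order_trans[OF keys_frag_extend]) auto
  then show ?thesis using assms(2) by (auto simp: r_coset_psl)
qed

lemma lookup_rmul:
  assumes "Poly_Mapping.keys x \<subseteq> X" "g \<in> carrier SL2Z" "k \<in> carrier SL2Z"
  shows "Poly_Mapping.lookup (rmul k x) (Gcoset \<Gamma> (g ** k)) = Poly_Mapping.lookup x (Gcoset \<Gamma> g)"
  using assms(1)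
proof (induction rule: free_Abelian_group_induct[consumes 1])
  case (3 C)
  then obtain h where h: "h \<in> carrier SL2Z" "C = Gcoset \<Gamma> h" by auto
  show ?case using Gcoset_right_cancel[of g h k] h assms(2,3) by (simp only: rmul_of lookup_frag_of)
qed (simp_all add: rmul_def frag_extend_diff lookup_minus)

lemma rmul_invariant_iff:
  assumes x: "Poly_Mapping.keys x \<subseteq> X" and k: "k \<in> carrier SL2Z"
  shows "rmul k x = x \<longleftrightarrow>
    (\<forall>g\<in>carrier SL2Z. Poly_Mapping.lookup x (Gcoset \<Gamma> (g ** k)) = Poly_Mapping.lookup x (Gcoset \<Gamma> g))"
    (is "_ \<longleftrightarrow> ?R")
proof
  assume "rmul k x = x" then show ?R using lookup_rmul[OF x _ k] by metis
next
  assume R: ?R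
  show "rmul k x = x"
  proof (rule poly_mapping_eqI)
    fix C show "Poly_Mapping.lookup (rmul k x) C = Poly_Mapping.lookup x C"
    proof (cases "C \<in> X")
      case True
      then obtain g where g: "g \<in> carrier SL2Z" "C = Gcoset \<Gamma> g" by auto
      let ?h = "g ** inv\<^bsub>SL2Z\<^esub> k"
      have h: "?h \<in> carrier SL2Z" "C = Gcoset \<Gamma> (?h ** k)"
        using g k by (simp_all add: SL.m_assoc flip: mult_SL2Z)
      then show ?thesis using R lookup_rmul[OF x h(1) k] by simp
    next
      case False
      then have "C \<notin> Poly_Mapping.keys x" "C \<notin> Poly_Mapping.keys (rmul k x)"
        using x keys_rmul[OF x k] by blast+
      then show ?thesis by (simp add: in_keys_iff)
    qed
  qed
qed

section \<open>Cusps and widths in terms of the action of T on X\<close>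

definition cusp_of :: "imat2 set set \<Rightarrow> p1q set" where
  "cusp_of C = cusp_at \<Gamma> (SOME g. g \<in> carrier SL2Z \<and> Gcoset \<Gamma> g = C)"

lemma cusp_at_uminus [simp]: "cusp_at \<Gamma> (- g) = cusp_at \<Gamma> g"
  by (simp add: cusp_at_def moebius_def)

lemma cusp_at_Gcoset:
  assumes "Gcoset \<Gamma> g = Gcoset \<Gamma> h" "g \<in> carrier SL2Z" "h \<in> carrier SL2Z"
  shows "cusp_at \<Gamma> g = cusp_at \<Gamma> h"
proof -
  obtain \<gamma> where "\<gamma> \<in> \<Gamma>" "g = \<gamma> ** h \<or> g = - (\<gamma> ** h)" using assms Gcoset_eq by blast
  then show ?thesis using cusp_at_invariant[OF \<Gamma>, of \<gamma> h] assms by (auto simp: mult_SL2Z)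
qed

lemma cusp_of_Gcoset [simp]:
  assumes "g \<in> carrier SL2Z" shows "cusp_of (Gcoset \<Gamma> g) = cusp_at \<Gamma> g"
proof -
  let ?h = "SOME h. h \<in> carrier SL2Z \<and> Gcoset \<Gamma> h = Gcoset \<Gamma> g"
  have "?h \<in> carrier SL2Z \<and> Gcoset \<Gamma> ?h = Gcoset \<Gamma> g"
    by (rule someI[of _ g]) (use assms in simp)
  then show ?thesis using cusp_at_Gcoset[of ?h g] assms by (simp add: cusp_of_def)
qed

lemma cusp_at_Tpow: "g \<in> carrier SL2Z \<Longrightarrow> cusp_at \<Gamma> (g ** Tpow m) = cusp_at \<Gamma> g"
  by (simp add: cusp_at_def moebius_def mat2_mult_nth Tpow_def)

text \<open>A cusp is the same as a T-orbit on X: both are double cosets of \<Gamma> and the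
  stabiliser of infinity.\<close>

lemma cusp_at_eq_iff:
  assumes g: "g \<in> carrier SL2Z" and h: "h \<in> carrier SL2Z"
  shows "cusp_at \<Gamma> h = cusp_at \<Gamma> g \<longleftrightarrow> (\<exists>m. Gcoset \<Gamma> h = Gcoset \<Gamma> (g ** Tpow m))"
proof
  assume eq: "cusp_at \<Gamma> h = cusp_at \<Gamma> g"
  have "moebius h None = moebius (mat 1) (moebius h None)"
    using moebius_mult_None[of "mat 1" h] h by simp
  moreover have "mat 1 \<in> \<Gamma>" using \<Gamma>.one_closed by (simp add: one_SL2Z)
  ultimately have "moebius h None \<in> cusp_at \<Gamma> h" unfolding cusp_at_def orbit_def by auto
  then obtain \<gamma> where \<gamma>: "\<gamma> \<in> \<Gamma>" "moebius h None = moebius \<gamma> (moebius g None)"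
    unfolding eq by (auto simp: cusp_at_def orbit_def)
  then have "moebius (\<gamma> ** g) None = moebius h None"
    using moebius_mult_None[of \<gamma> g] g by (simp add: mult_SL2Z)
  then obtain m where m: "h = \<gamma> ** g ** Tpow m \<or> h = - (\<gamma> ** g ** Tpow m)"
    using moebius_None_eq[of "\<gamma> ** g" h] g h \<gamma>(1) by auto
  have "Gcoset \<Gamma> (\<gamma> ** g ** Tpow m) = Gcoset \<Gamma> (g ** Tpow m)"
    using Gcoset_mult_left[OF \<gamma>(1), of "g ** Tpow m"] g by (simp add: matrix_mul_assoc)
  with m have "Gcoset \<Gamma> h = Gcoset \<Gamma> (g ** Tpow m)" by (elim disjE) simp_all
  then show "\<exists>m. Gcoset \<Gamma> h = Gcoset \<Gamma> (g ** Tpow m)" by blast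
next
  assume "\<exists>m. Gcoset \<Gamma> h = Gcoset \<Gamma> (g ** Tpow m)"
  then obtain m where "Gcoset \<Gamma> h = Gcoset \<Gamma> (g ** Tpow m)" by blast
  from cusp_at_Gcoset[OF this h] g show "cusp_at \<Gamma> h = cusp_at \<Gamma> g"
    by (simp add: cusp_at_Tpow)
qed

lemma cusps_eq: "cusps \<Gamma> = cusp_at \<Gamma> ` carrier SL2Z"
proof -
  have "c \<in> cusp_at \<Gamma> ` carrier SL2Z" if "c \<in> cusps \<Gamma>" for c
  proof -
    from that obtain z where "c = orbit (SL2Z\<lparr>carrier := \<Gamma>\<rparr>) moebius z"
      unfolding cusps_def orbits_def by blast
    then show ?thesis using moebius_None_surj[of z] by (auto simp: cusp_at_def)
  qed
  then show ?thesis using cusp_at_in_cusps[OF \<Gamma>] by blast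
qed

lemma cusps_eq': "cusps \<Gamma> = cusp_of ` X"
  unfolding cusps_eq image_image by (rule image_cong) simp_all

lemma finite_cusps: "finite (cusps \<Gamma>)"
  using finite_X by (simp add: cusps_eq')

text \<open>The stabiliser of the coset of \<open>g\<close> in the group of powers of T, as a
  subgroup of the integers; its positive generator is the width
  (\<open>cusp_width_props\<close>).\<close>

definition width_set :: "imat2 \<Rightarrow> int set" where
  "width_set g = {m. Gcoset \<Gamma> (g ** Tpow m) = Gcoset \<Gamma> g}"

lemma Gcoset_Tpow_eq_iff:
  assumes g: "g \<in> carrier SL2Z"
  shows "Gcoset \<Gamma> (g ** Tpow m) = Gcoset \<Gamma> (g ** Tpow n) \<longleftrightarrow> m - n \<in> width_set g"
proof
  assume "Gcoset \<Gamma> (g ** Tpow m) = Gcoset \<Gamma> (g ** Tpow n)"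
  from Gcoset_mult_right[OF this, of "Tpow (- n)"] g
  show "m - n \<in> width_set g" by (simp add: Tpow_add_assoc width_set_def Tpow_0)
next
  assume "m - n \<in> width_set g"
  then have "Gcoset \<Gamma> (g ** Tpow (m - n)) = Gcoset \<Gamma> g" by (simp add: width_set_def)
  from Gcoset_mult_right[OF this, of "Tpow n"] g
  show "Gcoset \<Gamma> (g ** Tpow m) = Gcoset \<Gamma> (g ** Tpow n)" by (simp add: Tpow_add_assoc)
qed

lemma width_set_0: "0 \<in> width_set g"
  by (simp add: width_set_def Tpow_0)

lemma width_set_diff:
  assumes g: "g \<in> carrier SL2Z" and "m \<in> width_set g" "n \<in> width_set g"
  shows "m - n \<in> width_set g"
proof -
  have "Gcoset \<Gamma> (g ** Tpow m) = Gcoset \<Gamma> (g ** Tpow n)"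
    using assms(2,3) by (simp add: width_set_def)
  then show ?thesis by (simp only: Gcoset_Tpow_eq_iff[OF g])
qed

lemma width_set_mult:
  assumes g: "g \<in> carrier SL2Z" and "m \<in> width_set g"
  shows "k * m \<in> width_set g"
proof -
  have n: "int j * m \<in> width_set g" for j
  proof (induction j)
    case (Suc j)
    have "- m \<in> width_set g" using width_set_diff[OF g width_set_0 assms(2)] by simp
    from width_set_diff[OF g Suc this] show ?case by (simp add: algebra_simps)
  qed (simp add: width_set_0)
  show ?thesis
  proof (cases "k \<ge> 0")
    case True then show ?thesis using n[of "nat k"] by simp
  next
    case False
    then show ?thesis using width_set_diff[OF g width_set_0 n[of "nat (- k)"]] by simp
  qed
qed

text \<open>The definition of \<open>cusp_width\<close> allows every representative of the cusp.
  Representatives differ by a power of T on X, and powers of T commute, so they all give the same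
  stabiliser.\<close>

lemma width_set_cusp:
  assumes g: "g \<in> carrier SL2Z" and h: "h \<in> carrier SL2Z" and "cusp_at \<Gamma> h = cusp_at \<Gamma> g"
  shows "width_set h = width_set g"
proof -
  obtain j where j: "Gcoset \<Gamma> h = Gcoset \<Gamma> (g ** Tpow j)" using assms cusp_at_eq_iff by blast
  have "m \<in> width_set h \<longleftrightarrow> m \<in> width_set g" for m
  proof -
    have "Gcoset \<Gamma> (h ** Tpow m) = Gcoset \<Gamma> (g ** Tpow (j + m))"
      using Gcoset_mult_right[OF j h, of "Tpow m"] g by (simp add: Tpow_add_assoc)
    then have "m \<in> width_set h \<longleftrightarrow> Gcoset \<Gamma> (g ** Tpow (j + m)) = Gcoset \<Gamma> (g ** Tpow j)"
      by (simp add: width_set_def j)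
    then show ?thesis by (simp add: Gcoset_Tpow_eq_iff[OF g])
  qed
  then show ?thesis by blast
qed

lemma conj_psl_iff:
  assumes g: "g \<in> carrier SL2Z"
  shows "psl (g \<otimes>\<^bsub>SL2Z\<^esub> matT [^]\<^bsub>SL2Z\<^esub> (n::nat) \<otimes>\<^bsub>SL2Z\<^esub> inv\<^bsub>SL2Z\<^esub> g) \<in> psl ` \<Gamma> \<longleftrightarrow> int n \<in> width_set g"
proof -
  let ?k = "g ** Tpow (int n) ** inv\<^bsub>SL2Z\<^esub> g"
  have k: "?k \<in> carrier SL2Z" using g by simp
  have "?k = \<gamma> \<longleftrightarrow> g ** Tpow (int n) = \<gamma> ** g" if "\<gamma> \<in> carrier SL2Z" for \<gamma>
    using g that SL.inv_solve_right'[of \<gamma> "g ** Tpow (int n)" g] by (auto simp: mult_SL2Z)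
  note e = this
  have "psl ?k \<in> psl ` \<Gamma> \<longleftrightarrow> (\<exists>\<gamma>\<in>\<Gamma>. ?k = \<gamma> \<or> ?k = - \<gamma>)"
    by (auto simp: psl_eq doubleton_eq_iff image_iff)
  also have "\<dots> \<longleftrightarrow> (\<exists>\<gamma>\<in>\<Gamma>. g ** Tpow (int n) = \<gamma> ** g \<or> g ** Tpow (int n) = - (\<gamma> ** g))"
    by (intro bex_cong refl) (use e \<Gamma>.mem_carrier in \<open>simp add: e\<close>)
  also have "\<dots> \<longleftrightarrow> int n \<in> width_set g"
    using g by (simp add: width_set_def Gcoset_eq)
  finally show ?thesis by (simp add: matT_nat_pow mult_SL2Z)
qed

lemma width_set_pos:
  assumes g: "g \<in> carrier SL2Z"
  shows "\<exists>n::nat. n > 0 \<and> int n \<in> width_set g"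
proof -
  have "range (\<lambda>n::nat. Gcoset \<Gamma> (g ** Tpow (int n))) \<subseteq> X" using g by auto
  then have "finite (range (\<lambda>n::nat. Gcoset \<Gamma> (g ** Tpow (int n))))"
    using finite_X finite_subset by blast
  then have "\<not> inj (\<lambda>n::nat. Gcoset \<Gamma> (g ** Tpow (int n)))"
    using finite_imageD infinite_UNIV_nat by blast
  then obtain m n :: nat where "m < n" "Gcoset \<Gamma> (g ** Tpow (int m)) = Gcoset \<Gamma> (g ** Tpow (int n))"
    unfolding inj_def by (metis nat_neq_iff)
  then have "int n - int m \<in> width_set g" using Gcoset_Tpow_eq_iff[OF g] by metis
  then show ?thesis using \<open>m < n\<close> by (intro exI[of _ "n - m"]) (simp add: of_nat_diff)
qed

lemma cusp_width_eq:
  assumes g: "g \<in> carrier SL2Z"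
  shows "cusp_width \<Gamma> (cusp_at \<Gamma> g) = (LEAST h. h > 0 \<and> int h \<in> width_set g)"
proof -
  have "(\<exists>g'\<in>carrier SL2Z. cusp_at \<Gamma> g' = cusp_at \<Gamma> g \<and>
     psl (g' \<otimes>\<^bsub>SL2Z\<^esub> matT [^]\<^bsub>SL2Z\<^esub> h \<otimes>\<^bsub>SL2Z\<^esub> inv\<^bsub>SL2Z\<^esub> g') \<in> psl ` \<Gamma>)
     \<longleftrightarrow> int h \<in> width_set g" for h
  proof -
    have "(\<exists>g'\<in>carrier SL2Z. cusp_at \<Gamma> g' = cusp_at \<Gamma> g \<and>
       psl (g' \<otimes>\<^bsub>SL2Z\<^esub> matT [^]\<^bsub>SL2Z\<^esub> h \<otimes>\<^bsub>SL2Z\<^esub> inv\<^bsub>SL2Z\<^esub> g') \<in> psl ` \<Gamma>)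
     \<longleftrightarrow> (\<exists>g'\<in>carrier SL2Z. cusp_at \<Gamma> g' = cusp_at \<Gamma> g \<and> int h \<in> width_set g')"
      using conj_psl_iff by blast
    then show ?thesis using width_set_cusp[OF g] g by blast
  qed
  then show ?thesis unfolding cusp_width_def by simp
qed

lemma cusp_width_props:
  assumes g: "g \<in> carrier SL2Z"
  shows "cusp_width \<Gamma> (cusp_at \<Gamma> g) > 0"
    and "m \<in> width_set g \<longleftrightarrow> int (cusp_width \<Gamma> (cusp_at \<Gamma> g)) dvd m"
proof -
  let ?w = "cusp_width \<Gamma> (cusp_at \<Gamma> g)"
  have w: "?w > 0 \<and> int ?w \<in> width_set g"
    unfolding cusp_width_eq[OF g] using LeastI_ex[OF width_set_pos[OF g]] .
  then show "?w > 0" by simp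
  show "m \<in> width_set g \<longleftrightarrow> int ?w dvd m"
  proof
    assume m: "m \<in> width_set g"
    have "m mod int ?w \<in> width_set g"
      using width_set_diff[OF g m width_set_mult[OF g conjunct2[OF w], of "m div int ?w"]]
      by (simp add: minus_div_mult_eq_mod)
    moreover have "0 \<le> m mod int ?w" "m mod int ?w < int ?w" using w by simp_all
    ultimately have "\<not> 0 < nat (m mod int ?w)"
      using not_less_Least[of "nat (m mod int ?w)" "\<lambda>h. h > 0 \<and> int h \<in> width_set g"]
      unfolding cusp_width_eq[OF g, symmetric] by auto
    then show "int ?w dvd m" using \<open>0 \<le> m mod int ?w\<close> by (simp add: dvd_eq_mod_eq_0)
  next
    assume "int ?w dvd m"
    then show "m \<in> width_set g" using width_set_mult[OF g conjunct2[OF w]] by (metis dvd_div_mult_self)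
  qed
qed

text \<open>The fibre of \<open>X \<rightarrow> cusps\<close> over a cusp is an orbit of \<open>T\<close>.\<close>

lemma card_fibre_cusp_of:
  assumes c: "c \<in> cusps \<Gamma>"
  shows "card {C \<in> X. cusp_of C = c} = cusp_width \<Gamma> c"
proof -
  obtain g where g: "g \<in> carrier SL2Z" "c = cusp_at \<Gamma> g" using c cusps_eq by blast
  let ?w = "cusp_width \<Gamma> c" and ?F = "\<lambda>m. Gcoset \<Gamma> (g ** Tpow m)"
  have w: "?w > 0" and F: "?F m = ?F n \<longleftrightarrow> int ?w dvd m - n" for m n
    using cusp_width_props[OF g(1)] g Gcoset_Tpow_eq_iff[OF g(1)] by auto
  have "{C \<in> X. cusp_of C = c} = range ?F"
  proof (intro equalityI subsetI)
    fix C assume "C \<in> {C \<in> X. cusp_of C = c}"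
    then obtain h where h: "h \<in> carrier SL2Z" "C = Gcoset \<Gamma> h" "cusp_at \<Gamma> h = cusp_at \<Gamma> g"
      using g(2) by auto
    then show "C \<in> range ?F" using cusp_at_eq_iff[OF g(1) h(1)] by blast
  next
    fix C assume "C \<in> range ?F"
    then show "C \<in> {C \<in> X. cusp_of C = c}" using g by (auto simp: cusp_at_Tpow)
  qed
  also have "\<dots> = ?F ` {0..<int ?w}"
  proof -
    have "?F m = ?F (m mod int ?w)" for m unfolding F by (simp add: minus_mod_eq_mult_div)
    moreover have "m mod int ?w \<in> {0..<int ?w}" for m using w by simp
    ultimately show ?thesis by blast
  qed
  also have "card \<dots> = card {0..<int ?w}"
  proof (rule card_image, rule inj_onI)
    fix m n assume "m \<in> {0..<int ?w}" "n \<in> {0..<int ?w}" "?F m = ?F n"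
    then show "m = n" unfolding F
      by (metis atLeastLessThan_iff mod_eq_dvd_iff mod_pos_pos_trivial)
  qed
  finally show ?thesis by simp
qed

end

section \<open>The relations between the symbols\<close>


context finite_index
begin

lemma keys_add_subset:
  "Poly_Mapping.keys x \<subseteq> A \<Longrightarrow> Poly_Mapping.keys y \<subseteq> A \<Longrightarrow> Poly_Mapping.keys (x + y) \<subseteq> A"
  using keys_add[of x y] by blast

definition Phi :: "(imat2 set set \<Rightarrow>\<^sub>0 int) \<Rightarrow> (p1q set \<Rightarrow>\<^sub>0 int)" where
  "Phi = frag_extend (\<lambda>C. frag_of (cusp_of C))"

definition eps :: "p1q set \<Rightarrow>\<^sub>0 int" where
  "eps = (\<Sum>c\<in>cusps \<Gamma>. frag_cmul (int (cusp_width \<Gamma> c div width_gcd \<Gamma>)) (frag_of c))"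

definition ones :: "imat2 set set \<Rightarrow>\<^sub>0 int" where
  "ones = (\<Sum>C\<in>X. frag_cmul 1 (frag_of C))"

lemma Phi_of: "g \<in> carrier SL2Z \<Longrightarrow> Phi (frag_of (Gcoset \<Gamma> g)) = frag_of (cusp_at \<Gamma> g)"
  by (simp add: Phi_def)

lemma Phi_add: "Phi (x + y) = Phi x + Phi y"
  and Phi_diff: "Phi (x - y) = Phi x - Phi y"
  and Phi_minus: "Phi (- x) = - Phi x"
  and Phi_cmul: "Phi (frag_cmul k x) = frag_cmul k (Phi x)"
  and Phi_0 [simp]: "Phi 0 = 0"
  by (simp_all add: Phi_def frag_extend_add frag_extend_diff frag_extend_minus frag_extend_cmul)

lemma keys_Phi: "Poly_Mapping.keys x \<subseteq> X \<Longrightarrow> Poly_Mapping.keys (Phi x) \<subseteq> cusps \<Gamma>"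
  unfolding Phi_def by (rule order_trans[OF keys_frag_extend]) (auto simp: cusps_eq')

lemma lookup_eps:
  "Poly_Mapping.lookup eps c =
     (if c \<in> cusps \<Gamma> then int (cusp_width \<Gamma> c div width_gcd \<Gamma>) else 0)"
  unfolding eps_def by (rule lookup_frag_sum[OF finite_cusps])

lemma keys_eps: "Poly_Mapping.keys eps \<subseteq> cusps \<Gamma>"
  unfolding eps_def by (rule keys_frag_sum)

lemma lookup_ones: "Poly_Mapping.lookup ones C = (if C \<in> X then 1 else 0)"
  unfolding ones_def by (rule lookup_frag_sum[OF finite_X])

lemma keys_ones: "Poly_Mapping.keys ones \<subseteq> X"
  unfolding ones_def by (rule keys_frag_sum)

lemma width_gcd_dvd: "c \<in> cusps \<Gamma> \<Longrightarrow> width_gcd \<Gamma> dvd cusp_width \<Gamma> c"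
  unfolding width_gcd_def by (intro Gcd_dvd imageI)

lemma width_gcd_pos: "width_gcd \<Gamma> > 0"
  using width_gcd_dvd[of "cusp_at \<Gamma> (mat 1)"] cusp_width_props(1)[of "mat 1"] cusps_eq
  by (auto intro!: gr0I)

text \<open>The fibre of X over a cusp has as many elements as the width of the cusp, so the sum
  over X maps to the width-weighted sum of the cusps.\<close>

lemma Phi_ones: "Phi ones = frag_cmul (int (width_gcd \<Gamma>)) eps"
proof (rule poly_mapping_eqI)
  fix c
  have "Phi ones = (\<Sum>C\<in>X. frag_of (cusp_of C))"
    unfolding Phi_def ones_def by (simp add: frag_extend_sum[OF finite_X] comp_def)
  then have "Poly_Mapping.lookup (Phi ones) c = (\<Sum>C\<in>X. if cusp_of C = c then 1 else 0)"
    by (simp add: Poly_Mapping.lookup_sum eq_commute cong: if_cong)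
  also have "\<dots> = int (card {C \<in> X. cusp_of C = c})"
    using finite_X by (simp add: sum.If_cases Int_def)
  also have "\<dots> = Poly_Mapping.lookup (frag_cmul (int (width_gcd \<Gamma>)) eps) c"
  proof (cases "c \<in> cusps \<Gamma>")
    case True
    then show ?thesis using width_gcd_dvd[OF True]
      by (simp add: card_fibre_cusp_of lookup_eps flip: of_nat_mult)
  next
    case False
    then have "{C \<in> X. cusp_of C = c} = {}" unfolding cusps_eq' by blast
    then show ?thesis using False by (simp only: card.empty lookup_frag_cmul lookup_eps) simp
  qed
  finally show "Poly_Mapping.lookup (Phi ones) c = Poly_Mapping.lookup (frag_cmul (int (width_gcd \<Gamma>)) eps) c" .
qed

text \<open>The coefficients of \<open>eps\<close> are the widths divided by their greatest common
  divisor, so they have no common factor. The proof clears this denominator: n d divides |k| e_c for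
  every cusp c, hence divides |k| d.\<close>

lemma eps_primitive:
  assumes n: "n > 0" and eq: "frag_cmul n w = frag_cmul k eps"
  shows "\<exists>j. w = frag_cmul j eps"
proof -
  let ?d = "width_gcd \<Gamma>"
  have l: "n * Poly_Mapping.lookup w c = k * Poly_Mapping.lookup eps c" for c
    using arg_cong[OF eq, of "\<lambda>x. Poly_Mapping.lookup x c"] by simp
  have "nat n * ?d dvd nat \<bar>k\<bar> * cusp_width \<Gamma> c" if c: "c \<in> cusps \<Gamma>" for c
  proof -
    obtain m where m: "cusp_width \<Gamma> c = ?d * m" using width_gcd_dvd[OF c] by blast
    then have "k * int m = n * Poly_Mapping.lookup w c"
      using l[of c] c width_gcd_pos by (simp add: lookup_eps)
    then have "n dvd \<bar>k\<bar> * int m" by (metis abs_mult abs_of_nat dvd_abs_iff dvd_triv_left)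
    then have "int (nat n) dvd int (nat \<bar>k\<bar> * m)" using n by simp
    then have "nat n dvd nat \<bar>k\<bar> * m" by (simp only: int_dvd_int_iff)
    then show ?thesis by (auto simp: m mult.left_commute mult.commute[of "nat n"])
  qed
  then have "nat n * ?d dvd Gcd ((*) (nat \<bar>k\<bar>) ` cusp_width \<Gamma> ` cusps \<Gamma>)"
    by (intro Gcd_greatest) auto
  then have "nat n * ?d dvd nat \<bar>k\<bar> * ?d" by (simp add: Gcd_mult width_gcd_def)
  then have "n dvd k" using width_gcd_pos n by (simp add: nat_dvd_iff)
  then obtain j where j: "k = n * j" by blast
  have "w = frag_cmul j eps"
    by (rule poly_mapping_eqI) (use l j n in \<open>simp add: mult.assoc\<close>)
  then show ?thesis by blast
qed

definition Inv :: "imat2 \<Rightarrow> (imat2 set set \<Rightarrow>\<^sub>0 int) set" where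
  "Inv k = {x. Poly_Mapping.keys x \<subseteq> X \<and> rmul k x = x}"

lemma carrier_ZPSL_inv: "carrier (ZPSL_inv \<Gamma> k) = Inv k"
  by (auto simp: ZPSL_inv_def invariants_def Inv_def ZPSL_eq)

lemma Inv_keys: "x \<in> Inv k \<Longrightarrow> Poly_Mapping.keys x \<subseteq> X"
  by (simp add: Inv_def)

lemma Inv_0: "0 \<in> Inv k"
  by (simp add: Inv_def rmul_def)

lemma Inv_add: "x \<in> Inv k \<Longrightarrow> y \<in> Inv k \<Longrightarrow> x + y \<in> Inv k"
  using keys_add[of x y] by (auto simp: Inv_def rmul_def frag_extend_add)

lemma Inv_minus: "x \<in> Inv k \<Longrightarrow> - x \<in> Inv k"
  by (auto simp: Inv_def rmul_def frag_extend_minus)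

lemma Inv_cmul: "x \<in> Inv k \<Longrightarrow> frag_cmul m x \<in> Inv k"
  by (auto simp: Inv_def rmul_def frag_extend_cmul)

lemma Inv_iff:
  assumes "k \<in> carrier SL2Z"
  shows "x \<in> Inv k \<longleftrightarrow> Poly_Mapping.keys x \<subseteq> X \<and>
    (\<forall>g\<in>carrier SL2Z. Poly_Mapping.lookup x (Gcoset \<Gamma> (g ** k)) = Poly_Mapping.lookup x (Gcoset \<Gamma> g))"
  using rmul_invariant_iff[OF _ assms] by (auto simp: Inv_def)

text \<open>The relations between the symbols \<open>{g, gS}\<close> (first component) and \<open>{g, gT}\<close> (second
  component), pulled back from \<open>Zcusps0\<close> to \<open>Zcusps\<close>.\<close>

definition R :: "((imat2 set set \<Rightarrow>\<^sub>0 int) \<times> (p1q set \<Rightarrow>\<^sub>0 int)) set" where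
  "R = {(s + v, w) | s v w. s \<in> Inv matS \<and> v \<in> Inv matU \<and> (\<exists>k. Phi v + w = frag_cmul k eps)}"

lemma R_I:
  "s \<in> Inv matS \<Longrightarrow> v \<in> Inv matU \<Longrightarrow> Phi v + w = frag_cmul k eps \<Longrightarrow> (s + v, w) \<in> R"
  unfolding R_def by blast

lemma R_E:
  assumes "(u, w) \<in> R"
  obtains s v k where "u = s + v" "s \<in> Inv matS" "v \<in> Inv matU" "Phi v + w = frag_cmul k eps"
  using assms unfolding R_def by blast

lemma R_0: "0 \<in> R"
  using R_I[OF Inv_0 Inv_0, of 0 0] by (simp add: zero_prod_def)

lemma R_add: "x \<in> R \<Longrightarrow> y \<in> R \<Longrightarrow> x + y \<in> R"
proof (cases x, cases y, clarify)
  fix u w u' w' assume "(u, w) \<in> R" "(u', w') \<in> R"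
  then obtain s v k s' v' k' where
    1: "u = s + v" "s \<in> Inv matS" "v \<in> Inv matU" "Phi v + w = frag_cmul k eps" and
    2: "u' = s' + v'" "s' \<in> Inv matS" "v' \<in> Inv matU" "Phi v' + w' = frag_cmul k' eps"
    by (elim R_E) blast
  have "Phi (v + v') + (w + w') = (Phi v + w) + (Phi v' + w')" by (simp add: Phi_add)
  also have "\<dots> = frag_cmul (k + k') eps" using 1 2 by (simp only: frag_cmul_distrib)
  finally have "((s + s') + (v + v'), w + w') \<in> R" using 1 2 by (intro R_I Inv_add)
  then show "(u, w) + (u', w') \<in> R" using 1 2 by (simp add: add_ac)
qed

lemma R_minus: "x \<in> R \<Longrightarrow> - x \<in> R"
proof (cases x, clarify)
  fix u w assume "(u, w) \<in> R"
  then obtain s v k where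
    1: "u = s + v" "s \<in> Inv matS" "v \<in> Inv matU" "Phi v + w = frag_cmul k eps"
    by (elim R_E) blast
  have "Phi (- v) + - w = - (Phi v + w)" by (simp add: Phi_minus)
  also have "\<dots> = frag_cmul (- k) eps" using 1 by simp
  finally have "(- s + - v, - w) \<in> R" using 1 by (intro R_I Inv_minus)
  then show "- (u, w) \<in> R" using 1 by simp
qed

lemma R_cmul: "(u, w) \<in> R \<Longrightarrow> (frag_cmul m u, frag_cmul m w) \<in> R"
proof -
  assume "(u, w) \<in> R"
  then obtain s v k where
    1: "u = s + v" "s \<in> Inv matS" "v \<in> Inv matU" "Phi v + w = frag_cmul k eps"
    by (elim R_E) blast
  have "Phi (frag_cmul m v) + frag_cmul m w = frag_cmul m (Phi v + w)"
    by (simp add: Phi_cmul frag_cmul_distrib2)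
  also have "\<dots> = frag_cmul (m * k) eps" using 1 by simp
  finally have "(frag_cmul m s + frag_cmul m v, frag_cmul m w) \<in> R" using 1 by (intro R_I Inv_cmul)
  then show ?thesis using 1 by (simp add: frag_cmul_distrib2)
qed

lemma R_diff: "x \<in> R \<Longrightarrow> y \<in> R \<Longrightarrow> x - y \<in> R"
  using R_add[OF _ R_minus, of x y] by simp

text \<open>If \<open>n u = s + v\<close>, then modulo \<open>n\<close> the function \<open>s = - v\<close> is invariant under \<open>S\<close> and \<open>U\<close>,
  hence constant; a multiple of the constant function \<open>1\<close> can be moved from \<open>s\<close> to \<open>v\<close>.\<close>

lemma R_saturated:
  assumes n: "n > 0" and R: "(frag_cmul n u, frag_cmul n w) \<in> R"
  shows "(u, w) \<in> R"
proof -
  let ?l = Poly_Mapping.lookup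
  from R obtain s v k where svk: "frag_cmul n u = s + v" "s \<in> Inv matS" "v \<in> Inv matU"
    "Phi v + frag_cmul n w = frag_cmul k eps" by (elim R_E)
  have l: "n * ?l u C = ?l s C + ?l v C" for C
    using arg_cong[OF svk(1), of "\<lambda>x. ?l x C"] by (simp add: lookup_add)
  have sk: "Poly_Mapping.keys s \<subseteq> X" and vk: "Poly_Mapping.keys v \<subseteq> X"
    using svk Inv_keys by auto
  have sS: "?l s (Gcoset \<Gamma> (g ** matS)) = ?l s (Gcoset \<Gamma> g)"
    and vU: "?l v (Gcoset \<Gamma> (g ** matU)) = ?l v (Gcoset \<Gamma> g)" if "g \<in> carrier SL2Z" for g
    using svk that by (auto simp: Inv_iff)
  define r where "r = ?l s (Gcoset \<Gamma> (mat 1))"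
  have dvd: "n dvd ?l s (Gcoset \<Gamma> g) - r" if "g \<in> carrier SL2Z" for g
    using that
  proof (induction rule: SL2Z_induct)
    case one then show ?case by (simp add: r_def)
  next
    case (S g) then show ?case by (simp add: sS)
  next
    case (U g)
    have "?l s (Gcoset \<Gamma> (g ** matU)) - r
        = (?l s (Gcoset \<Gamma> g) - r) + n * (?l u (Gcoset \<Gamma> (g ** matU)) - ?l u (Gcoset \<Gamma> g))"
      using l[of "Gcoset \<Gamma> (g ** matU)"] l[of "Gcoset \<Gamma> g"] vU[OF U(1)]
      by (simp add: right_diff_distrib)
    then show ?case using U(2) by (simp only: dvd_add dvd_triv_left)
  qed
  define s' where "s' = (\<Sum>C\<in>X. frag_cmul ((?l s C - r) div n) (frag_of C))"
  define v' where "v' = (\<Sum>C\<in>X. frag_cmul ((?l v C + r) div n) (frag_of C))"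
  have ls': "?l s' C = (if C \<in> X then (?l s C - r) div n else 0)"
    and lv': "?l v' C = (if C \<in> X then (?l v C + r) div n else 0)" for C
    by (simp_all only: s'_def v'_def lookup_frag_sum[OF finite_X])
  have s': "s' \<in> Inv matS"
    using keys_frag_sum[of "\<lambda>C. (?l s C - r) div n" X] by (simp add: Inv_iff ls' sS flip: s'_def)
  have v': "v' \<in> Inv matU"
    using keys_frag_sum[of "\<lambda>C. (?l v C + r) div n" X] by (simp add: Inv_iff lv' vU flip: v'_def)
  have ns': "n * ?l s' C = ?l s C - r" and nv': "n * ?l v' C = ?l v C + r" if C: "C \<in> X" for C
  proof -
    have "n dvd ?l s C - r" using dvd C by auto
    moreover have "?l v C + r = n * ?l u C - (?l s C - r)" using l[of C] by simp
    ultimately have "n dvd ?l v C + r" by (simp only: dvd_diff dvd_triv_left)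
    then show "n * ?l v' C = ?l v C + r" using C by (simp add: lv')
    show "n * ?l s' C = ?l s C - r" using C \<open>n dvd ?l s C - r\<close> by (simp add: ls')
  qed
  have u: "u = s' + v'"
  proof (rule poly_mapping_eqI)
    fix C
    have "n * ?l u C = n * ?l (s' + v') C"
    proof (cases "C \<in> X")
      case True
      then show ?thesis using l[of C] ns'[OF True] nv'[OF True] by (simp add: lookup_add distrib_left)
    next
      case False
      then have "?l s C = 0" "?l v C = 0" using sk vk by (auto simp: in_keys_iff)
      then show ?thesis using False l[of C] by (simp add: lookup_add ls' lv')
    qed
    then show "?l u C = ?l (s' + v') C" using n by simp
  qed
  have "v = frag_cmul n v' - frag_cmul r ones"
  proof (rule poly_mapping_eqI)
    fix C
    show "?l v C = ?l (frag_cmul n v' - frag_cmul r ones) C"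
    proof (cases "C \<in> X")
      case True
      then show ?thesis using nv'[OF True] by (simp add: lookup_minus lookup_ones)
    next
      case False
      then have "?l v C = 0" using vk by (auto simp: in_keys_iff)
      then show ?thesis using False by (simp add: lookup_minus lookup_ones lv')
    qed
  qed
  \<comment> \<open>Moving the constant \<open>r\<close> changes the image under \<open>Phi\<close>
    by a multiple of \<open>Phi ones\<close>, hence of \<open>eps\<close>, and this is allowed in
    \<open>R\<close>. Then \<open>eps_primitive\<close> divides by \<open>n\<close>.\<close>
  then have "frag_cmul k eps = frag_cmul n (Phi v' + w) - frag_cmul (r * int (width_gcd \<Gamma>)) eps"
    unfolding svk(4)[symmetric] by (simp add: Phi_diff Phi_cmul Phi_ones frag_cmul_distrib2)
  then have "frag_cmul n (Phi v' + w) = frag_cmul (k + r * int (width_gcd \<Gamma>)) eps"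
    by (simp add: frag_cmul_distrib)
  then obtain j where "Phi v' + w = frag_cmul j eps" using eps_primitive[OF n] by blast
  then show ?thesis unfolding u by (intro R_I s' v')
qed

sublocale ZC: comm_group "Zcusps \<Gamma>"
  unfolding Zcusps_def by (rule abelian_free_Abelian_group)

lemma Zcusps0_relations_eq: "Zcusps0_relations \<Gamma> = range (\<lambda>k. frag_cmul k eps)"
proof -
  have "eps \<in> carrier (Zcusps \<Gamma>)" using keys_eps by (simp add: Zcusps_def)
  then have "Zcusps0_relations \<Gamma> = {eps [^]\<^bsub>Zcusps \<Gamma>\<^esub> k | k. k \<in> (UNIV::int set)}"
    unfolding Zcusps0_relations_def eps_def[symmetric] by (rule ZC.generate_pow)
  then show ?thesis using keys_eps by (auto simp: Zcusps_def)
qed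

lemma subgroup_Zcusps0_relations: "subgroup (Zcusps0_relations \<Gamma>) (Zcusps \<Gamma>)"
  unfolding Zcusps0_relations_def eps_def[symmetric]
  using keys_eps by (intro ZC.generate_is_subgroup) (simp add: Zcusps_def)

sublocale ZC0: normal "Zcusps0_relations \<Gamma>" "Zcusps \<Gamma>"
  by (rule ZC.subgroup_imp_normal[OF subgroup_Zcusps0_relations])

definition zc :: "(p1q set \<Rightarrow>\<^sub>0 int) \<Rightarrow> (p1q set \<Rightarrow>\<^sub>0 int) set" where
  "zc w = Zcusps0_relations \<Gamma> #>\<^bsub>Zcusps \<Gamma>\<^esub> w"

lemma comm_group_Zcusps0: "comm_group (Zcusps0 \<Gamma>)"
  unfolding Zcusps0_def by (rule ZC.abelian_FactGroup[OF subgroup_Zcusps0_relations])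

lemma zc_hom: "zc \<in> hom (Zcusps \<Gamma>) (Zcusps0 \<Gamma>)"
  unfolding Zcusps0_def zc_def[abs_def] by (rule ZC0.r_coset_hom_Mod)

lemma carrier_Zcusps0: "carrier (Zcusps0 \<Gamma>) = zc ` carrier (Zcusps \<Gamma>)"
  by (auto simp: Zcusps0_def carrier_FactGroup zc_def)

lemma zc_eq_one_iff:
  assumes "Poly_Mapping.keys w \<subseteq> cusps \<Gamma>"
  shows "zc w = \<one>\<^bsub>Zcusps0 \<Gamma>\<^esub> \<longleftrightarrow> (\<exists>k. w = frag_cmul k eps)"
proof -
  have w: "w \<in> carrier (Zcusps \<Gamma>)" using assms by (simp add: Zcusps_def)
  have "zc w = \<one>\<^bsub>Zcusps0 \<Gamma>\<^esub> \<longleftrightarrow> w \<in> Zcusps0_relations \<Gamma>"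
    using ZC.coset_join1[OF _ w ZC0.is_subgroup] ZC.coset_join2[OF w ZC0.is_subgroup]
    by (auto simp: zc_def Zcusps0_def)
  then show ?thesis by (auto simp: Zcusps0_relations_eq)
qed

lemma cusp_class_eq: "cusp_class \<Gamma> c = zc (frag_of c)"
  by (simp add: cusp_class_def zc_def)

end

lemma hom_free_Abelian_group_eqI:
  assumes f: "f \<in> hom (free_Abelian_group A) G" and h: "h \<in> hom (free_Abelian_group A) G"
    and G: "group G" and eq: "\<And>a. a \<in> A \<Longrightarrow> f (frag_of a) = h (frag_of a)"
    and x: "Poly_Mapping.keys x \<subseteq> A"
  shows "f x = h x"
proof -
  interpret f: group_hom "free_Abelian_group A" G f
    using f G by (simp add: group_hom_def group_hom_axioms_def)
  interpret h: group_hom "free_Abelian_group A" G h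
    using h G by (simp add: group_hom_def group_hom_axioms_def)
  from x show ?thesis
  proof (induction rule: free_Abelian_group_induct[consumes 1])
    case 1 show ?case using f.hom_one h.hom_one by simp
  next
    case (2 x y)
    then show ?case
      using f.hom_mult[of x "- y"] h.hom_mult[of x "- y"] f.hom_inv[of y] h.hom_inv[of y] by simp
  next
    case (3 a) then show ?case by (rule eq)
  qed
qed

context finite_index
begin

lemma cusp_map_eq:
  assumes x: "Poly_Mapping.keys x \<subseteq> X"
  shows "cusp_map \<Gamma> x = zc (Phi x)"
proof (rule hom_free_Abelian_group_eqI[OF _ _ _ _ x])
  show "cusp_map \<Gamma> \<in> hom (free_Abelian_group X) (Zcusps0 \<Gamma>)"
    using cusp_map(1)[OF \<Gamma>] by (simp add: ZPSL_eq)
  have "Phi \<in> hom (free_Abelian_group X) (Zcusps \<Gamma>)"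
    using keys_Phi by (auto intro!: homI simp: Zcusps_def Phi_add)
  from hom_compose[OF this zc_hom]
  show "(\<lambda>x. zc (Phi x)) \<in> hom (free_Abelian_group X) (Zcusps0 \<Gamma>)" by (simp add: comp_def)
  show "group (Zcusps0 \<Gamma>)" using comm_group_Zcusps0 by (simp add: comm_group_def)
  show "cusp_map \<Gamma> (frag_of C) = zc (Phi (frag_of C))" if "C \<in> X" for C
    using that cusp_map(2)[OF \<Gamma>] by (auto simp: Phi_of cusp_class_eq)
qed

lemma cusp_map_eq_one_iff:
  assumes "Poly_Mapping.keys x \<subseteq> X"
  shows "cusp_map \<Gamma> x = \<one>\<^bsub>Zcusps0 \<Gamma>\<^esub> \<longleftrightarrow> (\<exists>k. Phi x = frag_cmul k eps)"
  using cusp_map_eq[OF assms] zc_eq_one_iff[OF keys_Phi[OF assms]] by simp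

end

section \<open>The universal cocycle\<close>


abbreviation "Pre \<equiv> carrier presymbols"

lemma frag_cmul_diff: "frag_cmul m (a - b) = frag_cmul m a - frag_cmul m b"
  by (rule poly_mapping_eqI) (simp add: lookup_minus right_diff_distrib)

lemma Pre_0 [simp]: "0 \<in> Pre"
  and Pre_add [simp]: "x \<in> Pre \<Longrightarrow> y \<in> Pre \<Longrightarrow> x + y \<in> Pre"
  and Pre_diff [simp]: "x \<in> Pre \<Longrightarrow> y \<in> Pre \<Longrightarrow> x - y \<in> Pre"
  and Pre_minus [simp]: "x \<in> Pre \<Longrightarrow> - x \<in> Pre"
  and Pre_cmul [simp]: "x \<in> Pre \<Longrightarrow> frag_cmul m x \<in> Pre"
  and Pre_of [simp]: "g \<in> carrier SL2Z \<Longrightarrow> g' \<in> carrier SL2Z \<Longrightarrow> frag_of (g, g') \<in> Pre"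
  using keys_add[of x y] keys_diff[of x y] keys_cmul[of m x] by (auto simp: presymbols_def)

lemma presymbols_ops [simp]:
  "\<one>\<^bsub>presymbols\<^esub> = 0" "x \<otimes>\<^bsub>presymbols\<^esub> y = x + y"
  "x [^]\<^bsub>presymbols\<^esub> (n::nat) = frag_cmul (int n) x"
  by (simp_all add: presymbols_def)

lemma inv_presymbols [simp]: "x \<in> Pre \<Longrightarrow> inv\<^bsub>presymbols\<^esub> x = - x"
  by (simp add: presymbols_def)

lemma subgroup_presymbolsI:
  assumes "H \<subseteq> Pre" "0 \<in> H" "\<And>x y. x \<in> H \<Longrightarrow> y \<in> H \<Longrightarrow> x + y \<in> H" "\<And>x. x \<in> H \<Longrightarrow> - x \<in> H"
  shows "subgroup H presymbols"
  using assms by unfold_locales auto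

lemma triangle_in_symbol_relations:
  assumes "g \<in> carrier SL2Z" "g' \<in> carrier SL2Z" "g'' \<in> carrier SL2Z"
  shows "frag_of (g, g') + frag_of (g', g'') + frag_of (g'', g) \<in> symbol_relations"
  unfolding symbol_relations_def by (rule generate.incl) (use assms in blast)

lemma sign_in_symbol_relations:
  assumes "g \<in> carrier SL2Z" "g' \<in> carrier SL2Z" "h \<in> {g, - g}" "h' \<in> {g', - g'}"
  shows "frag_of (g, g') - frag_of (h, h') \<in> symbol_relations"
  unfolding symbol_relations_def by (rule generate.incl) (use assms in blast)

lemma Tpow_in_symbol_relations:
  assumes "g \<in> carrier SL2Z"
  shows "frag_of (g, g ** Tpow m) - frag_cmul m (frag_of (g, g ** matT)) \<in> symbol_relations"
  unfolding symbol_relations_def mult_SL2Z matT_int_pow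
  by (rule generate.incl) (use assms in blast)

context finite_index
begin

definition symA :: "imat2 \<Rightarrow> (imat2 set set \<Rightarrow>\<^sub>0 int) \<times> (p1q set \<Rightarrow>\<^sub>0 int)" where
  "symA g = (frag_of (Gcoset \<Gamma> g), 0)"

definition symB :: "imat2 \<Rightarrow> (imat2 set set \<Rightarrow>\<^sub>0 int) \<times> (p1q set \<Rightarrow>\<^sub>0 int)" where
  "symB g = (0, frag_of (cusp_at \<Gamma> g))"

text \<open>Modulo \<open>R\<close>, the difference \<open>Pot g' - Pot g\<close> is the value of the universal
  \<open>\<Gamma>\<close>-invariant cocycle on the symbol \<open>{g, g'}\<close>.\<close>

definition Pot :: "imat2 \<Rightarrow> (imat2 set set \<Rightarrow>\<^sub>0 int) \<times> (p1q set \<Rightarrow>\<^sub>0 int)" where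
  "Pot = potential symA (\<lambda>g. symB g - symA (g ** matU))"

lemma sym_uminus [simp]: "symA (- g) = symA g" "symB (- g) = symB g"
  by (simp_all add: symA_def symB_def)

lemma symA_S_rel:
  assumes g: "g \<in> carrier SL2Z"
  shows "symA g + symA (g ** matS) \<in> R"
proof -
  have "frag_of (Gcoset \<Gamma> g) + frag_of (Gcoset \<Gamma> (g ** matS)) \<in> Inv matS"
    using g by (simp add: Inv_def keys_add_subset rmul_def frag_extend_add r_coset_psl matSS add.commute)
  from R_I[OF this Inv_0, of 0 0] show ?thesis by (simp add: symA_def)
qed

lemma U_orbit_in_Inv:
  assumes g: "g \<in> carrier SL2Z"
  shows "frag_of (Gcoset \<Gamma> g) + frag_of (Gcoset \<Gamma> (g ** matU)) + frag_of (Gcoset \<Gamma> (g ** matU ** matU)) \<in> Inv matU"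
  using g by (simp add: Inv_def keys_add_subset rmul_def frag_extend_add r_coset_psl matUUU add_ac)

text \<open>The increment along \<open>matU\<close> comes from the triangle \<open>g\<close>,
  \<open>g ** matT\<close>, \<open>g ** matU\<close>: by \<open>matUS\<close>, its side from
  \<open>g ** matT\<close> to \<open>g ** matU\<close> is an S-step at \<open>g ** matU\<close>
  taken backwards. Around a U-orbit with sum v, the increments add up to the pair (- v, Phi
  v).\<close>

lemma sym_U_rel:
  assumes g: "g \<in> carrier SL2Z"
  shows "(symB g - symA (g ** matU)) + (symB (g ** matU) - symA (g ** matU ** matU))
    + (symB (g ** matU ** matU) - symA (g ** matU ** matU ** matU)) \<in> R"
proof -
  let ?v = "frag_of (Gcoset \<Gamma> g) + frag_of (Gcoset \<Gamma> (g ** matU)) + frag_of (Gcoset \<Gamma> (g ** matU ** matU))"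
  have "(0 + - ?v, Phi ?v) \<in> R"
    by (rule R_I[OF Inv_0 Inv_minus[OF U_orbit_in_Inv[OF g]], of _ 0]) (simp only: Phi_minus, simp)
  then show ?thesis using g by (simp add: symA_def symB_def Phi_add Phi_of matUUU add_ac)
qed

lemma Pot_uminus [simp]: "Pot (- g) = Pot g"
  unfolding Pot_def by (rule potential_uminus) simp_all

lemma Pot_matS: "g \<in> carrier SL2Z \<Longrightarrow> Pot (g ** matS) - Pot g - symA g \<in> R"
  unfolding Pot_def
  by (rule potential_matS) (simp_all add: R_0 R_add R_minus symA_S_rel sym_U_rel)

lemma Pot_matU: "g \<in> carrier SL2Z \<Longrightarrow> Pot (g ** matU) - Pot g - (symB g - symA (g ** matU)) \<in> R"
  unfolding Pot_def
  by (rule potential_matU) (simp_all add: R_0 R_add R_minus symA_S_rel sym_U_rel)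

lemma Pot_matT:
  assumes g: "g \<in> carrier SL2Z" shows "Pot (g ** matT) - Pot g - symB g \<in> R"
proof -
  have "Pot (g ** matT) = Pot (g ** matU ** matS)" by (simp add: matUS)
  then have "Pot (g ** matT) - Pot g - symB g = (Pot (g ** matU ** matS) - Pot (g ** matU) - symA (g ** matU))
      + (Pot (g ** matU) - Pot g - (symB g - symA (g ** matU)))" by simp
  also have "\<dots> \<in> R" using g by (intro R_add Pot_matS Pot_matU) simp_all
  finally show ?thesis .
qed

lemma symB_Tpow: "g \<in> carrier SL2Z \<Longrightarrow> symB (g ** Tpow m) = symB g"
  by (simp add: symB_def cusp_at_Tpow)

text \<open>A step by T contributes only the cusp of its starting point, and this cusp is the same
  for all \<open>g ** Tpow n\<close>. A negative power is read backwards, starting from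
  \<open>g ** Tpow m\<close>.\<close>

lemma Pot_Tpow:
  assumes g: "g \<in> carrier SL2Z"
  shows "Pot (g ** Tpow m) - Pot g - (0, frag_cmul m (frag_of (cusp_at \<Gamma> g))) \<in> R"
proof -
  have nat: "Pot (h ** Tpow (int n)) - Pot h - (0, frag_cmul (int n) (frag_of (cusp_at \<Gamma> h))) \<in> R"
    if h: "h \<in> carrier SL2Z" for h n
  proof (induction n)
    case 0 then show ?case by (simp add: Tpow_0 R_0 flip: zero_prod_def)
  next
    case (Suc n)
    have "h ** Tpow (int n) ** matT = h ** Tpow (int (Suc n))"
      by (simp add: Tpow_add_assoc add.commute flip: Tpow_1)
    then have "Pot (h ** Tpow (int (Suc n))) - Pot (h ** Tpow (int n)) - symB h \<in> R"
      using Pot_matT[of "h ** Tpow (int n)"] h by (simp add: symB_Tpow)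
    from R_add[OF this Suc] show ?case
      by (simp add: symB_def frag_cmul_distrib minus_prod_def algebra_simps)
  qed
  show ?thesis
  proof (cases "m \<ge> 0")
    case True then show ?thesis using nat[OF g, of "nat m"] by simp
  next
    case False
    then have "Pot (g ** Tpow m ** Tpow (- m)) - Pot (g ** Tpow m)
        - (0, frag_cmul (- m) (frag_of (cusp_at \<Gamma> (g ** Tpow m)))) \<in> R"
      using nat[of "g ** Tpow m" "nat (- m)"] g by simp
    moreover have "(0, frag_cmul (- m) (frag_of (cusp_at \<Gamma> (g ** Tpow m))))
        = - (0 :: imat2 set set \<Rightarrow>\<^sub>0 int, frag_cmul m (frag_of (cusp_at \<Gamma> g)))"
      using g by (simp add: cusp_at_Tpow)
    ultimately have "Pot g - Pot (g ** Tpow m) + (0, frag_cmul m (frag_of (cusp_at \<Gamma> g))) \<in> R"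
      by (simp only: Tpow_add_assoc add.right_inverse Tpow_0 matrix_mul_rid diff_minus_eq_add)
    moreover have "b - a - p = - (a - b + p)"
      for a b p :: "(imat2 set set \<Rightarrow>\<^sub>0 int) \<times> (p1q set \<Rightarrow>\<^sub>0 int)" by simp
    ultimately show ?thesis using R_minus by metis
  qed
qed

text \<open>The increments of \<open>Pot\<close> are \<Gamma>-invariant, though \<open>Pot\<close>
  itself need not be. A translation thus shifts it by a constant modulo \<open>R\<close>, and the
  constant cancels in differences.\<close>

lemma Pot_Gamma:
  assumes \<gamma>: "\<gamma> \<in> \<Gamma>" and g: "g \<in> carrier SL2Z"
  shows "(Pot (\<gamma> ** g) - Pot g) - (Pot \<gamma> - Pot (mat 1)) \<in> R"
  using g
proof (induction rule: SL2Z_induct)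
  case one then show ?case by (simp add: R_0)
next
  case (S g)
  have \<gamma>g: "\<gamma> ** g \<in> carrier SL2Z" using S \<gamma> by simp
  have a: "symA (\<gamma> ** g) = symA g" using S \<gamma> by (simp add: symA_def Gcoset_mult_left)
  have "(Pot (\<gamma> ** (g ** matS)) - Pot (g ** matS)) - (Pot \<gamma> - Pot (mat 1))
      = (Pot (\<gamma> ** g) - Pot g - (Pot \<gamma> - Pot (mat 1)))
      + ((Pot (\<gamma> ** g ** matS) - Pot (\<gamma> ** g) - symA (\<gamma> ** g)) - (Pot (g ** matS) - Pot g - symA g))"
    by (simp add: a matrix_mul_assoc)
  also have "\<dots> \<in> R" using S \<gamma>g by (intro R_add[OF S(2) R_diff[OF Pot_matS Pot_matS]])
  finally show ?case .
next
  case (U g)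
  have \<gamma>g: "\<gamma> ** g \<in> carrier SL2Z" using U \<gamma> by simp
  have a: "symA (\<gamma> ** g ** matU) = symA (g ** matU)"
    using U \<gamma> Gcoset_mult_left[OF \<gamma>, of "g ** matU"] by (simp add: symA_def matrix_mul_assoc)
  have b: "symB (\<gamma> ** g) = symB g"
    using U cusp_at_invariant[OF \<Gamma> \<gamma>, of g] by (simp add: symB_def mult_SL2Z)
  have "(Pot (\<gamma> ** (g ** matU)) - Pot (g ** matU)) - (Pot \<gamma> - Pot (mat 1))
      = (Pot (\<gamma> ** g) - Pot g - (Pot \<gamma> - Pot (mat 1)))
      + ((Pot (\<gamma> ** g ** matU) - Pot (\<gamma> ** g) - (symB (\<gamma> ** g) - symA (\<gamma> ** g ** matU)))
        - (Pot (g ** matU) - Pot g - (symB g - symA (g ** matU))))"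
    by (simp add: a b matrix_mul_assoc)
  also have "\<dots> \<in> R" using U \<gamma>g by (intro R_add[OF U(2) R_diff[OF Pot_matU Pot_matU]])
  finally show ?case .
qed

text \<open>\<open>frag_extend\<close> takes values in one free abelian group, so the map into pairs
  is assembled from two components.\<close>

definition Psi :: "presymbol \<Rightarrow> (imat2 set set \<Rightarrow>\<^sub>0 int) \<times> (p1q set \<Rightarrow>\<^sub>0 int)" where
  "Psi y = (frag_extend (\<lambda>(g, g'). fst (Pot g' - Pot g)) y,
            frag_extend (\<lambda>(g, g'). snd (Pot g' - Pot g)) y)"

lemma Psi_0 [simp]: "Psi 0 = 0"
  and Psi_add: "Psi (x + y) = Psi x + Psi y"
  and Psi_diff: "Psi (x - y) = Psi x - Psi y"
  and Psi_minus: "Psi (- x) = - Psi x"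
  and Psi_cmul: "Psi (frag_cmul k x) = (frag_cmul k (fst (Psi x)), frag_cmul k (snd (Psi x)))"
  and Psi_of [simp]: "Psi (frag_of (g, g')) = Pot g' - Pot g"
  by (simp_all add: Psi_def zero_prod_def prod_eq_iff frag_extend_add frag_extend_diff frag_extend_minus
      frag_extend_cmul)

text \<open>Applied once for each of the two quotients modulo torsion, in \<open>pi1_eq_one\<close>
  and in \<open>Ker_Psi\<close>.\<close>

lemma Psi_saturated: "n > 0 \<Longrightarrow> Psi (frag_cmul n y) \<in> R \<Longrightarrow> Psi y \<in> R"
  using R_saturated[of n "fst (Psi y)" "snd (Psi y)"] by (simp add: Psi_cmul)

lemma subgroup_Psi: "subgroup {y \<in> Pre. Psi y \<in> R} presymbols"
  by (rule subgroup_presymbolsI) (auto simp: R_0 Psi_add R_add Psi_minus R_minus)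

sublocale P: comm_group presymbols by (rule comm_group_presymbols)
sublocale M: comm_group MMS by (rule comm_group_MMS)
sublocale MG: comm_group "MMS_Gamma \<Gamma>" by (rule comm_group_MMS_Gamma[OF \<Gamma>])

lemma Psi_symbol_relations:
  assumes "y \<in> symbol_relations" shows "Psi y \<in> R"
proof -
  let ?H = "{y \<in> Pre. Psi y \<in> R}"
  have T: "Psi (frag_of (g, g ** Tpow m) - frag_cmul m (frag_of (g, g ** matT))) \<in> R"
    if g: "g \<in> carrier SL2Z" for g m
  proof -
    let ?d = "Pot (g ** matT) - Pot g" and ?f = "frag_of (cusp_at \<Gamma> g)"
    have "(fst ?d, snd ?d - ?f) \<in> R"
      using Pot_matT[OF g] by (simp add: symB_def minus_prod_def)
    from R_cmul[OF this, of m]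
    have "(frag_cmul m (fst ?d), frag_cmul m (snd ?d)) - (0, frag_cmul m ?f) \<in> R"
      by (simp add: frag_cmul_diff)
    from R_diff[OF Pot_Tpow[OF g, of m] this]
    have "Pot (g ** Tpow m) - Pot g - (frag_cmul m (fst ?d), frag_cmul m (snd ?d)) \<in> R"
      by (simp only: diff_diff_eq2 diff_add_cancel)
    then show ?thesis by (simp only: Psi_diff Psi_cmul Psi_of)
  qed
  have tri: "frag_of (g, g') + frag_of (g', g'') + frag_of (g'', g) \<in> ?H"
    if "g \<in> carrier SL2Z" "g' \<in> carrier SL2Z" "g'' \<in> carrier SL2Z" for g g' g''
    using that by (simp add: Psi_add R_0)
  have sgn: "frag_of (g, g') - frag_of (h, h') \<in> ?H"
    if g: "g \<in> carrier SL2Z" "g' \<in> carrier SL2Z" "h \<in> {g, - g}" "h' \<in> {g', - g'}" for g g' h h'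
  proof -
    have "Pot h = Pot g" "h \<in> carrier SL2Z" using g(1,3) by (elim insertE emptyE; simp)+
    moreover have "Pot h' = Pot g'" "h' \<in> carrier SL2Z" using g(2,4) by (elim insertE emptyE; simp)+
    ultimately show ?thesis using g(1,2) by (simp add: Psi_diff R_0)
  qed
  have pow: "frag_of (g, g ** Tpow m) - frag_cmul m (frag_of (g, g ** matT)) \<in> ?H"
    if "g \<in> carrier SL2Z" for g m
    using T that by simp
  have "y \<in> ?H"
    by (rule subsetD[OF P.generate_subgroup_incl[OF _ subgroup_Psi]
        assms[unfolded symbol_relations_def mult_SL2Z matT_int_pow]])
       (intro Un_least subsetI; elim CollectE exE conjE; hypsubst; rule tri sgn pow; assumption)
  then show ?thesis by simp
qed

definition pi1 :: "presymbol \<Rightarrow> presymbol set set" where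
  "pi1 = tf_proj presymbols symbol_relations"

sublocale pi1: group_hom presymbols MMS pi1
  using tf_proj_hom[OF comm_group_presymbols subgroup_symbol_relations]
  by unfold_locales (simp add: pi1_def MMS_def)

lemma carrier_MMS: "carrier MMS = pi1 ` Pre"
  by (simp add: MMS_def pi1_def carrier_tf_quotient[OF comm_group_presymbols subgroup_symbol_relations])

lemma pi1_eq_one:
  assumes "y \<in> Pre" "pi1 y = \<one>\<^bsub>MMS\<^esub>" shows "Psi y \<in> R"
proof -
  obtain n :: nat where "n > 0" "frag_cmul (int n) y \<in> symbol_relations"
    using tf_proj_eq_one_iff[OF comm_group_presymbols subgroup_symbol_relations assms(1)] assms(2)
    by (auto simp: pi1_def MMS_def)
  then show ?thesis using Psi_saturated[of "int n" y] Psi_symbol_relations by simp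
qed

lemma Psi_act_presymbol:
  assumes \<gamma>: "\<gamma> \<in> \<Gamma>" and y: "y \<in> Pre"
  shows "Psi (act_presymbol \<gamma> y - y) \<in> R"
proof -
  from y have "Poly_Mapping.keys y \<subseteq> carrier SL2Z \<times> carrier SL2Z" by (simp add: presymbols_def)
  then show ?thesis
  proof (induction rule: free_Abelian_group_induct[consumes 1])
    case 1 show ?case by (simp add: act_presymbol_def R_0)
  next
    case (2 x y)
    have "Psi (act_presymbol \<gamma> (x - y) - (x - y))
        = Psi (act_presymbol \<gamma> x - x) - Psi (act_presymbol \<gamma> y - y)"
      by (simp add: act_presymbol_def frag_extend_diff Psi_diff)
    then show ?case using R_diff[OF 2(3,4)] by simp
  next
    case (3 p)
    then obtain g g' where p: "p = (g, g')" "g \<in> carrier SL2Z" "g' \<in> carrier SL2Z" by auto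
    have "Psi (act_presymbol \<gamma> (frag_of p) - frag_of p)
       = (Pot (\<gamma> ** g') - Pot g' - (Pot \<gamma> - Pot (mat 1))) - (Pot (\<gamma> ** g) - Pot g - (Pot \<gamma> - Pot (mat 1)))"
      by (simp add: p act_presymbol_def Psi_diff mult_SL2Z)
    also have "\<dots> \<in> R" by (rule R_diff[OF Pot_Gamma[OF \<gamma> p(3)] Pot_Gamma[OF \<gamma> p(2)]])
    finally show ?case .
  qed
qed

lemma act_presymbol_closed: "\<gamma> \<in> \<Gamma> \<Longrightarrow> y \<in> Pre \<Longrightarrow> act_presymbol \<gamma> y \<in> Pre"
  using act_presymbol_hom[OF \<Gamma>.mem_carrier] by (auto simp: hom_def)

lemma pi1_diff: "x \<in> Pre \<Longrightarrow> y \<in> Pre \<Longrightarrow> pi1 (x - y) = pi1 x \<otimes>\<^bsub>MMS\<^esub> inv\<^bsub>MMS\<^esub> pi1 y"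
  using pi1.hom_mult[of x "- y"] pi1.hom_inv[of y] by simp

text \<open>The coinvariant relations live in \<open>MMS\<close>, whereas \<open>Psi\<close> is a
  function of presymbols. Each generator is therefore lifted to
  \<open>act_presymbol \<gamma> y - y\<close>, to which \<open>Psi_act_presymbol\<close>
  applies.\<close>

lemma coinv_relations_Psi: "coinv_relations \<Gamma> \<subseteq> pi1 ` {y \<in> Pre. Psi y \<in> R}"
  unfolding coinv_relations_def
proof (rule M.generate_subgroup_incl[OF _ pi1.subgroup_img_is_subgroup[OF subgroup_Psi]], safe)
  fix \<gamma> x assume \<gamma>: "\<gamma> \<in> \<Gamma>" and "x \<in> carrier MMS"
  then obtain y where y: "y \<in> Pre" "x = pi1 y" by (auto simp: carrier_MMS)
  have "act_MMS \<gamma> x \<otimes>\<^bsub>MMS\<^esub> inv\<^bsub>MMS\<^esub> x = pi1 (act_presymbol \<gamma> y - y)"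
    using act_MMS_tf_proj[OF \<Gamma>.mem_carrier[OF \<gamma>] y(1)] y \<gamma>
    by (simp add: pi1_diff act_presymbol_closed) (simp add: pi1_def)
  then show "act_MMS \<gamma> x \<otimes>\<^bsub>MMS\<^esub> inv\<^bsub>MMS\<^esub> x \<in> pi1 ` {y \<in> Pre. Psi y \<in> R}"
    using Psi_act_presymbol[OF \<gamma> y(1)] act_presymbol_closed[OF \<gamma> y(1)] y by auto
qed

section \<open>The projection of presymbols to \<open>MMS_Gamma\<close> and its kernel\<close>

definition proj :: "presymbol \<Rightarrow> presymbol set set set set" where
  "proj y = tf_proj MMS (coinv_relations \<Gamma>) (pi1 y)"

sublocale proj: group_hom presymbols "MMS_Gamma \<Gamma>" proj
proof unfold_locales
  have "tf_proj MMS (coinv_relations \<Gamma>) \<in> hom MMS (MMS_Gamma \<Gamma>)"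
    using tf_proj_hom[OF comm_group_MMS subgroup_coinv_relations[OF \<Gamma>]] by (simp add: MMS_Gamma_def)
  from hom_compose[OF pi1.homh this]
  show "proj \<in> hom presymbols (MMS_Gamma \<Gamma>)" by (simp add: comp_def proj_def[abs_def])
qed

lemma carrier_MMS_Gamma: "carrier (MMS_Gamma \<Gamma>) = proj ` Pre"
  by (simp add: MMS_Gamma_def proj_def[abs_def] carrier_MMS image_image
      carrier_tf_quotient[OF comm_group_MMS subgroup_coinv_relations[OF \<Gamma>]])

lemma proj_of: "proj (frag_of (g, g')) = mms_Gamma \<Gamma> g g'"
  by (simp add: proj_def pi1_def mms_Gamma_def mms_def)

definition Ker :: "presymbol set" where
  "Ker = {y \<in> Pre. proj y = \<one>\<^bsub>MMS_Gamma \<Gamma>\<^esub>}"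

text \<open>So \<open>Psi\<close> induces a homomorphism from \<open>MMS_Gamma\<close> to the quotient by \<open>R\<close>.\<close>

lemma Ker_Psi: assumes "y \<in> Ker" shows "Psi y \<in> R"
proof -
  have y: "y \<in> Pre" "proj y = \<one>\<^bsub>MMS_Gamma \<Gamma>\<^esub>" using assms by (auto simp: Ker_def)
  then obtain n :: nat where n: "n > 0" "pi1 y [^]\<^bsub>MMS\<^esub> n \<in> coinv_relations \<Gamma>"
    using tf_proj_eq_one_iff[OF comm_group_MMS subgroup_coinv_relations[OF \<Gamma>], of "pi1 y"]
    by (auto simp: proj_def MMS_Gamma_def)
  then obtain z where z: "z \<in> Pre" "Psi z \<in> R" "pi1 (frag_cmul (int n) y) = pi1 z"
    using coinv_relations_Psi y pi1.hom_nat_pow[of y n] by auto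
  then have "pi1 (frag_cmul (int n) y - z) = \<one>\<^bsub>MMS\<^esub>" using y by (simp add: pi1_diff)
  then have "Psi (frag_cmul (int n) y - z) \<in> R" using pi1_eq_one y z by simp
  from R_add[OF this z(2)] have "Psi (frag_cmul (int n) y) \<in> R" by (simp add: Psi_diff)
  then show ?thesis using Psi_saturated[of "int n" y] n(1) by simp
qed

lemma Ker_0: "0 \<in> Ker"
  using proj.hom_one by (simp add: Ker_def)

lemma Ker_add: "x \<in> Ker \<Longrightarrow> y \<in> Ker \<Longrightarrow> x + y \<in> Ker"
  using proj.hom_mult[of x y] by (simp add: Ker_def)

lemma Ker_minus: "x \<in> Ker \<Longrightarrow> - x \<in> Ker"
  using proj.hom_inv[of x] by (simp add: Ker_def)

lemma Ker_diff: "x \<in> Ker \<Longrightarrow> y \<in> Ker \<Longrightarrow> x - y \<in> Ker"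
  using Ker_add[OF _ Ker_minus, of x y] by simp

text \<open>This is how torsion-freeness of \<open>MMS_Gamma\<close> is exploited: a relation may be
  checked on a positive multiple.\<close>

lemma Ker_saturated:
  assumes "y \<in> Pre" "n > 0" "frag_cmul n y \<in> Ker" shows "y \<in> Ker"
proof -
  have "proj y [^]\<^bsub>MMS_Gamma \<Gamma>\<^esub> nat n = \<one>\<^bsub>MMS_Gamma \<Gamma>\<^esub>"
    using assms proj.hom_nat_pow[of y "nat n"] by (simp add: Ker_def)
  then have "proj y \<in> torsion (MMS_Gamma \<Gamma>)"
    using assms(1,2) unfolding torsion_def mem_Collect_eq
    by (intro conjI exI[of _ "nat n"]) simp_all
  moreover have "torsion (MMS_Gamma \<Gamma>) = {\<one>\<^bsub>MMS_Gamma \<Gamma>\<^esub>}"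
    unfolding MMS_Gamma_def
    by (rule torsion_tf_quotient[OF comm_group_MMS subgroup_coinv_relations[OF \<Gamma>]])
  ultimately show ?thesis using assms(1) by (simp only: Ker_def) blast
qed

lemma Ker_symbol_relations:
  assumes "y \<in> symbol_relations" shows "y \<in> Ker"
proof -
  have y: "y \<in> Pre" using assms subgroup.subset[OF subgroup_symbol_relations] by blast
  have "pi1 y = \<one>\<^bsub>MMS\<^esub>"
    using tf_proj_eq_one_iff[OF comm_group_presymbols subgroup_symbol_relations y] assms y
    unfolding pi1_def MMS_def by (auto intro!: exI[of _ 1])
  then have "proj y = proj 0" using pi1.hom_one by (simp add: proj_def)
  then show ?thesis using y proj.hom_one by (simp add: Ker_def)
qed

lemma proj_eq_iff:
  assumes "x \<in> Pre" "y \<in> Pre" shows "proj x = proj y \<longleftrightarrow> x - y \<in> Ker"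
proof -
  have "proj (x - y) = proj x \<otimes>\<^bsub>MMS_Gamma \<Gamma>\<^esub> inv\<^bsub>MMS_Gamma \<Gamma>\<^esub> proj y"
    using proj.hom_mult[of x "- y"] proj.hom_inv[of y] assms by simp
  then show ?thesis using assms MG.inv_solve_right[of "\<one>\<^bsub>MMS_Gamma \<Gamma>\<^esub>" "proj x" "proj y"]
    by (simp add: Ker_def eq_commute[of "\<one>\<^bsub>MMS_Gamma \<Gamma>\<^esub>"])
qed

end

section \<open>A presentation of the mixed modular symbols\<close>


context finite_index
begin

definition rep :: "imat2 set set \<Rightarrow> imat2" where
  "rep C = (SOME g. g \<in> carrier SL2Z \<and> Gcoset \<Gamma> g = C)"

definition crep :: "p1q set \<Rightarrow> imat2" where
  "crep c = (SOME g. g \<in> carrier SL2Z \<and> cusp_at \<Gamma> g = c)"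

lemma rep:
  assumes "C \<in> X" shows "rep C \<in> carrier SL2Z" "Gcoset \<Gamma> (rep C) = C"
proof -
  have "\<exists>g. g \<in> carrier SL2Z \<and> Gcoset \<Gamma> g = C" using assms by blast
  from someI_ex[OF this] show "rep C \<in> carrier SL2Z" "Gcoset \<Gamma> (rep C) = C"
    by (simp_all add: rep_def)
qed

lemma crep:
  assumes "c \<in> cusps \<Gamma>" shows "crep c \<in> carrier SL2Z" "cusp_at \<Gamma> (crep c) = c"
proof -
  have "\<exists>g. g \<in> carrier SL2Z \<and> cusp_at \<Gamma> g = c"
    using assms unfolding cusps_eq by blast
  from someI_ex[OF this] show "crep c \<in> carrier SL2Z" "cusp_at \<Gamma> (crep c) = c"
    by (simp_all add: crep_def)
qed

text \<open>The lifts to presymbols depend on the chosen representatives. Their classes modulo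
  \<open>Ker\<close> do not, by \<open>liftA_Gcoset\<close> and
  \<open>liftB_cusp_at\<close>.\<close>

definition liftA :: "(imat2 set set \<Rightarrow>\<^sub>0 int) \<Rightarrow> presymbol" where
  "liftA = frag_extend (\<lambda>C. frag_of (rep C, rep C ** matS))"

definition liftB :: "(p1q set \<Rightarrow>\<^sub>0 int) \<Rightarrow> presymbol" where
  "liftB = frag_extend (\<lambda>c. frag_of (crep c, crep c ** matT))"

lemma liftA_0 [simp]: "liftA 0 = 0"
  and liftA_of: "liftA (frag_of C) = frag_of (rep C, rep C ** matS)"
  and liftA_add: "liftA (x + y) = liftA x + liftA y"
  and liftA_diff: "liftA (x - y) = liftA x - liftA y"
  and liftA_minus: "liftA (- x) = - liftA x"
  by (simp_all add: liftA_def frag_extend_add frag_extend_diff frag_extend_minus frag_extend_cmul)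

lemma liftB_0 [simp]: "liftB 0 = 0"
  and liftB_of: "liftB (frag_of c) = frag_of (crep c, crep c ** matT)"
  and liftB_add: "liftB (x + y) = liftB x + liftB y"
  and liftB_diff: "liftB (x - y) = liftB x - liftB y"
  and liftB_minus: "liftB (- x) = - liftB x"
  and liftB_cmul: "liftB (frag_cmul m x) = frag_cmul m (liftB x)"
  by (simp_all add: liftB_def frag_extend_add frag_extend_diff frag_extend_minus frag_extend_cmul)

lemma liftA_Pre: "Poly_Mapping.keys u \<subseteq> X \<Longrightarrow> liftA u \<in> Pre"
  by (induction rule: free_Abelian_group_induct[consumes 1])
     (simp_all add: liftA_of liftA_diff rep del: image_iff)

lemma liftB_Pre: "Poly_Mapping.keys w \<subseteq> cusps \<Gamma> \<Longrightarrow> liftB w \<in> Pre"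
  by (induction rule: free_Abelian_group_induct[consumes 1])
     (simp_all add: liftB_of liftB_diff crep)

text \<open>Together with \<open>Psi_liftB\<close>: modulo \<open>R\<close>, \<open>Psi\<close> is a
  left inverse of the lifts, so it detects which combinations of them lie outside
  \<open>Ker\<close>.\<close>

lemma Psi_liftA: "Poly_Mapping.keys u \<subseteq> X \<Longrightarrow> Psi (liftA u) - (u, 0) \<in> R"
proof (induction rule: free_Abelian_group_induct[consumes 1])
  case 1 show ?case by (simp add: R_0 flip: zero_prod_def)
next
  case (2 x y)
  have "Psi (liftA (x - y)) - (x - y, 0) = (Psi (liftA x) - (x, 0)) - (Psi (liftA y) - (y, 0))"
    by (simp add: liftA_diff Psi_diff minus_prod_def)
  then show ?case using R_diff[OF 2(3,4)] by simp
next
  case (3 C) then show ?case using Pot_matS[OF rep(1)[OF 3]] by (simp add: liftA_of symA_def rep(2))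
qed

lemma Psi_liftB: "Poly_Mapping.keys w \<subseteq> cusps \<Gamma> \<Longrightarrow> Psi (liftB w) - (0, w) \<in> R"
proof (induction rule: free_Abelian_group_induct[consumes 1])
  case 1 show ?case by (simp add: R_0 flip: zero_prod_def)
next
  case (2 x y)
  have "Psi (liftB (x - y)) - (0, x - y) = (Psi (liftB x) - (0, x)) - (Psi (liftB y) - (0, y))"
    by (simp add: liftB_diff Psi_diff minus_prod_def)
  then show ?case using R_diff[OF 2(3,4)] by simp
next
  case (3 c) then show ?case using Pot_matT[OF crep(1)[OF 3]] by (simp add: liftB_of symB_def crep(2))
qed

section \<open>Relations satisfied by the lifted symbols\<close>

lemma Ker_triangle:
  "g \<in> carrier SL2Z \<Longrightarrow> g' \<in> carrier SL2Z \<Longrightarrow> g'' \<in> carrier SL2Z \<Longrightarrow>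
    frag_of (g, g') + frag_of (g', g'') + frag_of (g'', g) \<in> Ker"
  by (intro Ker_symbol_relations triangle_in_symbol_relations)

lemma Ker_sign:
  "g \<in> carrier SL2Z \<Longrightarrow> g' \<in> carrier SL2Z \<Longrightarrow> h \<in> {g, - g} \<Longrightarrow> h' \<in> {g', - g'} \<Longrightarrow>
    frag_of (g, g') - frag_of (h, h') \<in> Ker"
  by (intro Ker_symbol_relations sign_in_symbol_relations)

lemma Ker_Tpow:
  "g \<in> carrier SL2Z \<Longrightarrow> frag_of (g, g ** Tpow m) - frag_cmul m (frag_of (g, g ** matT)) \<in> Ker"
  by (intro Ker_symbol_relations Tpow_in_symbol_relations)

lemma Ker_refl: "g \<in> carrier SL2Z \<Longrightarrow> frag_of (g, g) \<in> Ker"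
  using Ker_Tpow[of g 0] by (simp add: Tpow_0)

lemma Ker_sym:
  "g \<in> carrier SL2Z \<Longrightarrow> g' \<in> carrier SL2Z \<Longrightarrow> frag_of (g, g') + frag_of (g', g) \<in> Ker"
  using Ker_diff[OF Ker_triangle[of g g' g] Ker_refl[of g]] by simp

lemma Ker_chain:
  assumes "g \<in> carrier SL2Z" "g' \<in> carrier SL2Z" "g'' \<in> carrier SL2Z"
  shows "frag_of (g, g'') - (frag_of (g, g') + frag_of (g', g'')) \<in> Ker"
  using Ker_diff[OF Ker_sym[of g g''] Ker_triangle[of g g' g'']] assms by (simp add: algebra_simps)

lemma Ker_left_mult:
  assumes "\<gamma> \<in> \<Gamma>" "g \<in> carrier SL2Z" "g' \<in> carrier SL2Z"
  shows "frag_of (\<gamma> ** g, \<gamma> ** g') - frag_of (g, g') \<in> Ker"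
  using mms_Gamma_invariant[OF \<Gamma> assms] proj_eq_iff[of "frag_of (\<gamma> ** g, \<gamma> ** g')" "frag_of (g, g')"] assms
  by (simp add: proj_of mult_SL2Z)

lemma Ker_Gcoset:
  assumes eq: "Gcoset \<Gamma> h = Gcoset \<Gamma> g"
    and g: "g \<in> carrier SL2Z" and h: "h \<in> carrier SL2Z" and k: "k \<in> carrier SL2Z"
  shows "frag_of (h, h ** k) - frag_of (g, g ** k) \<in> Ker"
proof -
  obtain \<gamma> where \<gamma>: "\<gamma> \<in> \<Gamma>" "h = \<gamma> ** g \<or> h = - (\<gamma> ** g)" using eq Gcoset_eq[OF g h] by blast
  let ?h = "\<gamma> ** g"
  have "frag_of (h, h ** k) - frag_of (?h, ?h ** k) \<in> Ker"
    using \<gamma>(2) g h k \<gamma>(1) by (intro Ker_sign) (auto simp: matrix_mul_assoc)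
  from Ker_add[OF this Ker_left_mult[OF \<gamma>(1) g, of "g ** k"]] show ?thesis
    using g k by (simp add: matrix_mul_assoc)
qed

lemma liftA_Gcoset:
  assumes g: "g \<in> carrier SL2Z"
  shows "liftA (frag_of (Gcoset \<Gamma> g)) - frag_of (g, g ** matS) \<in> Ker"
  unfolding liftA_of using rep[of "Gcoset \<Gamma> g"] g by (intro Ker_Gcoset) simp_all

text \<open>The symbol {g T^m, g T^(m+1)} is the difference of {g, g T^(m+1)} and {g, g T^m}, that
  is, of m + 1 and m copies of {g, gT}. This makes the T-symbol a function of the cusp
  alone.\<close>

lemma Ker_shift_T:
  assumes g: "g \<in> carrier SL2Z"
  shows "frag_of (g ** Tpow m, g ** Tpow m ** matT) - frag_of (g, g ** matT) \<in> Ker"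
proof -
  let ?h = "g ** Tpow m" and ?b = "frag_of (g, g ** matT)"
  have e: "?h ** matT = g ** Tpow (m + 1)" by (simp add: Tpow_add_assoc flip: Tpow_1)
  have 1: "frag_of (g, ?h ** matT) - (frag_of (g, ?h) + frag_of (?h, ?h ** matT)) \<in> Ker"
    using g by (intro Ker_chain) simp_all
  have 2: "frag_of (g, ?h ** matT) - frag_cmul (m + 1) ?b \<in> Ker"
    unfolding e using Ker_Tpow[OF g] .
  have "frag_of (?h, ?h ** matT) - ?b = ((frag_of (g, ?h ** matT) - frag_cmul (m + 1) ?b)
      - (frag_of (g, ?h) - frag_cmul m ?b))
      - (frag_of (g, ?h ** matT) - (frag_of (g, ?h) + frag_of (?h, ?h ** matT)))"
    by (simp add: frag_cmul_distrib)
  also have "\<dots> \<in> Ker" by (rule Ker_diff[OF Ker_diff[OF 2 Ker_Tpow[OF g]] 1])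
  finally show ?thesis .
qed

lemma liftB_cusp_at:
  assumes g: "g \<in> carrier SL2Z"
  shows "liftB (frag_of (cusp_at \<Gamma> g)) - frag_of (g, g ** matT) \<in> Ker"
proof -
  let ?h = "crep (cusp_at \<Gamma> g)"
  have h: "?h \<in> carrier SL2Z" "cusp_at \<Gamma> ?h = cusp_at \<Gamma> g"
    using crep[of "cusp_at \<Gamma> g"] g cusps_eq by auto
  then obtain m where "Gcoset \<Gamma> ?h = Gcoset \<Gamma> (g ** Tpow m)" using cusp_at_eq_iff[OF g h(1)] by blast
  from Ker_Gcoset[OF this _ h(1), of matT]
  have "frag_of (?h, ?h ** matT) - frag_of (g ** Tpow m, g ** Tpow m ** matT) \<in> Ker" using g by simp
  from Ker_add[OF this Ker_shift_T[OF g, of m]] show ?thesis by (simp add: liftB_of)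
qed

lemma S_sum_in_Ker:
  assumes "Poly_Mapping.keys u \<subseteq> X"
  shows "liftA (u + rmul matS u) \<in> Ker"
  using assms
proof (induction rule: free_Abelian_group_induct[consumes 1])
  case 1 show ?case by (simp add: rmul_def Ker_0)
next
  case (2 x y)
  have "liftA (x - y + rmul matS (x - y)) = liftA (x + rmul matS x) - liftA (y + rmul matS y)"
    by (simp add: rmul_def frag_extend_diff liftA_add liftA_diff)
  then show ?case using Ker_diff[OF 2(3,4)] by simp
next
  case (3 C)
  then obtain g where g: "g \<in> carrier SL2Z" "C = Gcoset \<Gamma> g" by blast
  let ?h = "g ** matS"
  have "liftA (frag_of C + rmul matS (frag_of C))
    = ((liftA (frag_of (Gcoset \<Gamma> g)) - frag_of (g, ?h)) + (liftA (frag_of (Gcoset \<Gamma> ?h)) - frag_of (?h, ?h ** matS)))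
      + ((frag_of (g, ?h) + frag_of (?h, g)) - (frag_of (?h, g) - frag_of (?h, ?h ** matS)))"
    by (simp add: g rmul_of liftA_add)
  also have "\<dots> \<in> Ker"
    by (rule Ker_add[OF Ker_add[OF liftA_Gcoset liftA_Gcoset] Ker_diff[OF Ker_sym Ker_sign]])
       (use g in \<open>simp_all add: matSS\<close>)
  finally show ?case .
qed

text \<open>A coset fixed by S is invariant without being of the form u + uS, so the relation is
  obtained for twice \<open>s\<close> and then divided by 2.\<close>

lemma liftA_Inv_S:
  assumes "s \<in> Inv matS" shows "liftA s \<in> Ker"
proof (rule Ker_saturated)
  have s: "Poly_Mapping.keys s \<subseteq> X" "rmul matS s = s" using assms by (auto simp: Inv_def)
  show "liftA s \<in> Pre" by (rule liftA_Pre[OF s(1)])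
  have "frag_cmul 2 (liftA s) = liftA (s + rmul matS s)"
    using frag_cmul_distrib[of 1 1 "liftA s"] by (simp add: s liftA_add)
  then show "frag_cmul 2 (liftA s) \<in> Ker" using S_sum_in_Ker[OF s(1)] by simp
qed simp

lemma U_sum_in_Ker:
  assumes "Poly_Mapping.keys u \<subseteq> X"
  shows "liftA (u + rmul matU u + rmul matU (rmul matU u))
    - liftB (Phi (u + rmul matU u + rmul matU (rmul matU u))) \<in> Ker"
  using assms
proof (induction rule: free_Abelian_group_induct[consumes 1])
  case 1 show ?case by (simp add: rmul_def Ker_0)
next
  case (2 x y)
  let ?N = "\<lambda>u. u + rmul matU u + rmul matU (rmul matU u)"
  have e: "?N (x - y) = ?N x - ?N y" by (simp add: rmul_def frag_extend_diff)
  have "liftA (?N (x - y)) - liftB (Phi (?N (x - y)))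
      = (liftA (?N x) - liftB (Phi (?N x))) - (liftA (?N y) - liftB (Phi (?N y)))"
    unfolding e by (simp only: liftA_diff liftB_diff Phi_diff) simp
  then show ?case using Ker_diff[OF 2(3,4)] by simp
next
  case (3 C)
  then obtain g where g: "g \<in> carrier SL2Z" "C = Gcoset \<Gamma> g" by blast
  let ?a = "\<lambda>g. liftA (frag_of (Gcoset \<Gamma> g))" and ?b = "\<lambda>g. liftB (frag_of (cusp_at \<Gamma> g))"
  \<comment> \<open>The symbol {h, hU} is {h, hT} + {hT, hU}, and the last term is the negative of
    {hU, hUS}, because hUS = - hT.\<close>
  have step: "?b h - ?a (h ** matU) - frag_of (h, h ** matU) \<in> Ker" if h: "h \<in> carrier SL2Z" for h
  proof -
    let ?k = "h ** matU"
    have e: "frag_of (?k, ?k ** matS) + frag_of (h ** matT, ?k) \<in> Ker"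
    proof -
      have "frag_of (?k ** matS, ?k) - frag_of (h ** matT, ?k) \<in> Ker"
        using h by (intro Ker_sign) (simp_all add: matUS)
      from Ker_diff[OF Ker_sym this, of ?k "?k ** matS"] show ?thesis using h by simp
    qed
    have "?b h - ?a ?k - frag_of (h, ?k)
      = ((?b h - frag_of (h, h ** matT)) - (?a ?k - frag_of (?k, ?k ** matS)))
        - ((frag_of (?k, ?k ** matS) + frag_of (h ** matT, ?k))
          + (frag_of (h, ?k) - (frag_of (h, h ** matT) + frag_of (h ** matT, ?k))))"
      by simp
    also have "\<dots> \<in> Ker"
      using h by (intro Ker_diff[OF Ker_diff[OF liftB_cusp_at liftA_Gcoset] Ker_add[OF e Ker_chain]]) simp_all
    finally show ?thesis .
  qed
  let ?g1 = "g ** matU" and ?g2 = "g ** matU ** matU"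
  have tri: "frag_of (g, ?g1) + frag_of (?g1, ?g2) + frag_of (?g2, ?g2 ** matU) \<in> Ker"
  proof -
    have "frag_of (?g2, g) - frag_of (?g2, ?g2 ** matU) \<in> Ker"
      using g by (intro Ker_sign) (simp_all add: matUUU)
    from Ker_diff[OF Ker_triangle[of g ?g1 ?g2] this] show ?thesis using g by (simp add: add.assoc)
  qed
  have "liftA (frag_of C + rmul matU (frag_of C) + rmul matU (rmul matU (frag_of C)))
     - liftB (Phi (frag_of C + rmul matU (frag_of C) + rmul matU (rmul matU (frag_of C))))
    = - (((?b g - ?a ?g1 - frag_of (g, ?g1)) + (?b ?g1 - ?a ?g2 - frag_of (?g1, ?g2)))
       + (?b ?g2 - ?a (?g2 ** matU) - frag_of (?g2, ?g2 ** matU))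
       + (frag_of (g, ?g1) + frag_of (?g1, ?g2) + frag_of (?g2, ?g2 ** matU)))"
    using g by (simp add: rmul_of liftA_add liftB_add Phi_add Phi_of matUUU)
  also have "\<dots> \<in> Ker"
    using g by (intro Ker_minus Ker_add[OF Ker_add[OF Ker_add[OF step step] step] tri]) simp_all
  finally show ?case .
qed

text \<open>As for S, with the factor 3: for invariant \<open>v\<close> the sum over the powers of U
  is three times \<open>v\<close>.\<close>

lemma liftA_Inv_U:
  assumes "v \<in> Inv matU" shows "liftA v - liftB (Phi v) \<in> Ker"
proof (rule Ker_saturated)
  have v: "Poly_Mapping.keys v \<subseteq> X" "rmul matU v = v" using assms by (auto simp: Inv_def)
  show "liftA v - liftB (Phi v) \<in> Pre"
    using liftA_Pre[OF v(1)] liftB_Pre[OF keys_Phi[OF v(1)]] by simp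
  have 3: "frag_cmul 3 x = x + x + x" for x :: "'c \<Rightarrow>\<^sub>0 int"
    using frag_cmul_distrib[of 1 2 x] frag_cmul_distrib[of 1 1 x] by simp
  show "frag_cmul 3 (liftA v - liftB (Phi v)) \<in> Ker"
    using U_sum_in_Ker[OF v(1)] by (simp add: v 3 liftA_add liftB_add Phi_add algebra_simps)
qed simp

lemma ones_Inv: "k \<in> carrier SL2Z \<Longrightarrow> ones \<in> Inv k"
  by (simp add: Inv_iff keys_ones lookup_ones)

text \<open>\<open>ones\<close> is invariant under S, which kills \<open>liftA ones\<close>, and
  under U, which identifies it with \<open>liftB (Phi ones)\<close>. So a positive multiple of
  \<open>liftB eps\<close> is zero.\<close>

lemma liftB_eps: "liftB eps \<in> Ker"
proof (rule Ker_saturated)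
  show "liftB eps \<in> Pre" by (rule liftB_Pre[OF keys_eps])
  show "int (width_gcd \<Gamma>) > 0" using width_gcd_pos by simp
  have "frag_cmul (int (width_gcd \<Gamma>)) (liftB eps) = liftA ones - (liftA ones - liftB (Phi ones))"
    by (simp add: Phi_ones liftB_cmul)
  also have "\<dots> \<in> Ker" by (intro Ker_diff[OF liftA_Inv_S liftA_Inv_U] ones_Inv) simp_all
  finally show "frag_cmul (int (width_gcd \<Gamma>)) (liftB eps) \<in> Ker" .
qed

lemma Ker_cmul: "x \<in> Ker \<Longrightarrow> frag_cmul m x \<in> Ker"
  by (rule frag_closure_minus_cmul[where P = "\<lambda>x. x \<in> Ker"]) (auto intro: Ker_0 Ker_diff)

text \<open>The presentation of \<open>MMS_Gamma\<close>, completed by \<open>Pre_generated\<close>.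
  Applying \<open>Psi\<close> shows that \<open>Ker\<close> imposes nothing beyond \<open>R\<close>;
  the converse collects the relations verified above.\<close>

lemma lift_in_Ker_iff:
  assumes u: "Poly_Mapping.keys u \<subseteq> X" and w: "Poly_Mapping.keys w \<subseteq> cusps \<Gamma>"
  shows "liftA u + liftB w \<in> Ker \<longleftrightarrow> (u, w) \<in> R"
proof
  assume "liftA u + liftB w \<in> Ker"
  then have "Psi (liftA u) + Psi (liftB w) \<in> R" using Ker_Psi by (simp flip: Psi_add)
  from R_diff[OF this R_add[OF Psi_liftA[OF u] Psi_liftB[OF w]]]
  show "(u, w) \<in> R" by (simp add: algebra_simps)
next
  assume "(u, w) \<in> R"
  then obtain s v k where svk: "u = s + v" "s \<in> Inv matS" "v \<in> Inv matU" "Phi v + w = frag_cmul k eps"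
    by (elim R_E)
  have "liftA u + liftB w = liftA s + (liftA v - liftB (Phi v)) + liftB (Phi v + w)"
    by (simp add: svk(1) liftA_add liftB_add)
  also have "\<dots> \<in> Ker" unfolding svk(4) liftB_cmul
    by (intro Ker_add liftA_Inv_S liftA_Inv_U Ker_cmul liftB_eps svk)
  finally show "liftA u + liftB w \<in> Ker" .
qed

text \<open>By the triangle relation it suffices to treat symbols that start at the identity. A path
  of S- and U-steps breaks these up, and each U-step passes through gT, being a T-step followed by
  an S-step.\<close>

lemma Pre_generated:
  assumes "y \<in> Pre"
  shows "\<exists>u w. Poly_Mapping.keys u \<subseteq> X \<and> Poly_Mapping.keys w \<subseteq> cusps \<Gamma> \<and> y - (liftA u + liftB w) \<in> Ker"
    (is "?P y")
proof -
  have add: "?P (y + y')" if "?P y" "?P y'" for y y'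
  proof -
    from that(1) obtain u w where
      1: "Poly_Mapping.keys u \<subseteq> X" "Poly_Mapping.keys w \<subseteq> cusps \<Gamma>" "y - (liftA u + liftB w) \<in> Ker"
      by (elim exE conjE) (rule that)
    from that(2) obtain u' w' where
      2: "Poly_Mapping.keys u' \<subseteq> X" "Poly_Mapping.keys w' \<subseteq> cusps \<Gamma>" "y' - (liftA u' + liftB w') \<in> Ker"
      by (elim exE conjE) (rule that)
    have "y + y' - (liftA (u + u') + liftB (w + w')) \<in> Ker"
      using Ker_add[OF 1(3) 2(3)] by (simp add: liftA_add liftB_add algebra_simps)
    then show ?thesis using keys_add_subset[OF 1(1) 2(1)] keys_add_subset[OF 1(2) 2(2)]
      by (intro exI conjI)
  qed
  have neg: "?P (- y)" if "?P y" for y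
  proof -
    from that obtain u w where
      1: "Poly_Mapping.keys u \<subseteq> X" "Poly_Mapping.keys w \<subseteq> cusps \<Gamma>" "y - (liftA u + liftB w) \<in> Ker"
      by (elim exE conjE) (rule that)
    have "- y - (liftA (- u) + liftB (- w)) \<in> Ker"
      using Ker_minus[OF 1(3)] by (simp add: liftA_minus liftB_minus algebra_simps)
    then show ?thesis using 1(1,2) by (intro exI[of _ "- u"] exI[of _ "- w"]) simp
  qed
  have ker: "?P y" if "y - y' \<in> Ker" "?P y'" for y y'
  proof -
    from that(2) obtain u w where
      1: "Poly_Mapping.keys u \<subseteq> X" "Poly_Mapping.keys w \<subseteq> cusps \<Gamma>" "y' - (liftA u + liftB w) \<in> Ker"
      by (elim exE conjE) (rule that)
    have "y - (liftA u + liftB w) \<in> Ker" using Ker_add[OF that(1) 1(3)] by (simp add: algebra_simps)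
    then show ?thesis using 1(1,2) by (intro exI conjI)
  qed
  have zero: "?P 0" by (intro exI[of _ 0]) (simp add: Ker_0)
  have A: "?P (frag_of (g, g ** matS))" if g: "g \<in> carrier SL2Z" for g
    using Ker_minus[OF liftA_Gcoset[OF g]] g
    by (intro exI[of _ "frag_of (Gcoset \<Gamma> g)"] exI[of _ 0]) simp
  have B: "?P (frag_of (g, g ** matT))" if g: "g \<in> carrier SL2Z" for g
    using Ker_minus[OF liftB_cusp_at[OF g]] g cusps_eq
    by (intro exI[of _ 0] exI[of _ "frag_of (cusp_at \<Gamma> g)"]) simp
  have base: "?P (frag_of (mat 1, g))" if "g \<in> carrier SL2Z" for g
    using that
  proof (induction rule: SL2Z_induct)
    case one show ?case by (rule ker[OF _ zero]) (simp add: Ker_refl)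
  next
    case (S g)
    show ?case by (rule ker[OF Ker_chain add[OF S(2) A[OF S(1)]]]) (use S in simp_all)
  next
    case (U g)
    have 1: "?P (frag_of (mat 1, g ** matT))"
      by (rule ker[OF Ker_chain add[OF U(2) B[OF U(1)]]]) (use U in simp_all)
    have 2: "?P (frag_of (g ** matT, g ** matU))" using A[of "g ** matT"] U(1) by (simp only: matTS_eq) simp
    have "g ** matT \<in> carrier SL2Z" "g ** matU \<in> carrier SL2Z" using U(1) by simp_all
    from ker[OF Ker_chain[OF mat_in_SL2Z(4) this] add[OF 1 2]] show ?case .
  qed
  have gen: "?P (frag_of (g, g'))" if "g \<in> carrier SL2Z" "g' \<in> carrier SL2Z" for g g'
  proof -
    have "frag_of (g, g') - (frag_of (mat 1, g') + - frag_of (mat 1, g))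
        = - (frag_of (mat 1, g') - (frag_of (mat 1, g) + frag_of (g, g')))" by simp
    also have "\<dots> \<in> Ker" by (rule Ker_minus[OF Ker_chain[OF mat_in_SL2Z(4) that]])
    finally have "frag_of (g, g') - (frag_of (mat 1, g') + - frag_of (mat 1, g)) \<in> Ker" .
    from ker[OF this add[OF base[OF that(2)] neg[OF base[OF that(1)]]]] show ?thesis .
  qed
  have "Poly_Mapping.keys y \<subseteq> carrier SL2Z \<times> carrier SL2Z" using assms by (simp add: presymbols_def)
  then show ?thesis
  proof (induction rule: free_Abelian_group_induct[consumes 1])
    case 1 show ?case by (rule zero)
  next
    case (2 x y) show ?case using add[OF 2(3) neg[OF 2(4)]] by simp
  next
    case (3 a) then show ?case by (elim SigmaE) (simp only: gen)
  qed
qed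

lemma manin_map_eq:
  assumes u: "Poly_Mapping.keys u \<subseteq> X"
  shows "manin_map \<Gamma> u = proj (liftA u)"
proof (rule hom_free_Abelian_group_eqI[OF _ _ _ _ u])
  show "manin_map \<Gamma> \<in> hom (free_Abelian_group X) (MMS_Gamma \<Gamma>)"
    using manin_map(1)[OF \<Gamma>] by (simp add: ZPSL_eq)
  have "liftA \<in> hom (free_Abelian_group X) presymbols"
    by (auto intro!: homI simp: liftA_Pre liftA_add)
  from hom_compose[OF this proj.homh]
  show "(\<lambda>u. proj (liftA u)) \<in> hom (free_Abelian_group X) (MMS_Gamma \<Gamma>)" by (simp add: comp_def)
  show "group (MMS_Gamma \<Gamma>)" by (rule MG.is_group)
  fix C assume "C \<in> X"
  then obtain g where g: "g \<in> carrier SL2Z" "C = Gcoset \<Gamma> g" by blast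
  then have "proj (liftA (frag_of C)) = mms_Gamma \<Gamma> g (g ** matS)"
    using liftA_Gcoset[OF g(1)] liftA_Pre[of "frag_of C"] by (simp add: proj_eq_iff flip: proj_of)
  then show "manin_map \<Gamma> (frag_of C) = proj (liftA (frag_of C))"
    using manin_map(2)[OF \<Gamma> g(1)] g by (simp add: mult_SL2Z)
qed

lemma mms_Gamma_T:
  assumes g: "g \<in> carrier SL2Z"
  shows "mms_Gamma \<Gamma> g (g ** matT) = proj (liftB (frag_of (cusp_at \<Gamma> g)))"
proof -
  have "liftB (frag_of (cusp_at \<Gamma> g)) \<in> Pre" using g cusps_eq by (intro liftB_Pre) simp
  then show ?thesis
    using liftB_cusp_at[OF g] g proj_eq_iff[of "liftB (frag_of (cusp_at \<Gamma> g))" "frag_of (g, g ** matT)"]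
    by (simp add: proj_of)
qed

lemma carrier_ZPSL: "u \<in> carrier (ZPSL \<Gamma>) \<longleftrightarrow> Poly_Mapping.keys u \<subseteq> X"
  by (simp add: ZPSL_eq)

lemma kernel_cusp_map:
  "kernel (ZPSL_inv \<Gamma> matU) (Zcusps0 \<Gamma>) (cusp_map \<Gamma>) = {v \<in> Inv matU. \<exists>k. Phi v = frag_cmul k eps}"
  unfolding kernel_def carrier_ZPSL_inv using cusp_map_eq_one_iff Inv_keys by blast

lemma kernel_manin_map_iff:
  assumes "Poly_Mapping.keys u \<subseteq> X"
  shows "manin_map \<Gamma> u = \<one>\<^bsub>MMS_Gamma \<Gamma>\<^esub> \<longleftrightarrow> (u, 0) \<in> R"
  using assms lift_in_Ker_iff[OF assms, of 0] liftA_Pre[OF assms]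
  by (simp add: manin_map_eq Ker_def)

text \<open>This is the slice of \<open>R\<close> with second component 0: there u = s + v, where
  \<open>Phi v\<close> is a multiple of \<open>eps\<close>.\<close>

lemma kernel_manin_map:
  "kernel (ZPSL \<Gamma>) (MMS_Gamma \<Gamma>) (manin_map \<Gamma>)
      = generate (ZPSL \<Gamma>)
          (carrier (ZPSL_inv \<Gamma> matS) \<union> kernel (ZPSL_inv \<Gamma> matU) (Zcusps0 \<Gamma>) (cusp_map \<Gamma>))"
    (is "?K = generate _ ?G")
proof
  interpret Z: comm_group "ZPSL \<Gamma>" unfolding ZPSL_eq by (rule abelian_free_Abelian_group)
  interpret mm: group_hom "ZPSL \<Gamma>" "MMS_Gamma \<Gamma>" "manin_map \<Gamma>"
    by unfold_locales (rule manin_map(1)[OF \<Gamma>])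
  show "?K \<subseteq> generate (ZPSL \<Gamma>) ?G"
  proof
    fix u assume "u \<in> ?K"
    then have "(u, 0) \<in> R"
      by (simp add: kernel_def carrier_ZPSL kernel_manin_map_iff cong: conj_cong)
    then obtain s v k where svk: "u = s + v" "s \<in> Inv matS" "v \<in> Inv matU" "Phi v + 0 = frag_cmul k eps"
      by (elim R_E)
    then have "s \<in> ?G" "v \<in> ?G" by (auto simp: carrier_ZPSL_inv kernel_cusp_map)
    then have "s \<otimes>\<^bsub>ZPSL \<Gamma>\<^esub> v \<in> generate (ZPSL \<Gamma>) ?G" by (intro generate.eng generate.incl)
    then show "u \<in> generate (ZPSL \<Gamma>) ?G" by (simp add: svk(1) ZPSL_eq)
  qed
  have "u \<in> ?K" if u: "u \<in> ?G" for u
  proof -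
    have "Poly_Mapping.keys u \<subseteq> X \<and> (u, 0) \<in> R"
    proof (cases "u \<in> Inv matS")
      case True then show ?thesis using R_I[OF True Inv_0, of 0 0] Inv_keys by simp
    next
      case False
      then obtain k where "u \<in> Inv matU" "Phi u = frag_cmul k eps"
        using u by (auto simp: carrier_ZPSL_inv kernel_cusp_map)
      then show ?thesis using R_I[OF Inv_0, of u 0 k] Inv_keys by simp
    qed
    then show ?thesis by (simp add: kernel_def carrier_ZPSL kernel_manin_map_iff)
  qed
  then show "generate (ZPSL \<Gamma>) ?G \<subseteq> ?K"
    by (intro Z.generate_subgroup_incl mm.subgroup_kernel) blast
qed

end

section \<open>The cokernel of the Manin map\<close>


lemma (in group_hom) hom_eq_iff:
  assumes "x \<in> carrier G" "y \<in> carrier G"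
  shows "h x = h y \<longleftrightarrow> h (x \<otimes> inv y) = \<one>\<^bsub>H\<^esub>"
  using assms H.inv_solve_right[of "\<one>\<^bsub>H\<^esub>" "h x" "h y"] by (simp add: eq_commute[of "\<one>\<^bsub>H\<^esub>"])

text \<open>Two surjections from one group with equal kernels. The isomorphism comes with its values
  on images of elements of \<open>G\<close>, which is what makes the one in part (1)
  canonical.\<close>

lemma iso_of_same_kernel:
  assumes p: "group_hom G A p" "p ` carrier G = carrier A"
    and q: "group_hom G B q" "q ` carrier G = carrier B"
    and ker: "\<And>x. x \<in> carrier G \<Longrightarrow> p x = \<one>\<^bsub>A\<^esub> \<longleftrightarrow> q x = \<one>\<^bsub>B\<^esub>"
  shows "\<exists>h\<in>iso A B. \<forall>x\<in>carrier G. h (p x) = q x"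
proof -
  interpret p: group_hom G A p by (rule p)
  interpret q: group_hom G B q by (rule q)
  have eq: "p x = p y \<longleftrightarrow> q x = q y" if "x \<in> carrier G" "y \<in> carrier G" for x y
    using that ker[of "x \<otimes>\<^bsub>G\<^esub> inv\<^bsub>G\<^esub> y"] p.hom_eq_iff q.hom_eq_iff by simp
  define h where "h a = q (SOME x. x \<in> carrier G \<and> p x = a)" for a
  have h: "h (p x) = q x" if "x \<in> carrier G" for x
  proof -
    have "\<exists>y. y \<in> carrier G \<and> p y = p x" using that by blast
    from someI_ex[OF this] show ?thesis unfolding h_def using eq that by blast
  qed
  have "h \<in> iso A B"
  proof (rule isoI)
    show "h \<in> hom A B"
    proof (rule homI)
      fix a assume "a \<in> carrier A"
      then obtain x where "x \<in> carrier G" "a = p x" unfolding p(2)[symmetric] by blast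
      then show "h a \<in> carrier B" by (simp add: h)
    next
      fix a b assume "a \<in> carrier A" "b \<in> carrier A"
      then obtain x y where "x \<in> carrier G" "a = p x" "y \<in> carrier G" "b = p y"
        unfolding p(2)[symmetric] by blast
      then show "h (a \<otimes>\<^bsub>A\<^esub> b) = h a \<otimes>\<^bsub>B\<^esub> h b" by (simp add: h flip: p.hom_mult)
    qed
    show "bij_betw h (carrier A) (carrier B)"
      unfolding bij_betw_def p(2)[symmetric] q(2)[symmetric] inj_on_def
      using eq h by (auto simp: image_image)
  qed
  then show ?thesis using h by blast
qed

lemma (in comm_group) coset_hom:
  assumes H: "subgroup H G"
  shows "group_hom G (G Mod H) (\<lambda>x. H #> x)"
    and "(\<lambda>x. H #> x) ` carrier G = carrier (G Mod H)"
    and "\<And>x. x \<in> carrier G \<Longrightarrow> H #> x = \<one>\<^bsub>G Mod H\<^esub> \<longleftrightarrow> x \<in> H"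
proof -
  interpret N: normal H G by (rule subgroup_imp_normal[OF H])
  show "group_hom G (G Mod H) (\<lambda>x. H #> x)"
    using N.r_coset_hom_Mod N.factorgroup_is_group is_group
    by (simp add: group_hom_def group_hom_axioms_def)
  show "(\<lambda>x. H #> x) ` carrier G = carrier (G Mod H)" by (auto simp: carrier_FactGroup)
  show "H #> x = \<one>\<^bsub>G Mod H\<^esub> \<longleftrightarrow> x \<in> H" if "x \<in> carrier G" for x
    unfolding one_FactGroup using coset_join1[OF _ that H] coset_join2[OF that H] by blast
qed

lemma group_hom_comp:
  assumes "group_hom G H f" "group_hom H K g" shows "group_hom G K (\<lambda>x. g (f x))"
proof -
  interpret f: group_hom G H f by (rule assms)
  interpret g: group_hom H K g by (rule assms)
  show ?thesis using hom_compose[OF f.homh g.homh] by unfold_locales (simp add: comp_def)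
qed

context finite_index
begin

sublocale ZP: comm_group "ZPSL \<Gamma>"
  unfolding ZPSL_eq by (rule abelian_free_Abelian_group)

sublocale mm: group_hom "ZPSL \<Gamma>" "MMS_Gamma \<Gamma>" "manin_map \<Gamma>"
  by unfold_locales (rule manin_map(1)[OF \<Gamma>])

sublocale cm: group_hom "ZPSL \<Gamma>" "Zcusps0 \<Gamma>" "cusp_map \<Gamma>"
  using comm_group_Zcusps0 cusp_map(1)[OF \<Gamma>]
  by (intro group_hom.intro group_hom_axioms.intro) (auto simp: comm_group_def)

abbreviation "manin_image \<equiv> manin_map \<Gamma> ` carrier (ZPSL \<Gamma>)"

lemma subgroup_manin_image: "subgroup manin_image (MMS_Gamma \<Gamma>)"
  by (rule mm.img_is_subgroup)

lemma subgroup_Inv: "subgroup (Inv k) (ZPSL \<Gamma>)"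
proof
  fix x assume "x \<in> Inv k"
  then show "inv\<^bsub>ZPSL \<Gamma>\<^esub> x \<in> Inv k"
    using inv_free_Abelian_group[OF Inv_keys] by (simp add: ZPSL_eq Inv_minus)
qed (use Inv_keys in \<open>auto simp: ZPSL_eq Inv_0 Inv_add\<close>)

lemma proj_in_manin_image:
  assumes y: "y \<in> Pre"
  shows "proj y \<in> manin_image \<longleftrightarrow> (\<exists>u. Poly_Mapping.keys u \<subseteq> X \<and> y - liftA u \<in> Ker)"
proof -
  have "proj y \<in> manin_image \<longleftrightarrow> (\<exists>u. Poly_Mapping.keys u \<subseteq> X \<and> proj y = proj (liftA u))"
    by (simp only: image_iff Bex_def carrier_ZPSL manin_map_eq cong: conj_cong)
  then show ?thesis using proj_eq_iff[OF y liftA_Pre] by (simp cong: conj_cong)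
qed

text \<open>The first component of an element of \<open>R\<close> is absorbed by the Manin symbols,
  so only the image under \<open>Phi\<close> of its U-invariant part constrains \<open>w\<close>, up
  to sign and multiples of \<open>eps\<close>.\<close>

lemma liftB_in_manin_image:
  assumes w: "Poly_Mapping.keys w \<subseteq> cusps \<Gamma>"
  shows "proj (liftB w) \<in> manin_image \<longleftrightarrow> (\<exists>v\<in>Inv matU. \<exists>k. w = Phi v + frag_cmul k eps)"
proof -
  have "proj (liftB w) \<in> manin_image \<longleftrightarrow> (\<exists>u. Poly_Mapping.keys u \<subseteq> X \<and> liftA (- u) + liftB w \<in> Ker)"
    by (simp add: proj_in_manin_image liftB_Pre[OF w] liftA_minus)
  also have "\<dots> \<longleftrightarrow> (\<exists>u. Poly_Mapping.keys u \<subseteq> X \<and> (- u, w) \<in> R)"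
    using lift_in_Ker_iff[OF _ w] by (intro ex_cong1 conj_cong refl) simp
  also have "\<dots> \<longleftrightarrow> (\<exists>v\<in>Inv matU. \<exists>k. w = Phi v + frag_cmul k eps)"
  proof (intro iffI; elim exE conjE bexE)
    fix u assume "(- u, w) \<in> R"
    then obtain s v k where "v \<in> Inv matU" "Phi v + w = frag_cmul k eps" by (elim R_E)
    then have "- v \<in> Inv matU" "w = Phi (- v) + frag_cmul k eps"
      by (auto simp: Phi_minus Inv_minus algebra_simps simp flip: \<open>Phi v + w = frag_cmul k eps\<close>)
    then show "\<exists>v\<in>Inv matU. \<exists>k. w = Phi v + frag_cmul k eps" by blast
  next
    fix v k assume v: "v \<in> Inv matU" "w = Phi v + frag_cmul k eps"
    then have "(0 + - v, w) \<in> R" by (intro R_I[OF Inv_0 Inv_minus, of v w k]) (simp_all add: Phi_minus)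
    then show "\<exists>u. Poly_Mapping.keys u \<subseteq> X \<and> (- u, w) \<in> R" using Inv_keys[OF v(1)] by auto
  qed
  finally show ?thesis .
qed

text \<open>Both cokernels are quotients of \<open>Zcusps \<Gamma>\<close>, by \<open>?p\<close> and
  \<open>?q\<close>. The map \<open>?q\<close> is onto because S- and T-symbols together generate
  \<open>MMS_Gamma\<close> and the S-symbols vanish in the cokernel.\<close>

lemma cokernel_iso:
  "\<exists>h \<in> iso (cokernel (ZPSL_inv \<Gamma> matU) (Zcusps0 \<Gamma>) (cusp_map \<Gamma>))
              (cokernel (ZPSL \<Gamma>) (MMS_Gamma \<Gamma>) (manin_map \<Gamma>)).
        \<forall>g \<in> carrier SL2Z.
          h (coker_proj (ZPSL_inv \<Gamma> matU) (Zcusps0 \<Gamma>) (cusp_map \<Gamma>) (cusp_class \<Gamma> (cusp_at \<Gamma> g)))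
          = coker_proj (ZPSL \<Gamma>) (MMS_Gamma \<Gamma>) (manin_map \<Gamma>)
              (mms_Gamma \<Gamma> g (g \<otimes>\<^bsub>SL2Z\<^esub> matT))"
proof -
  interpret Z0: comm_group "Zcusps0 \<Gamma>" by (rule comm_group_Zcusps0)
  let ?I = "cusp_map \<Gamma> ` Inv matU"
  have I: "subgroup ?I (Zcusps0 \<Gamma>)" by (rule cm.subgroup_img_is_subgroup[OF subgroup_Inv])
  let ?p = "\<lambda>w. ?I #>\<^bsub>Zcusps0 \<Gamma>\<^esub> zc w" and ?q = "\<lambda>w. manin_image #>\<^bsub>MMS_Gamma \<Gamma>\<^esub> proj (liftB w)"
  let ?A = "Zcusps0 \<Gamma> Mod ?I" and ?B = "MMS_Gamma \<Gamma> Mod manin_image"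
  have zc: "group_hom (Zcusps \<Gamma>) (Zcusps0 \<Gamma>) zc"
    by unfold_locales (rule zc_hom)
  have "liftB \<in> hom (Zcusps \<Gamma>) presymbols"
    by (auto intro!: homI simp: Zcusps_def liftB_Pre liftB_add)
  then have lB: "group_hom (Zcusps \<Gamma>) presymbols liftB" by unfold_locales
  have p: "group_hom (Zcusps \<Gamma>) ?A ?p"
    by (rule group_hom_comp[OF zc Z0.coset_hom(1)[OF I]])
  have q: "group_hom (Zcusps \<Gamma>) ?B ?q"
    by (rule group_hom_comp[OF lB group_hom_comp[OF proj.group_hom_axioms
          MG.coset_hom(1)[OF subgroup_manin_image]]])
  have psurj: "?p ` carrier (Zcusps \<Gamma>) = carrier ?A"
    unfolding Z0.coset_hom(2)[OF I, symmetric] carrier_Zcusps0 image_image ..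
  have qsurj: "?q ` carrier (Zcusps \<Gamma>) = carrier ?B"
  proof
    show "?q ` carrier (Zcusps \<Gamma>) \<subseteq> carrier ?B"
      using group_hom.hom_closed[OF q] by blast
    show "carrier ?B \<subseteq> ?q ` carrier (Zcusps \<Gamma>)"
    proof
      fix c assume "c \<in> carrier ?B"
      then obtain y where y: "y \<in> Pre" "c = manin_image #>\<^bsub>MMS_Gamma \<Gamma>\<^esub> proj y"
        by (auto simp: carrier_FactGroup carrier_MMS_Gamma)
      obtain u w where uw: "Poly_Mapping.keys u \<subseteq> X" "Poly_Mapping.keys w \<subseteq> cusps \<Gamma>"
        "y - (liftA u + liftB w) \<in> Ker" using Pre_generated[OF y(1)] by (elim exE conjE) (rule that)
      have B: "liftB w \<in> Pre" by (rule liftB_Pre[OF uw(2)])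
      have d: "y - liftB w - liftA u \<in> Ker" using uw(3) by (simp add: algebra_simps)
      have "proj (y - liftB w) \<in> manin_image"
        using d uw(1) y(1) B by (subst proj_in_manin_image) auto
      moreover have "proj y = proj (y - liftB w) \<otimes>\<^bsub>MMS_Gamma \<Gamma>\<^esub> proj (liftB w)"
        using y(1) B proj.hom_mult[of "y - liftB w" "liftB w"] by simp
      ultimately have "proj y \<in> manin_image #>\<^bsub>MMS_Gamma \<Gamma>\<^esub> proj (liftB w)"
        by (auto simp: r_coset_def)
      then have "c = ?q w" unfolding y(2)
        using MG.repr_independence[OF _ _ subgroup_manin_image, of "proj y" "proj (liftB w)"] B by simp
      then show "c \<in> ?q ` carrier (Zcusps \<Gamma>)" using uw(2) by (simp add: Zcusps_def)
    qed
  qed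
  have ker: "?p w = \<one>\<^bsub>?A\<^esub> \<longleftrightarrow> ?q w = \<one>\<^bsub>?B\<^esub>" if w: "w \<in> carrier (Zcusps \<Gamma>)" for w
  proof -
    have kw: "Poly_Mapping.keys w \<subseteq> cusps \<Gamma>" using w by (simp add: Zcusps_def)
    have "?p w = \<one>\<^bsub>?A\<^esub> \<longleftrightarrow> zc w \<in> ?I"
      using w carrier_Zcusps0 by (intro Z0.coset_hom(3)[OF I]) blast
    also have "\<dots> \<longleftrightarrow> (\<exists>v\<in>Inv matU. zc w = zc (Phi v))"
      by (simp add: image_iff cusp_map_eq Inv_keys cong: bex_cong)
    also have "\<dots> \<longleftrightarrow> (\<exists>v\<in>Inv matU. \<exists>k. w = Phi v + frag_cmul k eps)"
    proof (rule bex_cong[OF refl])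
      fix v assume "v \<in> Inv matU"
      then have v: "Poly_Mapping.keys (Phi v) \<subseteq> cusps \<Gamma>" using keys_Phi Inv_keys by blast
      have d: "Poly_Mapping.keys (w - Phi v) \<subseteq> cusps \<Gamma>" using keys_diff[of w "Phi v"] v kw by blast
      have "zc w = zc (Phi v) \<longleftrightarrow> zc (w - Phi v) = \<one>\<^bsub>Zcusps0 \<Gamma>\<^esub>"
        using group_hom.hom_eq_iff[OF zc, of w "Phi v"] kw v by (simp add: Zcusps_def)
      then show "zc w = zc (Phi v) \<longleftrightarrow> (\<exists>k. w = Phi v + frag_cmul k eps)"
        unfolding zc_eq_one_iff[OF d] by (simp add: diff_eq_eq add.commute)
    qed
    also have "\<dots> \<longleftrightarrow> proj (liftB w) \<in> manin_image" by (rule liftB_in_manin_image[OF kw, symmetric])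
    also have "\<dots> \<longleftrightarrow> ?q w = \<one>\<^bsub>?B\<^esub>"
      using liftB_Pre[OF kw] by (intro MG.coset_hom(3)[OF subgroup_manin_image, symmetric]) simp
    finally show ?thesis .
  qed
  obtain h where h: "h \<in> iso ?A ?B" "\<forall>w\<in>carrier (Zcusps \<Gamma>). h (?p w) = ?q w"
    using iso_of_same_kernel[OF p psurj q qsurj ker] by blast
  have "h (?I #>\<^bsub>Zcusps0 \<Gamma>\<^esub> cusp_class \<Gamma> (cusp_at \<Gamma> g))
      = manin_image #>\<^bsub>MMS_Gamma \<Gamma>\<^esub> mms_Gamma \<Gamma> g (g ** matT)" if g: "g \<in> carrier SL2Z" for g
  proof -
    have "frag_of (cusp_at \<Gamma> g) \<in> carrier (Zcusps \<Gamma>)" using g by (simp add: Zcusps_def cusps_eq)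
    then show ?thesis using h(2) by (simp only: cusp_class_eq mms_Gamma_T[OF g])
  qed
  then show ?thesis using h(1)
    by (intro bexI[of _ h] ballI) (simp_all only: cokernel_def coker_proj_def carrier_ZPSL_inv mult_SL2Z)
qed

end

text \<open>Without fixed points, \<open>\<sigma>\<close> has only orbits of length 3, on which
  \<open>f\<close> is constant; the induction removes one orbit at a time.\<close>

lemma dvd_sum_free_order_3:
  fixes f :: "'a \<Rightarrow> int"
  assumes "finite A"
    and "\<And>x. x \<in> A \<Longrightarrow> \<sigma> x \<in> A" "\<And>x. x \<in> A \<Longrightarrow> \<sigma> (\<sigma> (\<sigma> x)) = x"
    and "\<And>x. x \<in> A \<Longrightarrow> \<sigma> x \<noteq> x" "\<And>x. x \<in> A \<Longrightarrow> f (\<sigma> x) = f x"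
  shows "3 dvd sum f A"
  using assms
proof (induction "card A" arbitrary: A rule: less_induct)
  case (less A)
  show ?case
  proof (cases "A = {}")
    case False
    then obtain x where x: "x \<in> A" by blast
    let ?B = "{x, \<sigma> x, \<sigma> (\<sigma> x)}"
    have B: "?B \<subseteq> A" using x less.prems(2) by blast
    have ne: "x \<noteq> \<sigma> x" "\<sigma> x \<noteq> \<sigma> (\<sigma> x)" "x \<noteq> \<sigma> (\<sigma> x)"
      using x less.prems(2-4) by metis+
    have "y \<in> ?B" if yB: "y \<in> A" "\<sigma> y \<in> ?B" for y
    proof -
      have y: "y = \<sigma> (\<sigma> (\<sigma> y))" and x3: "\<sigma> (\<sigma> (\<sigma> x)) = x" using yB(1) x less.prems(3) by simp_all
      consider "\<sigma> y = x" | "\<sigma> y = \<sigma> x" | "\<sigma> y = \<sigma> (\<sigma> x)" using yB(2) by blast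
      then have "y = \<sigma> (\<sigma> x) \<or> y = x \<or> y = \<sigma> x" using y x3 by cases metis+
      then show ?thesis by blast
    qed
    then have closed: "\<sigma> y \<in> A - ?B" if "y \<in> A - ?B" for y
      using that less.prems(2) by blast
    have "A - ?B \<subset> A" using x by blast
    from psubset_card_mono[OF less.prems(1) this] have "3 dvd sum f (A - ?B)"
      by (rule less.hyps) (use less.prems closed in simp_all)
    moreover have "sum f ?B = 3 * f x" using ne x less.prems(2,5) by simp
    moreover have "sum f A = sum f (A - ?B) + sum f ?B" by (rule sum.subset_diff[OF B less.prems(1)])
    ultimately show ?thesis by simp
  qed simp
qed

section \<open>The index of the image of the Manin map\<close>


definition Lpow :: "int \<Rightarrow> imat2" where
  "Lpow m = mat2 1 0 m 1"

lemma Lpow_in_SL2Z [simp]: "Lpow m \<in> carrier SL2Z"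
  by (simp add: carrier_SL2Z_iff Lpow_def)

lemma mult_Lpow [simp]:
  fixes g :: imat2
  shows "(g ** Lpow m) $ i $ 1 = g $ i $ 1 + m * g $ i $ 2" "(g ** Lpow m) $ i $ 2 = g $ i $ 2"
  by (simp_all add: mat2_mult_nth Lpow_def)

lemma mult_Tpow [simp]:
  fixes g :: imat2
  shows "(g ** Tpow m) $ i $ 1 = g $ i $ 1" "(g ** Tpow m) $ i $ 2 = m * g $ i $ 1 + g $ i $ 2"
  by (simp_all add: mat2_mult_nth Tpow_def)

lemma Lpow_add: "g ** Lpow m ** Lpow n = g ** Lpow (m + n)" for g :: imat2
  by (simp add: mat2_eq_iff algebra_simps)

lemma Lpow_0: "g ** Lpow 0 = g" for g :: imat2
  by (simp add: mat2_eq_iff)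

lemma matU_eq_Lpow: "g ** matU = g ** Lpow 1 ** Tpow (- 1)" for g :: imat2
  by (simp add: mat2_eq_iff)

lemma matUU_eq: "g ** matU ** matU = g ** matS ** Tpow (- 1)" for g :: imat2
  by (simp add: mat2_eq_iff)

lemma matS_eq: "g ** matS = g ** Tpow (- 1) ** matU" for g :: imat2
  by (simp add: mat2_eq_iff)

lemma matSTU_eq: "g ** matS ** matT ** matU = - (g ** Lpow (- 2))" for g :: imat2
  by (simp add: mat2_eq_iff)

context finite_index
begin

definition cuspB :: "imat2 \<Rightarrow> presymbol" where
  "cuspB g = liftB (frag_of (cusp_at \<Gamma> g))"

text \<open>The preimage in the presymbols of the image of the Manin map: equality in the cokernel
  becomes membership of a difference (\<open>coset_eq_iff_J\<close>).\<close>

definition J :: "presymbol set" where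
  "J = {y \<in> Pre. proj y \<in> manin_image}"

lemma cusp_at_in: "g \<in> carrier SL2Z \<Longrightarrow> cusp_at \<Gamma> g \<in> cusps \<Gamma>"
  by (simp add: cusps_eq)

lemma cuspB_Pre [simp]: "g \<in> carrier SL2Z \<Longrightarrow> cuspB g \<in> Pre"
  unfolding cuspB_def by (intro liftB_Pre) (simp add: cusp_at_in)

lemma cuspB_uminus [simp]: "cuspB (- g) = cuspB g"
  by (simp add: cuspB_def)

lemma cuspB_Tpow: "g \<in> carrier SL2Z \<Longrightarrow> cuspB (g ** Tpow m) = cuspB g"
  by (simp add: cuspB_def cusp_at_Tpow)

lemma J_0: "0 \<in> J"
  using subgroup.one_closed[OF subgroup_manin_image] proj.hom_one by (simp add: J_def)

lemma J_add: "x \<in> J \<Longrightarrow> y \<in> J \<Longrightarrow> x + y \<in> J"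
  using subgroup.m_closed[OF subgroup_manin_image, of "proj x" "proj y"] proj.hom_mult[of x y]
  by (simp add: J_def)

lemma J_minus: "x \<in> J \<Longrightarrow> - x \<in> J"
  using subgroup.m_inv_closed[OF subgroup_manin_image, of "proj x"] proj.hom_inv[of x]
  by (simp add: J_def)

lemma J_diff: "x \<in> J \<Longrightarrow> y \<in> J \<Longrightarrow> x - y \<in> J"
  using J_add[OF _ J_minus, of x y] by simp

lemma J_cmul: "x \<in> J \<Longrightarrow> frag_cmul m x \<in> J"
  by (rule frag_closure_minus_cmul[where P = "\<lambda>x. x \<in> J"]) (auto intro: J_0 J_diff)

lemma Ker_J: "x \<in> Ker \<Longrightarrow> x \<in> J"
  using subgroup.one_closed[OF subgroup_manin_image] by (simp add: J_def Ker_def)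

lemma liftA_J: "Poly_Mapping.keys u \<subseteq> X \<Longrightarrow> liftA u \<in> J"
  using liftA_Pre[of u] by (auto simp: J_def carrier_ZPSL simp flip: manin_map_eq)

lemma liftB_J_iff:
  assumes "Poly_Mapping.keys w \<subseteq> cusps \<Gamma>"
  shows "liftB w \<in> J \<longleftrightarrow> (\<exists>v\<in>Inv matU. \<exists>k. w = Phi v + frag_cmul k eps)"
  using liftB_in_manin_image[OF assms] liftB_Pre[OF assms] by (simp add: J_def)

lemma liftB_Phi_J:
  assumes "v \<in> Inv matU" shows "liftB (Phi v) \<in> J"
proof -
  have "\<exists>k. Phi v = Phi v + frag_cmul k eps" by (rule exI[of _ 0]) simp
  then show ?thesis using assms liftB_J_iff[OF keys_Phi[OF Inv_keys[OF assms]]] by blast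
qed

text \<open>The three cusps are the images under \<open>g\<close> of the vertices infinity, 1 and 0
  of a Farey triangle.\<close>

lemma cuspB_U_orbit:
  assumes g: "g \<in> carrier SL2Z"
  shows "cuspB g + cuspB (g ** matU) + cuspB (g ** matS) \<in> J"
proof -
  have "cuspB (g ** matU ** matU) = cuspB (g ** matS)" using g by (simp add: matUU_eq cuspB_Tpow)
  then show ?thesis
    using liftB_Phi_J[OF U_orbit_in_Inv[OF g]] g by (simp add: Phi_add Phi_of liftB_add cuspB_def)
qed

text \<open>Up to \<open>h\<close>, this compares two Farey triangles with the common side from 0 to
  -1; the opposite vertices are infinity and -1/2, and -1/2 is the image of infinity under
  L^-2.\<close>

lemma cuspB_Lpow_2:
  assumes h: "h \<in> carrier SL2Z" shows "cuspB (h ** Lpow (- 2)) - cuspB h \<in> J"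
proof -
  let ?g = "h ** matS"
  have "cuspB (?g ** matT ** matU) = cuspB (h ** Lpow (- 2))" by (simp add: matSTU_eq)
  moreover have "cuspB (?g ** matT) = cuspB ?g" using cuspB_Tpow[of ?g 1] h by (simp add: Tpow_1)
  moreover have "cuspB (?g ** matT ** matS) = cuspB (?g ** matU)" by (simp add: matTS_eq)
  ultimately have "cuspB ?g + cuspB (h ** Lpow (- 2)) + cuspB (?g ** matU) \<in> J"
    using cuspB_U_orbit[of "?g ** matT"] h by simp
  moreover have "cuspB ?g + cuspB (?g ** matU) + cuspB h \<in> J"
    using cuspB_U_orbit[of ?g] h by (simp add: matSS)
  ultimately have "(cuspB ?g + cuspB (h ** Lpow (- 2)) + cuspB (?g ** matU))
    - (cuspB ?g + cuspB (?g ** matU) + cuspB h) \<in> J" by (rule J_diff)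
  then show ?thesis by simp
qed

lemma cuspB_Lpow_even:
  assumes h: "h \<in> carrier SL2Z" shows "cuspB (h ** Lpow (- 2 * int n)) - cuspB h \<in> J"
proof (induction n)
  case 0 then show ?case by (simp add: Lpow_0 J_0)
next
  case (Suc n)
  have "h ** Lpow (- 2 * int n) ** Lpow (- 2) = h ** Lpow (- 2 * int (Suc n))"
    by (simp add: Lpow_add algebra_simps)
  then have "cuspB (h ** Lpow (- 2 * int (Suc n))) - cuspB (h ** Lpow (- 2 * int n)) \<in> J"
    using cuspB_Lpow_2[of "h ** Lpow (- 2 * int n)"] h by simp
  from J_add[OF this Suc] show ?case by simp
qed

text \<open>Writing N = 2n + 1 gives L = L^N L^(-2n), so L preserves the class. Powers of T on the
  right do not move the cusp, and U = L T^-1 and S = T^-1 U, so the class is constant along the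
  generators.\<close>

lemma cuspB_const:
  assumes N: "odd N" and L: "\<And>g. g \<in> carrier SL2Z \<Longrightarrow> cusp_at \<Gamma> (g ** Lpow (int N)) = cusp_at \<Gamma> g"
    and g: "g \<in> carrier SL2Z"
  shows "cuspB g - cuspB (mat 1) \<in> J"
proof -
  obtain n where n: "N = 2 * n + 1" using N oddE by blast
  have U: "cuspB (h ** matU) - cuspB h \<in> J" if h: "h \<in> carrier SL2Z" for h
  proof -
    have "h ** Lpow (int N) ** Lpow (- 2 * int n) = h ** Lpow 1" by (simp add: Lpow_add n)
    then have "cuspB (h ** Lpow 1) - cuspB (h ** Lpow (int N)) \<in> J"
      using cuspB_Lpow_even[of "h ** Lpow (int N)" n] h by simp
    moreover have "cuspB (h ** Lpow (int N)) = cuspB h" using L[OF h] by (simp add: cuspB_def)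
    moreover have "cuspB (h ** matU) = cuspB (h ** Lpow 1)" using h by (simp add: matU_eq_Lpow cuspB_Tpow)
    ultimately show ?thesis by simp
  qed
  from g show ?thesis
  proof (induction rule: SL2Z_induct)
    case one show ?case by (simp add: J_0)
  next
    case (S g)
    have "cuspB (g ** matS) - cuspB g \<in> J"
      using U[of "g ** Tpow (- 1)"] S(1) by (simp add: matS_eq cuspB_Tpow)
    from J_add[OF this S(2)] show ?case by simp
  next
    case (U g)
    from J_add[OF \<open>g \<in> carrier SL2Z \<Longrightarrow> cuspB (g ** matU) - cuspB g \<in> J\<close>[OF U(1)] U(2)] show ?case by simp
  qed
qed

lemma coset_eq_iff_J:
  assumes "x \<in> Pre" "y \<in> Pre"
  shows "manin_image #>\<^bsub>MMS_Gamma \<Gamma>\<^esub> proj x = manin_image #>\<^bsub>MMS_Gamma \<Gamma>\<^esub> proj y \<longleftrightarrow> x - y \<in> J"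
proof -
  let ?q = "\<lambda>y. manin_image #>\<^bsub>MMS_Gamma \<Gamma>\<^esub> proj y"
  have q: "group_hom presymbols (MMS_Gamma \<Gamma> Mod manin_image) ?q"
    by (rule group_hom_comp[OF proj.group_hom_axioms MG.coset_hom(1)[OF subgroup_manin_image]])
  have "?q x = ?q y \<longleftrightarrow> ?q (x - y) = \<one>\<^bsub>MMS_Gamma \<Gamma> Mod manin_image\<^esub>"
    using group_hom.hom_eq_iff[OF q assms] assms by simp
  also have "\<dots> \<longleftrightarrow> proj (x - y) \<in> manin_image"
    using assms by (intro MG.coset_hom(3)[OF subgroup_manin_image]) simp
  finally show ?thesis using assms by (simp add: J_def)
qed

lemma card_rcosets_manin_image:
  assumes const: "\<And>g. g \<in> carrier SL2Z \<Longrightarrow> cuspB g - cuspB (mat 1) \<in> J"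
  shows "card (rcosets\<^bsub>MMS_Gamma \<Gamma>\<^esub> manin_image) = (if cuspB (mat 1) \<in> J then 1 else 3)"
proof -
  let ?b = "cuspB (mat 1)" and ?q = "\<lambda>y. manin_image #>\<^bsub>MMS_Gamma \<Gamma>\<^esub> proj y"
  have b: "?b \<in> Pre" by simp
  have 3: "frag_cmul 3 ?b \<in> J"
  proof -
    have e: "frag_cmul 3 x = x + x + x" for x :: presymbol
      using frag_cmul_distrib[of 1 2 x] frag_cmul_distrib[of 1 1 x] by simp
    \<comment> \<open>All three vertices of the triangle at the identity have the class of
      \<open>?b\<close>.\<close>
    have "(?b + cuspB matU + cuspB matS) - ((cuspB matU - ?b) + (cuspB matS - ?b)) \<in> J"
      by (rule J_diff[OF _ J_add[OF const const]]) (use cuspB_U_orbit[of "mat 1"] in simp_all)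
    then show ?thesis by (simp add: e algebra_simps)
  qed
  have liftB: "\<exists>k. liftB w - frag_cmul k ?b \<in> J" if "Poly_Mapping.keys w \<subseteq> cusps \<Gamma>" for w
    using that
  proof (induction rule: free_Abelian_group_induct[consumes 1])
    case 1 show ?case by (rule exI[of _ 0]) (simp add: J_0)
  next
    case (2 x y)
    then obtain k l where "liftB x - frag_cmul k ?b \<in> J" "liftB y - frag_cmul l ?b \<in> J" by blast
    from J_diff[OF this] show ?case
      by (intro exI[of _ "k - l"]) (simp add: liftB_diff frag_cmul_diff_distrib algebra_simps)
  next
    case (3 c)
    then obtain g where "g \<in> carrier SL2Z" "c = cusp_at \<Gamma> g" unfolding cusps_eq by blast
    then show ?case using const[of g] by (intro exI[of _ 1]) (simp add: cuspB_def)
  qed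
  have all: "\<exists>k\<in>{0,1,2}. ?q y = ?q (frag_cmul k ?b)" if y: "y \<in> Pre" for y
  proof -
    obtain u w where uw: "Poly_Mapping.keys u \<subseteq> X" "Poly_Mapping.keys w \<subseteq> cusps \<Gamma>"
      "y - (liftA u + liftB w) \<in> Ker" using Pre_generated[OF y] by (elim exE conjE) (rule that)
    obtain k where k: "liftB w - frag_cmul k ?b \<in> J" using liftB[OF uw(2)] by blast
    have m: "frag_cmul k ?b - frag_cmul (k mod 3) ?b = frag_cmul (k div 3) (frag_cmul 3 ?b)"
      by (simp add: minus_mod_eq_div_mult flip: frag_cmul_diff_distrib)
    have "y - frag_cmul (k mod 3) ?b = (y - (liftA u + liftB w)) + liftA u
        + (liftB w - frag_cmul k ?b) + (frag_cmul k ?b - frag_cmul (k mod 3) ?b)"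
      by (simp del: minus_frag_cmul)
    also have "\<dots> \<in> J"
      unfolding m by (rule J_add[OF J_add[OF J_add[OF Ker_J[OF uw(3)] liftA_J[OF uw(1)]] k] J_cmul[OF 3]])
    finally have "?q y = ?q (frag_cmul (k mod 3) ?b)" using y by (subst coset_eq_iff_J) simp_all
    moreover have "k mod 3 \<in> {0,1,2}" by auto
    ultimately show ?thesis by (intro bexI)
  qed
  have "rcosets\<^bsub>MMS_Gamma \<Gamma>\<^esub> manin_image = ?q ` Pre"
    by (simp add: RCOSETS_def carrier_MMS_Gamma UNION_singleton_eq_range image_image)
  also have "\<dots> = (\<lambda>k. ?q (frag_cmul k ?b)) ` {0,1,2}"
  proof
    show "?q ` Pre \<subseteq> (\<lambda>k. ?q (frag_cmul k ?b)) ` {0,1,2}"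
    proof (rule image_subsetI)
      fix y assume "y \<in> Pre"
      from all[OF this] obtain k where "k \<in> {0,1,2}" "?q y = ?q (frag_cmul k ?b)" by (elim bexE)
      then show "?q y \<in> (\<lambda>k. ?q (frag_cmul k ?b)) ` {0,1,2}" by (intro image_eqI)
    qed
    show "(\<lambda>k. ?q (frag_cmul k ?b)) ` {0,1,2} \<subseteq> ?q ` Pre" using b by (intro image_subsetI imageI) simp
  qed
  finally have rc: "rcosets\<^bsub>MMS_Gamma \<Gamma>\<^esub> manin_image = (\<lambda>k. ?q (frag_cmul k ?b)) ` {0,1,2}" .
  have q: "?q (frag_cmul k ?b) = ?q (frag_cmul l ?b) \<longleftrightarrow> frag_cmul (k - l) ?b \<in> J" for k l
    using coset_eq_iff_J[of "frag_cmul k ?b" "frag_cmul l ?b"] by (simp add: frag_cmul_diff_distrib)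
  show ?thesis
  proof (cases "?b \<in> J")
    case True
    have "?q (frag_cmul k ?b) = ?q (frag_cmul 0 ?b)" for k unfolding q by (rule J_cmul[OF True])
    note this[of 1] this[of 2]
    then have "rcosets\<^bsub>MMS_Gamma \<Gamma>\<^esub> manin_image = {?q (frag_cmul 0 ?b)}"
      unfolding rc by (simp only: image_insert image_empty insert_absorb2)
    then show ?thesis using True by simp
  next
    case False
    have 2: "frag_cmul 2 ?b \<notin> J" using J_diff[OF 3, of "frag_cmul 2 ?b"] False
      by (auto simp flip: frag_cmul_diff_distrib)
    have neg: "frag_cmul (- m) ?b \<in> J \<longleftrightarrow> frag_cmul m ?b \<in> J" for m
      using J_minus[of "frag_cmul m ?b"] J_minus[of "frag_cmul (- m) ?b"] by auto
    have "inj_on (\<lambda>k. ?q (frag_cmul k ?b)) {0,1,2::int}"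
    proof (rule inj_onI)
      fix k l :: int
      assume kl: "k \<in> {0,1,2}" "l \<in> {0,1,2}" "?q (frag_cmul k ?b) = ?q (frag_cmul l ?b)"
      from kl(3) have J: "frag_cmul (k - l) ?b \<in> J" by (simp only: q)
      show "k = l" using kl(1,2)
        by (elim insertE emptyE) (use J False 2 neg[of 1] neg[of 2] in simp_all)
    qed
    from card_image[OF this] show ?thesis unfolding rc using False by simp
  qed
qed

definition deg :: "(p1q set \<Rightarrow>\<^sub>0 int) \<Rightarrow> int" where
  "deg w = (\<Sum>c\<in>cusps \<Gamma>. Poly_Mapping.lookup w c)"

lemma deg_add: "deg (x + y) = deg x + deg y"
  and deg_diff: "deg (x - y) = deg x - deg y"
  and deg_cmul: "deg (frag_cmul k x) = k * deg x"
  by (simp_all add: deg_def lookup_add lookup_minus sum.distrib sum_subtractf sum_distrib_left)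

lemma deg_of: "c \<in> cusps \<Gamma> \<Longrightarrow> deg (frag_of c) = 1"
  using finite_cusps by (simp add: deg_def)

lemma deg_Phi:
  "Poly_Mapping.keys v \<subseteq> X \<Longrightarrow> deg (Phi v) = (\<Sum>C\<in>X. Poly_Mapping.lookup v C)"
proof (induction rule: free_Abelian_group_induct[consumes 1])
  case 1 show ?case by (simp add: deg_def)
next
  case (2 x y) then show ?case by (simp add: Phi_diff deg_diff lookup_minus sum_subtractf)
next
  case (3 C)
  then have "cusp_of C \<in> cusps \<Gamma>" unfolding cusps_eq' by (rule imageI)
  moreover have "(\<Sum>D\<in>X. Poly_Mapping.lookup (frag_of C) D) = 1" using 3 finite_X by (simp only: lookup_frag_of) simp
  ultimately show ?case by (simp add: Phi_def deg_of)
qed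

lemma cuspB_J_iff_fixed:
  assumes const: "\<And>g. g \<in> carrier SL2Z \<Longrightarrow> cuspB g - cuspB (mat 1) \<in> J"
    and width: "1 \<in> width_set (mat 1)"
  shows "cuspB (mat 1) \<in> J \<longleftrightarrow> (\<exists>g\<in>carrier SL2Z. Gcoset \<Gamma> (g ** matU) = Gcoset \<Gamma> g)"
proof
  assume "\<exists>g\<in>carrier SL2Z. Gcoset \<Gamma> (g ** matU) = Gcoset \<Gamma> g"
  then obtain g where g: "g \<in> carrier SL2Z" "Gcoset \<Gamma> (g ** matU) = Gcoset \<Gamma> g" by blast
  \<comment> \<open>A fixed coset alone is U-invariant, so a single cusp, rather than a sum of
    three, dies in the cokernel.\<close>
  then have "frag_of (Gcoset \<Gamma> g) \<in> Inv matU" by (simp add: Inv_def rmul_of)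
  from liftB_Phi_J[OF this] have "cuspB g \<in> J" using g(1) by (simp add: Phi_of cuspB_def)
  from J_diff[OF this const[OF g(1)]] show "cuspB (mat 1) \<in> J" by simp
next
  assume J: "cuspB (mat 1) \<in> J"
  show "\<exists>g\<in>carrier SL2Z. Gcoset \<Gamma> (g ** matU) = Gcoset \<Gamma> g"
  proof (rule ccontr)
    assume nofix: "\<not> ?thesis"
    let ?c = "cusp_at \<Gamma> (mat 1)"
    have c: "?c \<in> cusps \<Gamma>" by (simp add: cusp_at_in)
    have sum3: "3 dvd (\<Sum>C\<in>X. Poly_Mapping.lookup v C)" if v: "v \<in> Inv matU" for v
    proof (rule dvd_sum_free_order_3[OF finite_X, of "\<lambda>C. C #>\<^bsub>PSL2Z\<^esub> psl matU"])
      fix C assume "C \<in> X"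
      then obtain g where g: "g \<in> carrier SL2Z" "C = Gcoset \<Gamma> g" by blast
      have C: "C #>\<^bsub>PSL2Z\<^esub> psl matU = Gcoset \<Gamma> (g ** matU)" using g by (simp add: r_coset_psl)
      show "C #>\<^bsub>PSL2Z\<^esub> psl matU \<in> X" unfolding C using g(1) by simp
      show "C #>\<^bsub>PSL2Z\<^esub> psl matU #>\<^bsub>PSL2Z\<^esub> psl matU #>\<^bsub>PSL2Z\<^esub> psl matU = C"
        using g by (simp add: r_coset_psl matUUU)
      show "C #>\<^bsub>PSL2Z\<^esub> psl matU \<noteq> C" unfolding C using nofix g by blast
      show "Poly_Mapping.lookup v (C #>\<^bsub>PSL2Z\<^esub> psl matU) = Poly_Mapping.lookup v C"
        unfolding C using v g by (simp add: Inv_iff)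
    qed
    have "width_gcd \<Gamma> dvd cusp_width \<Gamma> ?c" by (rule width_gcd_dvd[OF c])
    moreover have "cusp_width \<Gamma> ?c = 1" using cusp_width_props(2)[of "mat 1" 1] width by simp
    ultimately have "width_gcd \<Gamma> = 1" by simp
    then have "deg eps = deg (Phi ones)" by (simp add: Phi_ones)
    then have eps: "3 dvd deg eps" using sum3[OF ones_Inv[OF mat_in_SL2Z(3)]] by (simp add: deg_Phi keys_ones)
    have "liftB (frag_of ?c) \<in> J" using J by (simp add: cuspB_def)
    then obtain v k where v: "v \<in> Inv matU" "frag_of ?c = Phi v + frag_cmul k eps"
      using liftB_J_iff[of "frag_of ?c"] c by auto
    have "1 = deg (Phi v) + k * deg eps"
      using arg_cong[OF v(2), of deg] by (simp only: deg_of[OF c] deg_add deg_cmul)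
    moreover have "3 dvd deg (Phi v)" using sum3[OF v(1)] deg_Phi[OF Inv_keys[OF v(1)]] by simp
    ultimately have "(3::int) dvd 1" using eps by (metis dvd_add dvd_mult)
    then show False by simp
  qed
qed

lemma manin_image_index:
  assumes N: "odd N" and L: "\<And>g. g \<in> carrier SL2Z \<Longrightarrow> cusp_at \<Gamma> (g ** Lpow (int N)) = cusp_at \<Gamma> g"
    and width: "1 \<in> width_set (mat 1)"
  shows "card (rcosets\<^bsub>MMS_Gamma \<Gamma>\<^esub> manin_image)
    = (if \<exists>g\<in>carrier SL2Z. Gcoset \<Gamma> (g ** matU) = Gcoset \<Gamma> g then 1 else 3)"
  using card_rcosets_manin_image[OF cuspB_const[OF N L]] cuspB_J_iff_fixed[OF cuspB_const[OF N L] width]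
  by simp

end


section \<open>The form c^2 + c d + d^2 modulo powers of primes\<close>

lemma fermat_theorem_int:
  fixes a :: int
  assumes p: "prime p" and a: "\<not> int p dvd a"
  shows "[a ^ (p - 1) = 1] (mod int p)"
proof -
  let ?b = "nat (a mod int p)"
  have pos: "int p > 0" using prime_gt_0_nat[OF p] by simp
  have b: "int ?b = a mod int p" using pos by simp
  have "\<not> p dvd ?b"
  proof
    assume "p dvd ?b"
    then have "int p dvd int ?b" by (simp only: int_dvd_int_iff)
    then have "int p dvd a mod int p" by (simp only: b)
    then show False using a by (simp add: dvd_mod_iff)
  qed
  from fermat_theorem[OF p this] have "[int (?b ^ (p - 1)) = int 1] (mod int p)"
    by (simp only: cong_int_iff)
  then have "[(a mod int p) ^ (p - 1) = 1] (mod int p)" by (simp only: of_nat_power b of_nat_1)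
  then show ?thesis by (simp add: cong_def power_mod)
qed

text \<open>The form divides c^3 - d^3. If p were 2 modulo 3, cubing would be injective on units
  modulo p; then c = d modulo p, the form would be 3 c^2, and p would divide 3.\<close>

lemma prime_dvd_norm_form_imp_cong_1:
  fixes c d :: int
  assumes p: "prime p" "p \<ge> 5" and dvd: "int p dvd c * c + c * d + d * d" and cop: "coprime c d"
  shows "[p = 1] (mod 3)"
proof -
  have pi: "prime (int p)" using p by simp
  have nd: "\<not> int p dvd d"
  proof
    assume d: "int p dvd d"
    have "c * c = (c * c + c * d + d * d) - (c + d) * d" by (simp add: algebra_simps)
    then have "int p dvd c * c" using dvd d by (metis dvd_diff dvd_mult)
    then have "int p dvd c" using pi prime_dvd_mult_iff by blast
    with d have "int p dvd 1" using cop by (metis coprime_def is_unit_gcd gcd_greatest)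
    then show False using pi not_prime_unit by blast
  qed
  have nc: "\<not> int p dvd c"
  proof
    assume c: "int p dvd c"
    have "d * d = (c * c + c * d + d * d) - c * (c + d)" by (simp add: algebra_simps)
    then have "int p dvd d * d" using dvd c by (metis dvd_diff dvd_mult2)
    then show False using pi nd prime_dvd_mult_iff by blast
  qed
  have "p mod 3 \<noteq> 0"
  proof
    assume "p mod 3 = 0"
    then have "3 dvd p" by presburger
    moreover have "\<forall>m. m dvd p \<longrightarrow> m = 1 \<or> m = p" using p(1) by (simp add: prime_nat_iff)
    ultimately show False using p(2) by fastforce
  qed
  moreover have "p mod 3 \<noteq> 2"
  proof
    assume "p mod 3 = 2"
    then obtain k where k: "p = 3 * k + 2" by (metis mod_mult_div_eq add.commute)
    \<comment> \<open>Now c^(p-1) is c times a power of c^3, so Fermat determines c from its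
      cube.\<close>
    then have p1: "p - 1 = Suc (3 * k)" by simp
    have "c ^ 3 - d ^ 3 = (c - d) * (c * c + c * d + d * d)"
      by (simp add: power3_eq_cube algebra_simps)
    then have "[c ^ 3 = d ^ 3] (mod int p)" using dvd by (simp add: cong_iff_dvd_diff)
    then have 1: "[c ^ (3 * k) = d ^ (3 * k)] (mod int p)"
      using cong_pow by (fastforce simp: power_mult)
    have "[c ^ (p - 1) = d ^ (p - 1)] (mod int p)"
      using fermat_theorem_int[OF p(1) nc] fermat_theorem_int[OF p(1) nd] cong_trans cong_sym by blast
    then have "[c * c ^ (3 * k) = d * d ^ (3 * k)] (mod int p)" by (simp only: p1 power_Suc)
    also have "[d * d ^ (3 * k) = d * c ^ (3 * k)] (mod int p)"
      using 1 by (intro cong_mult cong_refl) (rule cong_sym)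
    finally have "[c * c ^ (3 * k) = d * c ^ (3 * k)] (mod int p)" .
    moreover have "coprime c (int p)" using prime_imp_coprime[OF pi nc] by (simp only: coprime_commute)
    then have "coprime (c ^ (3 * k)) (int p)" by simp
    ultimately have "[c = d] (mod int p)" by (simp add: cong_mult_rcancel)
    then have cd: "int p dvd c - d" by (simp add: cong_iff_dvd_diff)
    have "3 * (c * c) = (c * c + c * d + d * d) + (c - d) * (2 * c + d)" by (simp add: algebra_simps)
    then have "int p dvd 3 * (c * c)" using dvd cd by (metis dvd_add dvd_mult2)
    then have "int p dvd 3" using pi nc prime_dvd_mult_iff by blast
    then have "int p \<le> 3" by (rule zdvd_imp_le) simp
    then show False using p(2) by simp
  qed
  ultimately have "p mod 3 = 1" by presburger
  then show ?thesis by (simp add: cong_def)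
qed

text \<open>With g a primitive root modulo p and m = (p-1)/3, the cube of e = g^(m p^(n-1)) has
  exponent \<open>totient (p ^ n)\<close>, so it is 1 modulo p^n. The power p^(n-1) leaves the
  residue modulo p unchanged, and g^m is not 1 there, so e - 1 can be cancelled from e^3 -
  1.\<close>

lemma exists_cube_root_of_unity_mod_prime_power:
  assumes p: "prime p" and p3: "[p = 1] (mod 3)" and n: "n \<ge> 1"
  shows "\<exists>d::int. int (p ^ n) dvd d * d + d + 1"
proof -
  have p2: "p \<ge> 2" using prime_ge_2_nat[OF p] .
  have "p mod 3 = 1" using p3 by (simp add: cong_def)
  then obtain m where m: "p = 3 * m + 1" by (metis mod_mult_div_eq add.commute)
  then have m': "p - 1 = m * 3" "m > 0" "m < p - 1" using p2 by auto
  obtain g where g: "residue_primroot p g" using prime_primitive_root_exists[OF _ p] p2 by auto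
  then have cop: "coprime g p" and ord: "ord p g = p - 1"
    using totient_prime[OF p] by (auto simp: residue_primroot_def coprime_commute)
  define y where "y = g ^ m"
  have y1: "\<not> [y = 1] (mod p)"
    unfolding y_def ord_divides ord using m' by (auto dest: dvd_imp_le)
  have yp: "[y ^ (p ^ j) = y] (mod p)" for j
  proof (induction j)
    case (Suc j)
    have "coprime y p" using cop by (simp add: y_def)
    then have "\<not> p dvd y" using coprime_common_divisor[of y p p] p2 by auto
    then have "[y ^ (p - 1) = 1] (mod p)" by (rule fermat_theorem[OF p])
    then have "[y ^ (p - 1) * y = 1 * y] (mod p)" by (intro cong_mult cong_refl)
    then have "[y ^ p = y] (mod p)" using p2 by (simp flip: power_Suc2)
    with cong_pow[OF Suc, of p] have "[(y ^ (p ^ j)) ^ p = y] (mod p)" using cong_trans by blast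
    then show ?case by (simp add: power_mult[symmetric] mult.commute)
  qed simp
  define e where "e = y ^ (p ^ (n - 1))"
  have e1: "\<not> [e = 1] (mod p)" using yp[of "n - 1"] y1 unfolding e_def using cong_trans cong_sym by blast
  have "e ^ 3 = g ^ totient (p ^ n)"
  proof -
    have "totient (p ^ n) = m * p ^ (n - 1) * 3"
      using totient_prime_power[OF p, of n] n m' by (simp add: mult_ac)
    then show ?thesis by (simp add: e_def y_def power_mult)
  qed
  then have "[e ^ 3 = 1] (mod p ^ n)" using euler_theorem[of g "p ^ n"] cop by simp
  then have "[int (e ^ 3) = int 1] (mod int (p ^ n))" by (simp only: cong_int_iff)
  then have "int (p ^ n) dvd int e ^ 3 - 1" by (simp add: cong_iff_dvd_diff)
  also have "int e ^ 3 - 1 = (int e - 1) * (int e * int e + int e + 1)"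
    by (simp add: power3_eq_cube algebra_simps)
  finally have dvd: "int (p ^ n) dvd (int e - 1) * (int e * int e + int e + 1)" .
  have "\<not> int p dvd int e - 1"
    using e1 cong_int_iff[of e 1 p] by (simp add: cong_iff_dvd_diff)
  then have "coprime (int (p ^ n)) (int e - 1)"
    using p prime_imp_coprime[of "int p" "int e - 1"] by simp
  then show ?thesis using dvd coprime_dvd_mult_right_iff by blast
qed

section \<open>Congruence subgroups and the cosets fixed by U\<close>

lemma Gamma1_subset_Gamma0: "Gamma1 N \<subseteq> Gamma0 N"
  by (auto simp: Gamma0_def Gamma1_def)

lemma matT_in_Gamma1: "matT \<in> Gamma1 N"
  by (simp add: Gamma1_def matT_def carrier_SL2Z_iff)

text \<open>The witness is \<open>g L\<^sup>N g\<^sup>-\<^sup>1 = 1 + N g (L - 1) g\<^sup>-\<^sup>1\<close>.\<close>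

lemma conj_Lpow_in_Gamma1:
  assumes g: "g \<in> carrier SL2Z"
  shows "\<exists>\<gamma>\<in>Gamma1 N. \<gamma> ** g = g ** Lpow (int N)"
proof
  let ?N = "int N" and ?b = "g$1$2" and ?d = "g$2$2"
  let ?\<gamma> = "mat2 (1 + ?N * ?b * ?d) (- ?N * ?b * ?b) (?N * ?d * ?d) (1 - ?N * ?b * ?d)"
  show "?\<gamma> \<in> Gamma1 N"
    by (simp add: Gamma1_def carrier_SL2Z_iff cong_iff_dvd_diff algebra_simps)
  have det: "g$1$1 * ?d = 1 + ?b * g$2$1" using g by (simp add: carrier_SL2Z_iff)
  have "(1 + ?N * ?b * ?d) * g$1$1 + (- ?N * ?b * ?b) * g$2$1 = g$1$1 + ?N * ?b * (g$1$1 * ?d - ?b * g$2$1)"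
    by (simp add: algebra_simps)
  moreover have "(?N * ?d * ?d) * g$1$1 + (1 - ?N * ?b * ?d) * g$2$1 = g$2$1 + ?N * ?d * (g$1$1 * ?d - ?b * g$2$1)"
    by (simp add: algebra_simps)
  ultimately show "?\<gamma> ** g = g ** Lpow ?N"
    using det by (simp add: mat2_eq_iff mat2_mult_nth[of "mat2 _ _ _ _"] algebra_simps)
qed

context finite_index
begin

lemma index_congruence:
  assumes N: "odd N" and sub: "Gamma1 N \<subseteq> \<Gamma>"
  shows "card (rcosets\<^bsub>MMS_Gamma \<Gamma>\<^esub> manin_image)
    = (if \<exists>g\<in>carrier SL2Z. Gcoset \<Gamma> (g ** matU) = Gcoset \<Gamma> g then 1 else 3)"
proof (rule manin_image_index[OF N])
  show "cusp_at \<Gamma> (g ** Lpow (int N)) = cusp_at \<Gamma> g" if g: "g \<in> carrier SL2Z" for g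
  proof -
    obtain \<gamma> where \<gamma>: "\<gamma> \<in> Gamma1 N" "\<gamma> ** g = g ** Lpow (int N)" using conj_Lpow_in_Gamma1[OF g] by blast
    have "\<gamma> \<in> \<Gamma>" using \<gamma>(1) sub by (rule rev_subsetD)
    from cusp_at_invariant[OF \<Gamma> this g] show ?thesis by (simp only: mult_SL2Z \<gamma>(2))
  qed
  have "matT \<in> \<Gamma>" using matT_in_Gamma1 sub by blast
  from Gcoset_mult_left[OF this, of "mat 1"] show "1 \<in> width_set (mat 1)"
    by (simp add: width_set_def Tpow_1)
qed

text \<open>The element is g U g^-1 up to sign, hence the absolute values. Its trace will rule out
  \<open>Gamma1\<close>, and its lower left entry gives the condition on p for
  \<open>Gamma0\<close>.\<close>

lemma U_fixed_coset:
  assumes g: "g \<in> carrier SL2Z" and fixed: "Gcoset \<Gamma> (g ** matU) = Gcoset \<Gamma> g"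
  shows "\<exists>\<gamma>\<in>\<Gamma>. \<bar>\<gamma>$1$1 + \<gamma>$2$2\<bar> = 1 \<and>
    \<bar>\<gamma>$2$1\<bar> = \<bar>g$2$1 * g$2$1 + g$2$1 * g$2$2 + g$2$2 * g$2$2\<bar>"
proof -
  obtain \<gamma> where \<gamma>: "\<gamma> \<in> \<Gamma>" "g ** matU = \<gamma> ** g \<or> g ** matU = - (\<gamma> ** g)"
    using fixed Gcoset_eq[OF g, of "g ** matU"] g by auto
  have det: "g$1$1 * g$2$2 - g$1$2 * g$2$1 = 1" using g by (simp add: carrier_SL2Z_iff)
  have key: "\<delta>$1$1 + \<delta>$2$2 = 1 \<and> \<delta>$2$1 = g$2$1 * g$2$1 + g$2$1 * g$2$2 + g$2$2 * g$2$2"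
    if "g ** matU = \<delta> ** g" for \<delta>
  proof -
    have e: "g$1$1 + g$1$2 = \<delta>$1$1 * g$1$1 + \<delta>$1$2 * g$2$1" "- g$1$1 = \<delta>$1$1 * g$1$2 + \<delta>$1$2 * g$2$2"
      "g$2$1 + g$2$2 = \<delta>$2$1 * g$1$1 + \<delta>$2$2 * g$2$1" "- g$2$1 = \<delta>$2$1 * g$1$2 + \<delta>$2$2 * g$2$2"
      using that by (simp_all add: mat2_eq_iff mat2_mult_nth[of \<delta>])
    \<comment> \<open>Cramer's rule: each entry of (g U) g^-1 is isolated by combining two of the
      equations \<open>e\<close>.\<close>
    have "\<delta>$2$1 * (g$1$1 * g$2$2 - g$1$2 * g$2$1) = (g$2$1 + g$2$2) * g$2$2 - (- g$2$1) * g$2$1"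
      unfolding e by (simp add: algebra_simps)
    moreover have "\<delta>$1$1 * (g$1$1 * g$2$2 - g$1$2 * g$2$1) = (g$1$1 + g$1$2) * g$2$2 - (- g$1$1) * g$2$1"
      unfolding e by (simp add: algebra_simps)
    moreover have "\<delta>$2$2 * (g$1$1 * g$2$2 - g$1$2 * g$2$1) = g$1$1 * (- g$2$1) - g$1$2 * (g$2$1 + g$2$2)"
      unfolding e by (simp add: algebra_simps)
    ultimately show ?thesis using det by (simp add: algebra_simps)
  qed
  from \<gamma>(2) have "g ** matU = \<gamma> ** g \<or> g ** matU = (- \<gamma>) ** g" by simp
  then show ?thesis using key[of \<gamma>] key[of "- \<gamma>"] \<gamma>(1) by (intro bexI[of _ \<gamma>]) auto
qed

end

theorem theorem2p14:
  fixes \<Gamma> :: "imat2 set"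
  assumes "subgroup \<Gamma> SL2Z"
    and "finite (rcosets\<^bsub>SL2Z\<^esub> \<Gamma>)"
  shows
    "(\<exists>h \<in> iso (cokernel (ZPSL_inv \<Gamma> matU) (Zcusps0 \<Gamma>) (cusp_map \<Gamma>))
              (cokernel (ZPSL \<Gamma>) (MMS_Gamma \<Gamma>) (manin_map \<Gamma>)).
        \<forall>g \<in> carrier SL2Z.
          h (coker_proj (ZPSL_inv \<Gamma> matU) (Zcusps0 \<Gamma>) (cusp_map \<Gamma>) (cusp_class \<Gamma> (cusp_at \<Gamma> g)))
          = coker_proj (ZPSL \<Gamma>) (MMS_Gamma \<Gamma>) (manin_map \<Gamma>)
              (mms_Gamma \<Gamma> g (g \<otimes>\<^bsub>SL2Z\<^esub> matT)))
   \<and> (\<forall>(p::nat) (n::nat). prime p \<and> p \<ge> 5 \<and> n \<ge> 1 \<and> (\<Gamma> = Gamma1 (p ^ n) \<or> \<Gamma> = Gamma0 (p ^ n)) \<longrightarrow>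
        card (rcosets\<^bsub>MMS_Gamma \<Gamma>\<^esub> (manin_map \<Gamma> ` carrier (ZPSL \<Gamma>))) dvd 3
      \<and> (card (rcosets\<^bsub>MMS_Gamma \<Gamma>\<^esub> (manin_map \<Gamma> ` carrier (ZPSL \<Gamma>))) = 1
          \<longleftrightarrow> [p = 1] (mod 3) \<and> \<Gamma> = Gamma0 (p ^ n)))
   \<and> kernel (ZPSL \<Gamma>) (MMS_Gamma \<Gamma>) (manin_map \<Gamma>)
      = generate (ZPSL \<Gamma>)
          (carrier (ZPSL_inv \<Gamma> matS) \<union> kernel (ZPSL_inv \<Gamma> matU) (Zcusps0 \<Gamma>) (cusp_map \<Gamma>))"
proof -
  interpret finite_index \<Gamma> by (rule finite_index.intro) (fact assms)+
  have index: "card (rcosets\<^bsub>MMS_Gamma \<Gamma>\<^esub> manin_image) dvd 3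
      \<and> (card (rcosets\<^bsub>MMS_Gamma \<Gamma>\<^esub> manin_image) = 1 \<longleftrightarrow> [p = 1] (mod 3) \<and> \<Gamma> = Gamma0 (p ^ n))"
    if p: "prime p" "p \<ge> 5" and n: "n \<ge> 1" and \<Gamma>: "\<Gamma> = Gamma1 (p ^ n) \<or> \<Gamma> = Gamma0 (p ^ n)" for p n :: nat
  proof -
    let ?fix = "\<exists>g\<in>carrier SL2Z. Gcoset \<Gamma> (g ** matU) = Gcoset \<Gamma> g"
    have "odd (p ^ n)" using p primes_dvd_imp_eq[of 2 p] by auto
    moreover have "Gamma1 (p ^ n) \<subseteq> \<Gamma>" using \<Gamma> Gamma1_subset_Gamma0 by blast
    ultimately have card: "card (rcosets\<^bsub>MMS_Gamma \<Gamma>\<^esub> manin_image) = (if ?fix then 1 else 3)"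
      by (rule index_congruence)
    have pn: "int p dvd int (p ^ n)" using n by (simp add: dvd_power)
    have "?fix \<longleftrightarrow> [p = 1] (mod 3) \<and> \<Gamma> = Gamma0 (p ^ n)"
    proof
      assume ?fix
      then obtain g where g: "g \<in> carrier SL2Z" "Gcoset \<Gamma> (g ** matU) = Gcoset \<Gamma> g" by blast
      obtain \<gamma> where \<gamma>: "\<gamma> \<in> \<Gamma>" "\<bar>\<gamma>$1$1 + \<gamma>$2$2\<bar> = 1"
        "\<bar>\<gamma>$2$1\<bar> = \<bar>g$2$1 * g$2$1 + g$2$1 * g$2$2 + g$2$2 * g$2$2\<bar>" using U_fixed_coset[OF g] by blast
      have "\<Gamma> \<noteq> Gamma1 (p ^ n)"
      proof
        assume "\<Gamma> = Gamma1 (p ^ n)"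
        with \<gamma>(1) have "\<gamma> \<in> Gamma1 (p ^ n)" by simp
        \<comment> \<open>The trace is 2 modulo p^n in \<open>Gamma1\<close>, but here it is 1 or
          -1. The difference is -1 or -3, and p is at least 5.\<close>
        then have "int (p ^ n) dvd \<gamma>$1$1 - 1" "int (p ^ n) dvd \<gamma>$2$2 - 1"
          by (simp_all add: Gamma1_def cong_iff_dvd_diff)
        then have "int (p ^ n) dvd (\<gamma>$1$1 - 1) + (\<gamma>$2$2 - 1)" by (rule dvd_add)
        from dvd_trans[OF pn this] have d: "int p dvd (\<gamma>$1$1 + \<gamma>$2$2) - 2"
          by (simp add: algebra_simps)
        have "\<gamma>$1$1 + \<gamma>$2$2 = 1 \<or> \<gamma>$1$1 + \<gamma>$2$2 = -1" using \<gamma>(2) by linarith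
        then have "int p dvd 1 \<or> int p dvd 3" using d by auto
        then show False using p(2) by (auto dest: zdvd_imp_le)
      qed
      then have \<Gamma>0: "\<Gamma> = Gamma0 (p ^ n)" using \<Gamma> by blast
      with \<gamma>(1) have "\<gamma> \<in> Gamma0 (p ^ n)" by simp
      then have "int (p ^ n) dvd \<gamma>$2$1" by (simp add: Gamma0_def cong_iff_dvd_diff)
      from dvd_trans[OF pn this] have "int p dvd \<bar>\<gamma>$2$1\<bar>" by simp
      then have dvd: "int p dvd g$2$1 * g$2$1 + g$2$1 * g$2$2 + g$2$2 * g$2$2" unfolding \<gamma>(3) by simp
      have "coprime (g$2$1) (g$2$2)"
      proof (rule coprimeI)
        fix q assume "q dvd g$2$1" "q dvd g$2$2"
        then have "q dvd g$1$1 * g$2$2 - g$1$2 * g$2$1" by (intro dvd_diff dvd_mult)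
        then show "q dvd 1" using g(1) by (simp add: carrier_SL2Z_iff)
      qed
      from prime_dvd_norm_form_imp_cong_1[OF p dvd this] \<Gamma>0 show "[p = 1] (mod 3) \<and> \<Gamma> = Gamma0 (p ^ n)" by blast
    next
      assume "[p = 1] (mod 3) \<and> \<Gamma> = Gamma0 (p ^ n)"
      then have \<Gamma>0: "\<Gamma> = Gamma0 (p ^ n)" and "[p = 1] (mod 3)" by auto
      then obtain d :: int where d: "int (p ^ n) dvd d * d + d + 1"
        using exists_cube_root_of_unity_mod_prime_power[OF p(1) _ n] by blast
      \<comment> \<open>The bottom row (1, d) turns c^2 + c d + d^2 into d^2 + d + 1, which is
        divisible by the level; \<open>?\<gamma>\<close> is \<open>?g\<close> U
        \<open>?g\<close>^-1.\<close>
      let ?g = "mat2 0 (- 1) 1 d" and ?\<gamma> = "mat2 (- d) (- 1) (d * d + d + 1) (1 + d)"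
      have g: "?g \<in> carrier SL2Z" by (simp add: carrier_SL2Z_iff)
      have "?\<gamma> \<in> \<Gamma>" unfolding \<Gamma>0 using d
        by (simp add: Gamma0_def carrier_SL2Z_iff cong_iff_dvd_diff algebra_simps)
      moreover have "?\<gamma> ** ?g = ?g ** matU"
        by (simp add: mat2_eq_iff mat2_mult_nth[of "mat2 _ _ _ _" "mat2 _ _ _ _"] algebra_simps)
      ultimately have "Gcoset \<Gamma> (?g ** matU) = Gcoset \<Gamma> ?g" using Gcoset_mult_left[OF _ g, of ?\<gamma>] by simp
      then show ?fix using g by blast
    qed
    then show ?thesis unfolding card by simp
  qed
  then show ?thesis using cokernel_iso kernel_manin_map by blast
qed

end
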